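(* Let $\mathcal H=L^2(D)$ with $D\subset\mathbb R^d$ a smooth bounded domain, let $A=-\Delta$ with $D(A)=H^1_0(D)\cap H^2(D)$, and let $T>0$. Let $\beta,\delta>0$, $\alpha>\frac d2$, $\gamma>\frac d2$, $m_0\in\mathcal H^{\alpha}$, $y\in\mathcal H$, let $\mu_0=\mathcal N(m_0,\beta A^{-\alpha})$ and $\mathcal C_1=\delta A^{-\gamma}$, and define $$\Phi(u;y)=\tfrac12\|\mathcal C_1^{-1/2}e^{-AT}u\|^2-\bigl\langle\mathcal C_1^{-1/2}e^{-\frac12AT}u,\;\mathcal C_1^{-1/2}e^{-\frac12AT}y\bigr\rangle,\qquad u\in\mathcal H.$$ Let $\mu$ and $\mu^N$ be the probability measures on $\mathcal H$ given by $$\frac{d\mu}{d\mu_0}(u)\propto\exp(-\Phi(u;y)),\qquad \frac{d\mu^N}{d\mu_0}(u)\propto\exp(-\Phi(P^Nu;y)),$$ where $P^N$ is the orthogonal projection in $\mathcal H$ onto the span of $\{\phi_k\}_{|k|\le N}$. Then there are constants $c_1>0$, $c_2>0$, independent of $N$, such that $$d_{\rm Hell}(\mu,\mu^N)\le c_1\exp(-c_2N^2).$$ Consequently the means of $\mu$ and $\mu^N$ are $\mathcal O(\exp(-c_2N^2))$ close in the $\mathcal H$ norm, and the covariance operators of $\mu$ and $\mu^N$ are $\mathcal O(\exp(-c_2N^2))$ close in the operator norm on $\mathcal H$.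
   Context: $\|\cdot\|$ and $\langle\cdot,\cdot\rangle$ are the norm and inner product of $\mathcal H=L^2(D)$. $\{(\phi_k,\lambda_k)\}_{k\in\mathbb K}$ is a complete orthonormal set of eigenfunctions in $\mathcal H$ and corresponding eigenvalues of $A$, indexed by multi-indices $k\in\mathbb K\subset\mathbb Z^d\setminus\{0\}$ so that $\lambda_k$ grows like $|k|^2$ (i.e. $c|k|^2\le\lambda_k\le C|k|^2$ for some $c,C>0$). Powers and the semigroup are defined spectrally: $A^au=\sum_k\lambda_k^a\langle u,\phi_k\rangle\phi_k$, $e^{-At}u=\sum_ke^{-\lambda_kt}\langle u,\phi_k\rangle\phi_k$; and $\mathcal H^s=\{u:\|u\|_s^2=\sum_k\lambda_k^s|\langle u,\phi_k\rangle|^2<\infty\}$. The measure $\mu$ is the posterior for the initial condition $u$ of $\frac{dv}{dt}+Av=0$, $v(0)=u$, with prior $\mu_0$ and observation $y=e^{-AT}u+\eta$, $\eta\sim\mathcal N(0,\mathcal C_1)$. The Hellinger distance between probability measures $\mu,\mu'$ both absolutely continuous with respect to $\nu$ is $$d_{\rm Hell}(\mu,\mu')=\Bigl(\tfrac12\int\Bigl(\sqrt{\tfrac{d\mu}{d\nu}}-\sqrt{\tfrac{d\mu'}{d\nu}}\Bigr)^2d\nu\Bigr)^{1/2}.$$ *)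

theory Defs
  imports "HOL-Probability.Probability" "HOL-Library.Landau_Symbols"
begin

section \<open>The Hilbert space of square-integrable real functions\<close>

text \<open>
  The type \<open>'a L2\<close> consists of the square-integrable Borel functions on the whole of \<open>'a\<close>, modulo
  equality almost everywhere.  A type cannot depend on a domain \<open>D\<close>, so the space of
  square-integrable functions on \<open>D\<close> is the closed subspace \<open>L2_on D\<close>, defined below, of functions
  vanishing almost everywhere outside \<open>D\<close>; that is, functions on \<open>D\<close> are extended by zero.
\<close>

definition square_integrable :: "('a::euclidean_space \<Rightarrow> real) \<Rightarrow> bool" where
  "square_integrable f \<longleftrightarrow> f \<in> borel_measurable borel \<and> integrable lborel (\<lambda>x. (f x)\<^sup>2)"

lemma square_integrable_measurable [measurable_dest]:
  "square_integrable f \<Longrightarrow> f \<in> borel_measurable borel"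
  by (simp add: square_integrable_def)

lemma square_integrable_mult:
  assumes "square_integrable f" "square_integrable g"
  shows "integrable lborel (\<lambda>x. f x * g x)"
proof (rule Bochner_Integration.integrable_bound)
  show "integrable lborel (\<lambda>x. (f x)\<^sup>2 + (g x)\<^sup>2)"
    using assms by (auto simp: square_integrable_def)
  show "(\<lambda>x. f x * g x) \<in> borel_measurable lborel"
    using assms by (auto simp: square_integrable_def)
  show "AE x in lborel. norm (f x * g x) \<le> norm ((f x)\<^sup>2 + (g x)\<^sup>2)"
  proof (rule AE_I2)
    fix x
    have "2 * \<bar>f x * g x\<bar> \<le> (f x)\<^sup>2 + (g x)\<^sup>2"
      using sum_squares_bound[of "\<bar>f x\<bar>" "\<bar>g x\<bar>"] by (simp add: abs_mult)
    then show "norm (f x * g x) \<le> norm ((f x)\<^sup>2 + (g x)\<^sup>2)" by simp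
  qed
qed

lemma square_integrable_0: "square_integrable (\<lambda>_. 0)"
  by (simp add: square_integrable_def)

lemma square_integrable_scale:
  assumes "square_integrable f" shows "square_integrable (\<lambda>x. c * f x)"
  using assms by (auto simp: square_integrable_def power_mult_distrib)

lemma square_integrable_add:
  assumes "square_integrable f" "square_integrable g"
  shows "square_integrable (\<lambda>x. f x + g x)"
  using assms square_integrable_mult[OF assms]
  by (auto simp: square_integrable_def power2_sum mult.assoc)

definition L2_rel :: "('a::euclidean_space \<Rightarrow> real) \<Rightarrow> ('a \<Rightarrow> real) \<Rightarrow> bool" where
  "L2_rel f g \<longleftrightarrow> square_integrable f \<and> square_integrable g \<and> (AE x in lborel. f x = g x)"

quotient_type (overloaded) 'a L2 = "'a::euclidean_space \<Rightarrow> real" / partial: L2_rel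
proof (rule part_equivpI)
  show "\<exists>x. L2_rel x x"
    using square_integrable_0 by (auto simp: L2_rel_def)
  show "symp L2_rel"
    by (auto simp: symp_def L2_rel_def)
  show "transp L2_rel"
    by (auto simp: transp_def L2_rel_def elim: AE_mp)
qed

instantiation L2 :: (euclidean_space) real_inner
begin

lift_definition zero_L2 :: "'a L2" is "\<lambda>_. 0"
  by (simp add: L2_rel_def square_integrable_0)

lift_definition plus_L2 :: "'a L2 \<Rightarrow> 'a L2 \<Rightarrow> 'a L2" is "\<lambda>f g x. f x + g x"
  by (auto simp: L2_rel_def square_integrable_add)

lift_definition scaleR_L2 :: "real \<Rightarrow> 'a L2 \<Rightarrow> 'a L2" is "\<lambda>c f x. c * f x"
  by (auto simp: L2_rel_def square_integrable_scale)

lift_definition inner_L2 :: "'a L2 \<Rightarrow> 'a L2 \<Rightarrow> real"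
  is "\<lambda>f g. (\<integral>x. f x * g x \<partial>lborel)"
  by (rule integral_cong_AE) (auto simp: L2_rel_def dest: square_integrable_measurable)

definition uminus_L2 :: "'a L2 \<Rightarrow> 'a L2" where "uminus_L2 u = (-1) *\<^sub>R u"
definition minus_L2 :: "'a L2 \<Rightarrow> 'a L2 \<Rightarrow> 'a L2" where "minus_L2 u v = u + (-1) *\<^sub>R v"
definition norm_L2 :: "'a L2 \<Rightarrow> real" where "norm_L2 u = sqrt (inner u u)"
definition sgn_L2 :: "'a L2 \<Rightarrow> 'a L2" where "sgn_L2 u = inverse (norm u) *\<^sub>R u"
definition dist_L2 :: "'a L2 \<Rightarrow> 'a L2 \<Rightarrow> real" where "dist_L2 u v = norm (u - v)"
definition uniformity_L2 :: "('a L2 \<times> 'a L2) filter"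
  where "uniformity_L2 = (INF e\<in>{0<..}. principal {(x, y). dist x y < e})"
definition open_L2 :: "'a L2 set \<Rightarrow> bool"
  where "open_L2 U \<longleftrightarrow> (\<forall>x\<in>U. eventually (\<lambda>(x', y). x' = x \<longrightarrow> y \<in> U) uniformity)"

instance
proof
  fix a b c :: "'a L2" and r s :: real
  show "a + b + c = a + (b + c)"
    by transfer (auto simp: L2_rel_def add.assoc intro!: square_integrable_add)
  show "a + b = b + a"
    by transfer (auto simp: L2_rel_def add.commute intro!: square_integrable_add)
  show "0 + a = a"
    by transfer (auto simp: L2_rel_def)
  show "- a + a = 0"
    unfolding uminus_L2_def
    by transfer (auto simp: L2_rel_def
        intro!: square_integrable_add square_integrable_scale square_integrable_0
                square_integrable_scale[where c="-1", simplified])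
  show "a - b = a + - b"
    by (simp add: minus_L2_def uminus_L2_def)
  show "r *\<^sub>R (a + b) = r *\<^sub>R a + r *\<^sub>R b"
    by transfer (auto simp: L2_rel_def distrib_left
        intro!: square_integrable_add square_integrable_scale)
  show "(r + s) *\<^sub>R a = r *\<^sub>R a + s *\<^sub>R a"
    by transfer (auto simp: L2_rel_def distrib_right
        intro!: square_integrable_add square_integrable_scale)
  show "r *\<^sub>R s *\<^sub>R a = (r * s) *\<^sub>R a"
    by transfer (auto simp: L2_rel_def mult.assoc
        intro!: square_integrable_scale)
  show "1 *\<^sub>R a = a"
    by transfer (auto simp: L2_rel_def)
  show "sgn a = inverse (norm a) *\<^sub>R a" by (rule sgn_L2_def)
  show "dist a b = norm (a - b)" by (rule dist_L2_def)
  show "uniformity = (INF e\<in>{0<..}. principal {(x, y :: 'a L2). dist x y < e})"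
    by (rule uniformity_L2_def)
  show "\<And>U :: 'a L2 set. open U \<longleftrightarrow> (\<forall>x\<in>U. eventually (\<lambda>(x', y). x' = x \<longrightarrow> y \<in> U) uniformity)"
    by (rule open_L2_def)
  show "inner a b = inner b a"
    by transfer (simp add: mult.commute)
  show "inner (a + b) c = inner a c + inner b c"
    by transfer (auto simp: L2_rel_def distrib_right square_integrable_mult)
  show "inner (r *\<^sub>R a) b = r * inner a b"
    by transfer (simp add: mult.assoc)
  show "0 \<le> inner a a"
    by transfer simp
  show "inner a a = 0 \<longleftrightarrow> a = 0"
  proof transfer
    fix f :: "'a \<Rightarrow> real" assume "L2_rel f f"
    then have f: "square_integrable f" by (simp add: L2_rel_def)
    have "(\<integral>x. f x * f x \<partial>lborel) = 0 \<longleftrightarrow> (AE x in lborel. f x * f x = 0)"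
      by (rule integral_nonneg_eq_0_iff_AE) (auto intro: square_integrable_mult f)
    then show "(\<integral>x. f x * f x \<partial>lborel) = 0 \<longleftrightarrow> L2_rel f (\<lambda>_. 0)"
      using f by (simp add: L2_rel_def square_integrable_0)
  qed
  show "norm a = sqrt (inner a a)" by (rule norm_L2_def)
qed

end

definition to_L2 :: "('a::euclidean_space \<Rightarrow> real) \<Rightarrow> 'a L2" where
  "to_L2 f = abs_L2 f"

lemma square_integrable_rep_L2 [simp]: "square_integrable (rep_L2 u)"
  using Quotient3_rep_reflp[OF Quotient3_L2, of u] by (simp add: L2_rel_def)

lemma to_L2_rep_L2 [simp]: "to_L2 (rep_L2 u) = u"
  unfolding to_L2_def by (rule Quotient3_abs_rep[OF Quotient3_L2])

lemma to_L2_eq_iff: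
  assumes "square_integrable f" "square_integrable g"
  shows "to_L2 f = to_L2 g \<longleftrightarrow> (AE x in lborel. f x = g x)"
  using Quotient3_rel[OF Quotient3_L2, of f g] assms by (simp add: to_L2_def L2_rel_def)

lemma rep_to_L2_AE:
  assumes "square_integrable f"
  shows "AE x in lborel. rep_L2 (to_L2 f) x = f x"
  using to_L2_eq_iff[of "rep_L2 (to_L2 f)" f] assms by simp

lemma to_L2_add:
  assumes "square_integrable f" "square_integrable g"
  shows "to_L2 (\<lambda>x. f x + g x) = to_L2 f + to_L2 g"
  unfolding to_L2_def using assms
  by (intro plus_L2.abs_eq[symmetric]) (auto simp: L2_rel_def)

lemma to_L2_scaleR:
  assumes "square_integrable f"
  shows "to_L2 (\<lambda>x. c * f x) = c *\<^sub>R to_L2 f"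
  unfolding to_L2_def using assms
  by (intro scaleR_L2.abs_eq[symmetric]) (auto simp: L2_rel_def)

lemma square_integrable_diff:
  assumes "square_integrable f" "square_integrable g"
  shows "square_integrable (\<lambda>x. f x - g x)"
  using square_integrable_add[OF assms(1) square_integrable_scale[OF assms(2), of "-1"]] by simp

lemma to_L2_diff:
  assumes "square_integrable f" "square_integrable g"
  shows "to_L2 (\<lambda>x. f x - g x) = to_L2 f - to_L2 g"
  using to_L2_add[OF assms(1) square_integrable_scale[OF assms(2), of "-1"]]
        to_L2_scaleR[OF assms(2), of "-1"] by simp

lemma inner_to_L2:
  assumes "square_integrable f" "square_integrable g"
  shows "inner (to_L2 f) (to_L2 g) = (\<integral>x. f x * g x \<partial>lborel)"
  unfolding to_L2_def using assms
  by (intro inner_L2.abs_eq) (auto simp: L2_rel_def)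

lemma inner_L2_rep: "inner u v = (\<integral>x. rep_L2 u x * rep_L2 v x \<partial>lborel)"
  using inner_to_L2[of "rep_L2 u" "rep_L2 v"] by simp

lemma norm_to_L2:
  assumes "square_integrable f"
  shows "(norm (to_L2 f))\<^sup>2 = (\<integral>x. (f x)\<^sup>2 \<partial>lborel)"
  unfolding power2_norm_eq_inner inner_to_L2[OF assms assms] by (simp add: power2_eq_square)

lemma nn_integral_to_L2:
  assumes "square_integrable f"
  shows "(\<integral>\<^sup>+x. ennreal ((f x)\<^sup>2) \<partial>lborel) = ennreal ((norm (to_L2 f))\<^sup>2)"
  unfolding norm_to_L2[OF assms]
  by (rule nn_integral_eq_integral) (use assms in \<open>auto simp: square_integrable_def\<close>)

lemma square_integrableI_nn_integral:
  assumes "f \<in> borel_measurable borel" "(\<integral>\<^sup>+x. ennreal ((f x)\<^sup>2) \<partial>lborel) < \<infinity>"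
  shows "square_integrable f"
  unfolding square_integrable_def using assms
  by (auto intro!: integrableI_nonneg)

subsection \<open>Completeness\<close>

instance L2 :: (euclidean_space) banach
proof
  fix X :: "nat \<Rightarrow> 'a L2" assume X: "Cauchy X"
  have "\<exists>N. \<forall>m\<ge>N. \<forall>n\<ge>N. dist (X m) (X n) < (1/4) ^ k" for k
    using X unfolding Cauchy_def by (metis zero_less_divide_1_iff zero_less_numeral zero_less_power)
  then obtain N where N: "\<And>k m n. m \<ge> N k \<Longrightarrow> n \<ge> N k \<Longrightarrow> dist (X m) (X n) < (1/4) ^ k"
    by metis
  define r where "r n = n + (\<Sum>k\<le>n. N k)" for n
  have r: "strict_mono r" by (rule strict_monoI_Suc) (simp add: r_def)
  have rN: "r m \<ge> N n" if "n \<le> m" for m n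
  proof -
    have "N n \<le> (\<Sum>k\<le>m. N k)" using that by (intro member_le_sum) auto
    then show ?thesis by (simp add: r_def)
  qed
  define g where "g n = rep_L2 (X (r n))" for n
  have g[simp]: "square_integrable (g n)" for n by (simp add: g_def)
  then have [measurable]: "g n \<in> borel_measurable borel" for n
    by (simp add: square_integrable_def)
  have g_norm: "(\<integral>\<^sup>+x. ennreal ((g m x - g n x)\<^sup>2) \<partial>lborel) = ennreal ((dist (X (r m)) (X (r n)))\<^sup>2)" for m n
    using nn_integral_to_L2[OF square_integrable_diff[OF g g]]
    by (simp add: to_L2_diff dist_norm) (simp add: g_def)
  have g_dist: "(\<integral>\<^sup>+x. ennreal ((g m x - g n x)\<^sup>2) \<partial>lborel) \<le> ennreal (((1/4) ^ k)\<^sup>2)"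
    if "k \<le> m" "k \<le> n" for k m n
    unfolding g_norm using N[OF rN rN, OF that]
    by (intro ennreal_leI power_mono) auto
  define A where "A n = {x. (1/4) ^ n \<le> (g (Suc n) x - g n x)\<^sup>2}" for n
  have [measurable]: "A n \<in> sets lborel" for n by (auto simp: A_def)
  have A: "emeasure lborel (A n) \<le> ennreal ((1/4) ^ n)" for n
  proof -
    have "emeasure lborel (A n)
        = emeasure lborel {x\<in>UNIV. 1 \<le> ennreal (4 ^ n) * ennreal ((g (Suc n) x - g n x)\<^sup>2)}"
      by (rule arg_cong[where f="emeasure lborel"])
        (auto simp: A_def power_one_over field_simps simp flip: ennreal_mult)
    also have "\<dots> \<le> ennreal (4 ^ n) * (\<integral>\<^sup>+x. ennreal ((g (Suc n) x - g n x)\<^sup>2) * indicator UNIV x \<partial>lborel)"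
      by (rule nn_integral_Markov_inequality) auto
    also have "\<dots> \<le> ennreal (4 ^ n) * ennreal (((1/4) ^ n)\<^sup>2)"
      using g_dist[of n "Suc n" n] by (intro mult_left_mono) auto
    also have "\<dots> = ennreal ((1/4) ^ n)"
      by (simp add: power2_eq_square power_one_over flip: ennreal_mult)
    finally show ?thesis .
  qed
  have "AE x in lborel. eventually (\<lambda>n. x \<in> space lborel - A n) sequentially"
  proof (rule borel_cantelli_AE1)
    show "A n \<in> sets lborel" for n by fact
    show "emeasure lborel (A n) < \<infinity>" for n
      using A[of n] by (rule order_le_less_trans) simp
    show "summable (\<lambda>n. measure lborel (A n))"
    proof (rule summable_comparison_test')
      show "summable (\<lambda>n. (1/4::real) ^ n)" by (rule summable_geometric) auto
      show "norm (measure lborel (A n)) \<le> (1/4) ^ n" if "0 \<le> n" for n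
        using A[of n] by (simp add: measure_def enn2real_leI)
    qed
  qed
  then have conv: "AE x in lborel. convergent (\<lambda>n. g n x)"
  proof eventually_elim
    case (elim x)
    have "summable (\<lambda>n. g (Suc n) x - g n x)"
    proof (rule summable_comparison_test_ev)
      show "summable (\<lambda>n. (1/2::real) ^ n)" by (rule summable_geometric) auto
      show "\<forall>\<^sub>F n in sequentially. norm (g (Suc n) x - g n x) \<le> (1/2) ^ n"
        using elim
      proof eventually_elim
        case (elim n)
        have "((1/2) ^ n)\<^sup>2 = (1/4 :: real) ^ n"
          by (simp add: power2_eq_square flip: power_mult_distrib)
        with elim have "\<bar>g (Suc n) x - g n x\<bar>\<^sup>2 \<le> ((1/2) ^ n)\<^sup>2"
          by (simp add: A_def)
        then show ?case
          by (simp add: power2_le_iff_abs_le del: power2_abs)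
      qed
    qed
    then have "convergent (\<lambda>n. \<Sum>k<n. g (Suc k) x - g k x)"
      by (simp add: summable_iff_convergent)
    then have "convergent (\<lambda>n. (g n x - g 0 x) + g 0 x)"
      by (intro convergent_add convergent_const) (simp add: sum_lessThan_telescope[of "\<lambda>n. g n x"])
    then show ?case by simp
  qed
  define f where "f x = lim (\<lambda>n. g n x)" for x
  have [measurable]: "f \<in> borel_measurable borel"
    unfolding f_def by (rule borel_measurable_lim_metric) simp
  have f: "AE x in lborel. (\<lambda>n. g n x) \<longlonglongrightarrow> f x"
    using conv by eventually_elim (simp add: f_def convergent_LIMSEQ_iff)
  have Fatou: "(\<integral>\<^sup>+x. ennreal ((f x - g n x)\<^sup>2) \<partial>lborel) \<le> ennreal (((1/4) ^ n)\<^sup>2)" for n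
  proof -
    have "(\<integral>\<^sup>+x. ennreal ((f x - g n x)\<^sup>2) \<partial>lborel)
        = (\<integral>\<^sup>+x. liminf (\<lambda>m. ennreal ((g m x - g n x)\<^sup>2)) \<partial>lborel)"
      using f
      by (intro nn_integral_cong_AE, eventually_elim)
         (auto intro!: lim_imp_Liminf[symmetric] tendsto_intros)
    also have "\<dots> \<le> liminf (\<lambda>m. \<integral>\<^sup>+x. ennreal ((g m x - g n x)\<^sup>2) \<partial>lborel)"
      by (rule nn_integral_liminf) auto
    also have "\<dots> \<le> liminf (\<lambda>m. ennreal (((1/4) ^ n)\<^sup>2))"
      by (rule Liminf_mono) (auto intro!: eventually_sequentiallyI[of n] g_dist)
    also have "\<dots> = ennreal (((1/4) ^ n)\<^sup>2)"
      by (rule Liminf_const) simp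
    finally show ?thesis .
  qed
  have "square_integrable (\<lambda>x. f x - g 0 x)"
    using Fatou[of 0] by (intro square_integrableI_nn_integral) (auto intro: order_le_less_trans)
  from square_integrable_add[OF this g, of 0] have f2: "square_integrable f" by simp
  have dist: "dist (X (r n)) (to_L2 f) \<le> (1/4) ^ n" for n
  proof -
    have "ennreal ((norm (to_L2 f - X (r n)))\<^sup>2) \<le> ennreal (((1/4) ^ n)\<^sup>2)"
      using Fatou[of n] nn_integral_to_L2[OF square_integrable_diff[OF f2 g], of n]
      by (simp add: to_L2_diff f2) (simp add: g_def)
    then have "(norm (to_L2 f - X (r n)))\<^sup>2 \<le> ((1/4) ^ n)\<^sup>2"
      by (subst (asm) ennreal_le_iff) auto
    then show ?thesis
      by (simp add: dist_norm norm_minus_commute power2_le_iff_abs_le)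
  qed
  have "(\<lambda>n. dist (X (r n)) (to_L2 f)) \<longlonglongrightarrow> 0"
    by (rule tendsto_sandwich[of "\<lambda>_. 0" _ _ "\<lambda>n. (1/4::real) ^ n"])
       (auto intro!: always_eventually LIMSEQ_realpow_zero simp: dist)
  then have "(X \<circ> r) \<longlonglongrightarrow> to_L2 f"
    by (simp add: tendsto_dist_iff[of "X \<circ> r"])
  then show "convergent X"
    using Cauchy_converges_subseq[OF X r] by (auto simp: convergent_def)
qed

subsection \<open>Separability\<close>

lemma to_L2_dominated:
  fixes f g :: "'a::euclidean_space \<Rightarrow> real"
  assumes g: "square_integrable g" and [measurable]: "f \<in> borel_measurable borel"
    and [measurable]: "\<And>n. s n \<in> borel_measurable borel"
    and bound: "\<And>n x. \<bar>s n x\<bar> \<le> g x" and lim: "\<And>x. (\<lambda>n. s n x) \<longlonglongrightarrow> f x"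
  shows "square_integrable f" "\<And>n. square_integrable (s n)"
    "(\<lambda>n. to_L2 (s n)) \<longlonglongrightarrow> to_L2 f"
proof -
  have g2: "integrable lborel (\<lambda>x. (g x)\<^sup>2)" and [measurable]: "g \<in> borel_measurable borel"
    using g by (auto simp: square_integrable_def)
  have fb: "\<bar>f x\<bar> \<le> g x" for x
    by (rule LIMSEQ_le_const2[OF tendsto_rabs[OF lim]]) (auto intro: bound)
  have sq: "square_integrable h" if "h \<in> borel_measurable borel" "\<And>x. \<bar>h x\<bar> \<le> g x" for h
    unfolding square_integrable_def
  proof (intro conjI that Bochner_Integration.integrable_bound[OF g2] AE_I2)
    show "(\<lambda>x. (h x)\<^sup>2) \<in> borel_measurable lborel" using that by simp
    fix x show "norm ((h x)\<^sup>2) \<le> norm ((g x)\<^sup>2)"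
      using power_mono[OF that(2)[of x], of 2] by simp
  qed
  show f: "square_integrable f" by (rule sq) (auto intro: fb)
  show s: "square_integrable (s n)" for n by (rule sq) (auto intro: bound)
  have "(\<lambda>n. \<integral>x. (s n x - f x)\<^sup>2 \<partial>lborel) \<longlonglongrightarrow> (\<integral>x. 0 \<partial>(lborel :: 'a measure))"
  proof (rule integral_dominated_convergence)
    show "integrable lborel (\<lambda>x. 4 * (g x)\<^sup>2)" using g2 by simp
    show "AE x in lborel. (\<lambda>n. (s n x - f x)\<^sup>2) \<longlonglongrightarrow> 0"
    proof (rule AE_I2)
      fix x
      have "(\<lambda>n. (s n x - f x)\<^sup>2) \<longlonglongrightarrow> (f x - f x)\<^sup>2" by (intro tendsto_intros lim)
      then show "(\<lambda>n. (s n x - f x)\<^sup>2) \<longlonglongrightarrow> 0" by simp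
    qed
    show "AE x in lborel. norm ((s n x - f x)\<^sup>2) \<le> 4 * (g x)\<^sup>2" for n
    proof (rule AE_I2)
      fix x
      have "\<bar>s n x - f x\<bar> \<le> 2 * g x" using bound[of n x] fb[of x] by linarith
      from power_mono[OF this, of 2]
      show "norm ((s n x - f x)\<^sup>2) \<le> 4 * (g x)\<^sup>2" by (simp add: power_mult_distrib)
    qed
  qed auto
  then have "(\<lambda>n. (norm (to_L2 (s n) - to_L2 f))\<^sup>2) \<longlonglongrightarrow> 0"
    using norm_to_L2[OF square_integrable_diff[OF s f]] by (simp add: to_L2_diff s f)
  then have "(\<lambda>n. norm (to_L2 (s n) - to_L2 f)) \<longlonglongrightarrow> 0"
    using tendsto_real_sqrt by fastforce
  then show "(\<lambda>n. to_L2 (s n)) \<longlonglongrightarrow> to_L2 f"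
    by (simp add: tendsto_norm_zero_iff LIM_zero_iff)
qed

lemma square_integrable_indicator:
  assumes "A \<in> sets borel" "emeasure lborel A < \<infinity>"
  shows "square_integrable (indicator A)"
  using assms by (auto simp: square_integrable_def power2_eq_square integrable_indicator_iff
      simp flip: indicator_inter_arith)

lemma subspace_closure_L2:
  fixes S :: "'a::euclidean_space L2 set"
  assumes "subspace S" shows "subspace (closure S)"
proof (rule subspaceI)
  show "0 \<in> closure S" using subspace_0[OF assms] closure_subset by blast
  fix u v assume u: "u \<in> closure S"
  then obtain f where f: "\<And>n. f n \<in> S" "f \<longlonglongrightarrow> u" by (auto simp: closure_sequential)
  show "u + v \<in> closure S" if v: "v \<in> closure S"
  proof -
    obtain g where g: "\<And>n. g n \<in> S" "g \<longlonglongrightarrow> v" using v by (auto simp: closure_sequential)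
    show ?thesis unfolding closure_sequential
      by (rule exI[of _ "\<lambda>n. f n + g n"]) (auto intro: subspace_add assms f g tendsto_add)
  qed
  show "c *\<^sub>R u \<in> closure S" for c unfolding closure_sequential
    by (rule exI[of _ "\<lambda>n. c *\<^sub>R f n"])
       (auto intro: subspace_scale assms f tendsto_scaleR tendsto_const)
qed

lemma countable_closure_span_L2:
  obtains S :: "'a::euclidean_space L2 set" where "countable S" "closure (span S) = UNIV"
proof -
  obtain B :: "'a set set" where B: "countable B" "topological_basis B"
    using ex_countable_basis by auto
  define G where "G = Inter ` {F. finite F \<and> F \<subseteq> B}"
  define Q :: "nat \<Rightarrow> 'a set" where "Q n = cball 0 (real n)" for n
  define ind where "ind A n = to_L2 (indicator (A \<inter> Q n))" for A n
  define S where "S = (\<lambda>(A, n). ind A n) ` (G \<times> UNIV)"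
  define V where "V = closure (span S)"
  have V: "subspace V" unfolding V_def by (intro subspace_closure_L2 subspace_span)
  have Vlim: "l \<in> V" if "\<And>n. x n \<in> V" "x \<longlonglongrightarrow> l" for x l
    using that closed_sequentially[of V x l] by (auto simp: V_def)
  have "countable G" unfolding G_def by (intro countable_image countable_Collect_finite_subset B)
  then have "countable S" by (auto simp: S_def)
  have "open b" if "b \<in> B" for b using topological_basis_open[OF B(2) that] .
  then have Gopen: "open A" if "A \<in> G" for A using that by (auto simp: G_def)
  have "B \<subseteq> G"
  proof
    fix b assume "b \<in> B"
    then have "b = Inter {b}" "finite {b}" "{b} \<subseteq> B" by auto
    then show "b \<in> G" unfolding G_def by blast
  qed
  have Int: "Int_stable G"
  proof (rule Int_stableI)
    fix a b assume "a \<in> G" "b \<in> G"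
    then obtain F F' where "finite F" "F \<subseteq> B" "a = \<Inter>F" "finite F'" "F' \<subseteq> B" "b = \<Inter>F'"
      by (auto simp: G_def)
    then have "a \<inter> b = \<Inter>(F \<union> F')" "finite (F \<union> F')" "F \<union> F' \<subseteq> B" by auto
    then show "a \<inter> b \<in> G" unfolding G_def by blast
  qed
  have borel: "sets borel = sigma_sets UNIV G"
  proof
    have "sets borel = sigma_sets UNIV B"
      unfolding borel_eq_countable_basis[OF B] by (rule sets_measure_of) simp
    also have "\<dots> \<subseteq> sigma_sets UNIV G" by (rule sigma_sets_mono') fact
    finally show "sets borel \<subseteq> sigma_sets UNIV G" .
    show "sigma_sets UNIV G \<subseteq> sets borel"
      using sets.sigma_sets_subset[of G borel] Gopen by (metis borel_open space_borel subsetI)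
  qed
  have [measurable]: "Q n \<in> sets borel" for n by (simp add: Q_def)
  have Qfin: "emeasure lborel (A \<inter> Q n) < \<infinity>" if "A \<in> sets borel" for A n
    by (rule order_le_less_trans[OF emeasure_mono[of _ "Q n"] emeasure_bounded_finite])
       (auto simp: Q_def)
  have sqi: "square_integrable (indicator (A \<inter> Q n) :: 'a \<Rightarrow> real)" if "A \<in> sets borel" for A n
    using that by (intro square_integrable_indicator Qfin) auto
  have ind_empty: "ind {} n = 0" for n
  proof -
    have "(indicator ({} \<inter> Q n) :: 'a \<Rightarrow> real) = (\<lambda>_. 0)" by (simp add: fun_eq_iff)
    then show ?thesis by (simp add: ind_def to_L2_def zero_L2.abs_eq)
  qed
  have U: "UNIV \<in> G" unfolding G_def by (auto intro!: image_eqI[of _ _ "{}"])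
  have ind: "ind A n \<in> V" if "A \<in> sets borel" for A n
    using Int Pow_UNIV[THEN equalityD2, THEN subset_trans[OF subset_UNIV]] that[unfolded borel]
  proof (induction rule: sigma_sets_induct_disjoint)
    case (basic A)
    then have "ind A n \<in> S" by (auto simp: S_def)
    then show ?case using closure_subset span_superset by (force simp: V_def)
  next
    case empty
    show ?case using subspace_0[OF V] ind_empty by simp
  next
    case (compl A)
    then have A: "A \<in> sets borel" by (simp add: borel)
    have "ind UNIV n \<in> S" using U by (auto simp: S_def)
    then have UV: "ind UNIV n \<in> V" using closure_subset span_superset by (force simp: V_def)
    have "ind (UNIV - A) n = to_L2 (\<lambda>x. indicator (UNIV \<inter> Q n) x - indicator (A \<inter> Q n) x)"
      unfolding ind_def by (rule arg_cong[where f=to_L2]) (auto simp: indicator_def fun_eq_iff)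
    also have "\<dots> = ind UNIV n - ind A n"
      unfolding ind_def using A by (intro to_L2_diff sqi) auto
    finally show ?case using subspace_diff[OF V UV compl(2)] by simp
  next
    case (union A)
    then have A: "A i \<in> sets borel" for i by (auto simp: borel)
    have step: "ind (\<Union>i<m. A i) n \<in> V" for m
    proof (induction m)
      case 0
      show ?case using subspace_0[OF V] ind_empty by simp
    next
      case (Suc m)
      have "A m \<inter> A i = {}" if "i < m" for i
        using union(1) that by (simp add: disjoint_family_on_def)
      then have "A m \<inter> (\<Union>i<m. A i) = {}" by blast
      then have "ind (\<Union>i<Suc m. A i) n
          = to_L2 (\<lambda>x. indicator ((\<Union>i<m. A i) \<inter> Q n) x + indicator (A m \<inter> Q n) x)"
        unfolding ind_def lessThan_Suc
        by (intro arg_cong[where f=to_L2]) (auto simp: indicator_def fun_eq_iff)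
      also have "\<dots> = ind (\<Union>i<m. A i) n + ind (A m) n"
        unfolding ind_def using A by (intro to_L2_add sqi) auto
      finally show ?case using subspace_add[OF V Suc union(3)] by simp
    qed
    have "(\<lambda>m. ind (\<Union>i<m. A i) n) \<longlonglongrightarrow> ind (\<Union>i. A i) n"
      unfolding ind_def
    proof (rule to_L2_dominated(3))
      show "square_integrable (indicator (UNIV \<inter> Q n) :: 'a \<Rightarrow> real)" by (rule sqi) auto
      fix x
      show "(\<lambda>m. indicator ((\<Union>i<m. A i) \<inter> Q n) x) \<longlonglongrightarrow> (indicator ((\<Union>i. A i) \<inter> Q n) x :: real)"
        unfolding indicator_inter_arith by (intro tendsto_mult tendsto_const LIMSEQ_indicator_UN)
      show "\<bar>indicator ((\<Union>i<m. A i) \<inter> Q n) x\<bar> \<le> (indicator (UNIV \<inter> Q n) x :: real)" for m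
        by (auto simp: indicator_def)
    qed (use A in auto)
    then show ?case by (rule Vlim[OF step])
  qed
  have "u \<in> V" for u
  proof -
    define f where "f = rep_L2 u"
    have f: "square_integrable f" "u = to_L2 f" by (simp_all add: f_def)
    then have fm [measurable]: "f \<in> borel_measurable borel" by (simp add: square_integrable_def)
    from borel_measurable_implies_sequence_metric[OF fm, of 0] obtain s where
      s: "\<And>i. simple_function borel (s i)"
      and slim: "\<And>x. (\<lambda>i. s i x) \<longlonglongrightarrow> f x"
      and sb: "\<And>i x. \<bar>s i x\<bar> \<le> 2 * \<bar>f x\<bar>"
      by (auto simp: dist_real_def)
    have [measurable]: "s i \<in> borel_measurable borel" for i
      using s by (rule borel_measurable_simple_function)
    define t where "t i x = s i x * indicator (Q i) x" for i x
    have [measurable]: "t i \<in> borel_measurable borel" for i unfolding t_def by measurable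
    have "to_L2 (t i) \<in> V" for i
    proof -
      have fin: "finite (range (s i))" using simple_functionD(1)[OF s] by simp
      have pre: "s i -` {y} \<in> sets borel" for y using simple_functionD(2)[OF s, of i "{y}"] by simp
      define h where "h y x = y * indicator ((s i -` {y}) \<inter> Q i) x" for y x
      have h: "square_integrable (h y)" "to_L2 (h y) \<in> V" for y
        unfolding h_def using subspace_scale[OF V ind[OF pre], of y y i]
        by (auto simp: to_L2_scaleR sqi pre ind_def intro!: square_integrable_scale)
      have sum: "square_integrable (\<lambda>x. \<Sum>y\<in>Y. h y x) \<and> to_L2 (\<lambda>x. \<Sum>y\<in>Y. h y x) \<in> V"
        if "finite Y" for Y
        using that
      proof (induction Y)
        case empty
        have "to_L2 (\<lambda>_. 0) = (0 :: 'a L2)" by (simp add: to_L2_def zero_L2.abs_eq)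
        then show ?case using subspace_0[OF V] by (simp add: square_integrable_0)
      next
        case (insert y Y)
        then show ?case
          using subspace_add[OF V h(2)] by (simp add: square_integrable_add to_L2_add h(1))
      qed
      have "t i = (\<lambda>x. \<Sum>y\<in>range (s i). h y x)"
      proof
        fix x
        have "(\<Sum>y\<in>range (s i). h y x) = (\<Sum>y\<in>range (s i). if y = s i x then t i x else 0)"
          by (rule sum.cong) (auto simp: t_def h_def indicator_def)
        then show "t i x = (\<Sum>y\<in>range (s i). h y x)" using fin by simp
      qed
      then show ?thesis using sum[OF fin] by simp
    qed
    moreover have "(\<lambda>i. to_L2 (t i)) \<longlonglongrightarrow> to_L2 f"
    proof (rule to_L2_dominated(3))
      have "square_integrable (\<lambda>x. \<bar>f x\<bar>)" using f(1) by (simp add: square_integrable_def)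
      then show "square_integrable (\<lambda>x. 2 * \<bar>f x\<bar>)" by (rule square_integrable_scale)
      fix x
      show "\<bar>t i x\<bar> \<le> 2 * \<bar>f x\<bar>" for i
        using sb[of i x] by (auto simp: t_def indicator_def)
      have "eventually (\<lambda>i. t i x = s i x) sequentially"
      proof (rule eventually_sequentiallyI)
        fix i assume "nat \<lceil>norm x\<rceil> \<le> i"
        then have "norm x \<le> real i" by linarith
        then show "t i x = s i x" by (simp add: t_def Q_def)
      qed
      then show "(\<lambda>i. t i x) \<longlonglongrightarrow> f x"
        using slim[of x] by (simp add: tendsto_cong)
    qed auto
    ultimately show "u \<in> V" unfolding f(2) by (rule Vlim)
  qed
  then have "closure (span S) = UNIV" by (auto simp: V_def)
  with \<open>countable S\<close> show thesis by (rule that)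
qed

instance L2 :: (euclidean_space) second_countable_topology
proof
  obtain S :: "'a L2 set" where S: "countable S" "closure (span S) = UNIV"
    by (rule countable_closure_span_L2)
  define R :: "'a L2 set" where
    "R = (\<lambda>l. sum_list (map (\<lambda>(q, s). of_rat q *\<^sub>R s) l)) ` lists (UNIV \<times> S)"
  have cR: "countable R" unfolding R_def using S(1) by auto
  have R_add: "u + v \<in> R" if uv: "u \<in> R" "v \<in> R" for u v
  proof -
    obtain l l' where l: "l \<in> lists (UNIV \<times> S)" "l' \<in> lists (UNIV \<times> S)"
      "u = sum_list (map (\<lambda>(q, s). of_rat q *\<^sub>R s) l)"
      "v = sum_list (map (\<lambda>(q, s). of_rat q *\<^sub>R s) l')"
      using uv unfolding R_def by blast
    show ?thesis unfolding R_def
      by (rule image_eqI[of _ _ "l @ l'"]) (use l in auto)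
  qed
  have R_scale: "of_rat p *\<^sub>R u \<in> R" if u: "u \<in> R" for u p
  proof -
    obtain l where l: "l \<in> lists (UNIV \<times> S)"
      "u = sum_list (map (\<lambda>(q, s). of_rat q *\<^sub>R s) l)"
      using u unfolding R_def by blast
    have "of_rat p *\<^sub>R sum_list (map (\<lambda>(q, s). of_rat q *\<^sub>R s) l)
        = sum_list (map (\<lambda>(q, s). of_rat q *\<^sub>R s) (map (\<lambda>(q, s). (p * q, s)) l))"
      by (induction l) (auto simp: scaleR_add_right of_rat_mult)
    then show ?thesis unfolding R_def
      by (intro image_eqI[of _ _ "map (\<lambda>(q, s). (p * q, s)) l"]) (use l in auto)
  qed
  have "subspace (closure R)"
  proof (rule subspaceI)
    have "0 \<in> R" unfolding R_def by (rule image_eqI[of _ _ "[]"]) auto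
    then show "0 \<in> closure R" using closure_subset by blast
    fix u v assume u: "u \<in> closure R"
    then obtain f where f: "\<And>n. f n \<in> R" "f \<longlonglongrightarrow> u" by (auto simp: closure_sequential)
    show "u + v \<in> closure R" if v: "v \<in> closure R"
    proof -
      obtain g where g: "\<And>n. g n \<in> R" "g \<longlonglongrightarrow> v" using v by (auto simp: closure_sequential)
      show ?thesis unfolding closure_sequential
        by (rule exI[of _ "\<lambda>n. f n + g n"]) (auto intro: R_add f g tendsto_add)
    qed
    fix c :: real
    have "c \<in> closure \<rat>" using Rats_closure_real by auto
    then obtain q where q: "\<And>n. q n \<in> \<rat>" "q \<longlonglongrightarrow> c" by (auto simp: closure_sequential)
    show "c *\<^sub>R u \<in> closure R" unfolding closure_sequential
    proof (rule exI[of _ "\<lambda>n. q n *\<^sub>R f n"], intro conjI allI)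
      show "q n *\<^sub>R f n \<in> R" for n
        using q(1)[of n] by (auto elim!: Rats_cases simp: R_scale f)
      show "(\<lambda>n. q n *\<^sub>R f n) \<longlonglongrightarrow> c *\<^sub>R u" by (intro tendsto_scaleR q f)
    qed
  qed
  moreover have "S \<subseteq> closure R"
  proof
    fix s assume "s \<in> S"
    then have "s \<in> R" unfolding R_def by (intro image_eqI[of _ _ "[(1, s)]"]) auto
    then show "s \<in> closure R" using closure_subset by blast
  qed
  ultimately have "span S \<subseteq> closure R" by (rule span_minimal[rotated])
  then have dense: "closure R = UNIV"
    using closure_minimal[of "span S" "closure R"] S(2) by auto
  define B where "B = (\<lambda>(s, n). ball s (1 / real (Suc n))) ` (R \<times> UNIV)"
  have "topological_basis B"
  proof (rule topological_basisI)
    show "open b" if "b \<in> B" for b using that by (auto simp: B_def)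
    fix U and x :: "'a L2" assume "open U" "x \<in> U"
    then obtain e where e: "e > 0" "ball x e \<subseteq> U" by (auto simp: open_contains_ball)
    then obtain n where n: "1 / real (Suc n) < e / 2"
      using nat_approx_posE[of "e/2"] by auto
    have "x \<in> closure R" by (simp add: dense)
    then obtain s where s: "s \<in> R" "dist s x < 1 / real (Suc n)"
      unfolding closure_approachable by (metis of_nat_0_less_iff zero_less_Suc zero_less_divide_1_iff)
    have "ball s (1 / real (Suc n)) \<subseteq> ball x e"
    proof
      fix z assume "z \<in> ball s (1 / real (Suc n))"
      then have "dist x z < 1 / real (Suc n) + 1 / real (Suc n)"
        using s(2) dist_triangle[of x z s] by (simp add: dist_commute)
      then show "z \<in> ball x e" using n by simp
    qed
    then show "\<exists>b\<in>B. x \<in> b \<and> b \<subseteq> U"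
      using s e by (intro bexI[of _ "ball s (1 / real (Suc n))"]) (auto simp: B_def)
  qed
  moreover have "countable B" unfolding B_def using cR by auto
  ultimately show "\<exists>B :: 'a L2 set set. countable B \<and> open = generate_topology B"
    using topological_basis_imp_subbasis by blast
qed

definition L2_on :: "'a::euclidean_space set \<Rightarrow> 'a L2 set" where
  "L2_on D = {u. AE x in lborel. x \<notin> D \<longrightarrow> rep_L2 u x = 0}"


section \<open>Smooth domains, Sobolev spaces and the Dirichlet Laplacian\<close>

definition partial :: "'a::euclidean_space \<Rightarrow> ('a \<Rightarrow> real) \<Rightarrow> 'a \<Rightarrow> real" where
  "partial i f x = frechet_derivative f (at x) i"

primrec Ck_on :: "nat \<Rightarrow> 'a::euclidean_space set \<Rightarrow> ('a \<Rightarrow> real) \<Rightarrow> bool" where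
  "Ck_on 0 S f \<longleftrightarrow> continuous_on S f"
| "Ck_on (Suc n) S f \<longleftrightarrow> (\<forall>x\<in>S. f differentiable at x) \<and> (\<forall>i\<in>Basis. Ck_on n S (partial i f))"

text \<open>Only meant for open \<open>S\<close>, since the derivatives are taken in the whole space.\<close>

definition smooth_on :: "'a::euclidean_space set \<Rightarrow> ('a \<Rightarrow> real) \<Rightarrow> bool" where
  "smooth_on S f \<longleftrightarrow> (\<forall>n. Ck_on n S f)"

text \<open>Smoothness of the boundary is expressed by local defining functions with non-zero gradient.\<close>

definition smooth_bounded_domain :: "'a::euclidean_space set \<Rightarrow> bool" where
  "smooth_bounded_domain D \<longleftrightarrow>
     open D \<and> connected D \<and> D \<noteq> {} \<and> bounded D \<and>
     (\<forall>p\<in>frontier D. \<exists>U \<rho>. open U \<and> p \<in> U \<and> smooth_on U \<rho> \<and>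
        (\<exists>i\<in>Basis. partial i \<rho> p \<noteq> 0) \<and> D \<inter> U = {x\<in>U. \<rho> x < 0})"

definition test_functions :: "'a::euclidean_space set \<Rightarrow> ('a \<Rightarrow> real) set" where
  "test_functions D =
     {\<psi>. smooth_on UNIV \<psi> \<and> compact (closure {x. \<psi> x \<noteq> 0}) \<and> closure {x. \<psi> x \<noteq> 0} \<subseteq> D}"

definition has_weak_partial :: "'a::euclidean_space set \<Rightarrow> 'a \<Rightarrow> 'a L2 \<Rightarrow> 'a L2 \<Rightarrow> bool" where
  "has_weak_partial D i u v \<longleftrightarrow> v \<in> L2_on D \<and>
     (\<forall>\<psi>\<in>test_functions D. inner u (to_L2 (partial i \<psi>)) = - inner v (to_L2 \<psi>))"

definition weak_partial :: "'a::euclidean_space set \<Rightarrow> 'a \<Rightarrow> 'a L2 \<Rightarrow> 'a L2" where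
  "weak_partial D i u = (THE v. has_weak_partial D i u v)"

definition H1 :: "'a::euclidean_space set \<Rightarrow> 'a L2 set" where
  "H1 D = {u\<in>L2_on D. \<forall>i\<in>Basis. \<exists>v. has_weak_partial D i u v}"

definition H2 :: "'a::euclidean_space set \<Rightarrow> 'a L2 set" where
  "H2 D = {u\<in>H1 D. \<forall>i\<in>Basis. weak_partial D i u \<in> H1 D}"

text \<open>The closure of the test functions in the norm of \<open>H1 D\<close>.\<close>

definition H1_0 :: "'a::euclidean_space set \<Rightarrow> 'a L2 set" where
  "H1_0 D = {u\<in>H1 D. \<exists>\<psi>. (\<forall>n::nat. \<psi> n \<in> test_functions D) \<and>
      (\<lambda>n. to_L2 (\<psi> n)) \<longlonglongrightarrow> u \<and>
      (\<forall>i\<in>Basis. (\<lambda>n. to_L2 (partial i (\<psi> n))) \<longlonglongrightarrow> weak_partial D i u)}"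

definition laplacian :: "'a::euclidean_space set \<Rightarrow> 'a L2 \<Rightarrow> 'a L2" where
  "laplacian D u = (\<Sum>i\<in>Basis. weak_partial D i (weak_partial D i u))"

definition multi_index_norm :: "int ^ 'd \<Rightarrow> real" where
  "multi_index_norm k = norm (\<chi> i. real_of_int (k $ i))"

text \<open>
  A complete orthonormal set of eigenfunctions \<open>\<phi>\<close> with eigenvalues \<open>lam\<close>, indexed by \<open>K\<close>, of the
  operator \<open>A = -\<Delta>\<close> on \<open>L2_on D\<close> with domain \<open>H1_0 D \<inter> H2 D\<close>.
\<close>

definition dirichlet_eigenbasis ::
  "(real ^ 'd) set \<Rightarrow> (int ^ 'd) set \<Rightarrow> (int ^ 'd \<Rightarrow> (real ^ 'd) L2) \<Rightarrow> (int ^ 'd \<Rightarrow> real) \<Rightarrow> bool" where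
  "dirichlet_eigenbasis D K \<phi> lam \<longleftrightarrow>
     0 \<notin> K \<and>
     (\<forall>k\<in>K. \<phi> k \<in> H1_0 D \<inter> H2 D \<and> - laplacian D (\<phi> k) = lam k *\<^sub>R \<phi> k) \<and>
     (\<forall>j\<in>K. \<forall>k\<in>K. inner (\<phi> j) (\<phi> k) = (if j = k then 1 else 0)) \<and>
     closure (span (\<phi> ` K)) = L2_on D \<and>
     (\<exists>c>0. \<exists>C>0. \<forall>k\<in>K. c * (multi_index_norm k)\<^sup>2 \<le> lam k \<and> lam k \<le> C * (multi_index_norm k)\<^sup>2)"


section \<open>Spectrally defined operators\<close>

text \<open>
  In the following, \<open>\<phi>\<close> is an orthonormal basis of eigenvectors indexed by \<open>K\<close>, and \<open>lam\<close> is the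
  family of eigenvalues of the operator of which the power or the semigroup is formed.
\<close>

definition spectral_op :: "'k set \<Rightarrow> ('k \<Rightarrow> 'h::real_inner) \<Rightarrow> ('k \<Rightarrow> real) \<Rightarrow> 'h \<Rightarrow> 'h" where
  "spectral_op K \<phi> g u = (\<Sum>\<^sub>\<infinity>k\<in>K. (g k * inner u (\<phi> k)) *\<^sub>R \<phi> k)"

definition op_power :: "'k set \<Rightarrow> ('k \<Rightarrow> 'h::real_inner) \<Rightarrow> ('k \<Rightarrow> real) \<Rightarrow> real \<Rightarrow> 'h \<Rightarrow> 'h" where
  "op_power K \<phi> lam a = spectral_op K \<phi> (\<lambda>k. lam k powr a)"

definition semigroup_op :: "'k set \<Rightarrow> ('k \<Rightarrow> 'h::real_inner) \<Rightarrow> ('k \<Rightarrow> real) \<Rightarrow> real \<Rightarrow> 'h \<Rightarrow> 'h" where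
  "semigroup_op K \<phi> lam t = spectral_op K \<phi> (\<lambda>k. exp (- lam k * t))"

definition sobolev_scale ::
  "'h set \<Rightarrow> 'k set \<Rightarrow> ('k \<Rightarrow> 'h::real_inner) \<Rightarrow> ('k \<Rightarrow> real) \<Rightarrow> real \<Rightarrow> 'h set" where
  "sobolev_scale H K \<phi> lam s = {u\<in>H. (\<lambda>k. lam k powr s * (inner u (\<phi> k))\<^sup>2) summable_on K}"

text \<open>\<open>\<C>\<^sub>1\<^sup>-\<^sup>1\<^sup>/\<^sup>2\<close> for \<open>\<C>\<^sub>1 = \<delta> A\<^sup>-\<^sup>\<gamma>\<close>, which has the eigenvalues \<open>\<delta> * lam k powr (-\<gamma>)\<close>.\<close>

definition noise_cov_inv_sqrt ::
  "'k set \<Rightarrow> ('k \<Rightarrow> 'h::real_inner) \<Rightarrow> ('k \<Rightarrow> real) \<Rightarrow> real \<Rightarrow> real \<Rightarrow> 'h \<Rightarrow> 'h" where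
  "noise_cov_inv_sqrt K \<phi> lam \<delta> \<gamma> = op_power K \<phi> (\<lambda>k. \<delta> * lam k powr (-\<gamma>)) (-1/2)"

definition potential ::
  "'k set \<Rightarrow> ('k \<Rightarrow> 'h::real_inner) \<Rightarrow> ('k \<Rightarrow> real) \<Rightarrow> real \<Rightarrow> real \<Rightarrow> real \<Rightarrow> 'h \<Rightarrow> 'h \<Rightarrow> real" where
  "potential K \<phi> lam T \<delta> \<gamma> y u =
     (let R = noise_cov_inv_sqrt K \<phi> lam \<delta> \<gamma>; S = semigroup_op K \<phi> lam in
      1/2 * (norm (R (S T u)))\<^sup>2 - inner (R (S (1/2 * T) u)) (R (S (1/2 * T) y)))"

definition orth_proj :: "'h::real_inner set \<Rightarrow> 'h \<Rightarrow> 'h" where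
  "orth_proj V u = (THE p. p \<in> V \<and> (\<forall>v\<in>V. inner (u - p) v = 0))"


section \<open>Measures on a Hilbert space\<close>

definition real_gaussian :: "real \<Rightarrow> real \<Rightarrow> real measure" where
  "real_gaussian m v =
     (if v = 0 then return borel m else density lborel (normal_density m (sqrt v)))"

text \<open>The Gaussian measure \<open>\<N>(m, C)\<close> on a closed subspace \<open>H\<close>.\<close>

definition gaussian_on ::
  "'h::real_inner set \<Rightarrow> 'h measure \<Rightarrow> 'h \<Rightarrow> ('h \<Rightarrow> 'h) \<Rightarrow> bool" where
  "gaussian_on H M m C \<longleftrightarrow>
     prob_space M \<and> sets M = sets (restrict_space borel H) \<and>
     (\<forall>h\<in>H. distr M borel (\<lambda>u. inner u h) = real_gaussian (inner m h) (inner (C h) h))"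

definition posterior :: "'h measure \<Rightarrow> ('h \<Rightarrow> real) \<Rightarrow> 'h measure" where
  "posterior M \<Phi> = density M (\<lambda>u. ennreal (exp (- \<Phi> u) / (\<integral>v. exp (- \<Phi> v) \<partial>M)))"

text \<open>Only meant for \<open>\<mu>\<close> and \<open>\<mu>'\<close> absolutely continuous with respect to \<open>\<nu>\<close>.\<close>

definition hellinger_dist :: "'h measure \<Rightarrow> 'h measure \<Rightarrow> 'h measure \<Rightarrow> real" where
  "hellinger_dist \<nu> \<mu> \<mu>' = sqrt (1/2 *
     (\<integral>u. (sqrt (enn2real (RN_deriv \<nu> \<mu> u)) - sqrt (enn2real (RN_deriv \<nu> \<mu>' u)))\<^sup>2 \<partial>\<nu>))"

definition mean_of :: "'h::{real_inner, banach, second_countable_topology} measure \<Rightarrow> 'h" where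
  "mean_of \<mu> = (\<integral>u. u \<partial>\<mu>)"

text \<open>
  For a measure on a closed subspace \<open>H\<close>, the covariance operator maps into \<open>H\<close> and vanishes on the
  orthogonal complement of \<open>H\<close>, so its operator norm on the whole space is the one on \<open>H\<close>.
\<close>

definition covariance_op ::
  "'h::{real_inner, banach, second_countable_topology} measure \<Rightarrow> 'h \<Rightarrow> 'h" where
  "covariance_op \<mu> h = (\<integral>u. inner (u - mean_of \<mu>) h *\<^sub>R (u - mean_of \<mu>) \<partial>\<mu>)"

end

theory Submission
  imports Defs
begin

text \<open>
  In the eigenbasis the potential is a sum over \<open>k\<close> of terms of size at most
  \<open>q k * (u\<^sub>k\<^sup>2 + y\<^sub>k\<^sup>2)\<close>, where \<open>q k = lam k powr \<gamma> / \<delta> * exp (- lam k * T)\<close>.  As \<open>lam k\<close> is of order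
  \<open>|k|\<^sup>2\<close>, discarding the modes with \<open>|k| > N\<close> changes it by at most \<open>exp (- c2 * N\<^sup>2)\<close> times a
  constant multiple of \<open>1 + \<parallel>u\<parallel>\<^sup>2\<close>.  Normalised densities, first and second moments are Lipschitz under
  such perturbations once \<open>(1 + \<parallel>u\<parallel>\<^sup>2)\<^sup>4\<close> and \<open>exp (- 2 \<Phi>)\<close> are integrable, uniformly in \<open>N\<close>.  Both
  bounds only use the one-dimensional marginals of the prior: \<open>- \<Phi>\<close> lies below a bounded linear
  functional, and the moment of the norm follows from those of the coordinates by the Cauchy-Schwarz
  inequality, since the lattice sum of \<open>|k|\<close> to the power \<open>- 2 \<alpha>\<close> converges.
\<close>

section \<open>Orthonormal systems and spectral operators\<close>

text \<open>The obstacle is the exponential weight. Completing the square in mode \<open>k\<close>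
  shows that the \<open>k\<close>-th term of \<Phi> can be as low as
  \<open>- lam k powr \<gamma> / \<delta> * y\<^sub>k\<^sup>2 / 2\<close>. For \<open>y\<close>
  merely square-integrable these minima need not have a finite sum, so \<open>exp (- \<Phi>)\<close>
  may be unbounded and has to be integrated rather than estimated pointwise. A perturbation of size
  \<open>1 + \<parallel>u\<parallel>\<^sup>2\<close>, tested against a second moment, produces the
  integrand \<open>(1 + \<parallel>u\<parallel>\<^sup>2)\<^sup>2 * exp (- \<Phi> u)\<close>; the
  inequality \<open>a * b \<le> a\<^sup>2 + b\<^sup>2\<close> separates its factors, and this is
  where the fourth power and \<open>exp (- 2 \<Phi>)\<close> come from. The rate comes from
  splitting \<open>exp (- lam k * T)\<close> into halves: one absorbs
  \<open>lam k powr \<gamma>\<close>, the other survives as decay. Sums over \<open>K\<close> are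
  unordered, whereas Fatou's lemma and the measurability of limits need sequences; the balls
  \<open>|k| \<le> N\<close> supply them.\<close>

locale orthonormal_system =
  fixes K :: "'k set" and \<phi> :: "'k \<Rightarrow> 'h::{real_inner, banach}"
  assumes orthonormal: "j \<in> K \<Longrightarrow> k \<in> K \<Longrightarrow> inner (\<phi> j) (\<phi> k) = (if j = k then 1 else 0)"
begin

lemma inner_sum_basis:
  assumes "finite F" "F \<subseteq> K" "j \<in> K"
  shows "inner (\<Sum>k\<in>F. a k *\<^sub>R \<phi> k) (\<phi> j) = (if j \<in> F then a j else 0)"
proof -
  have "inner (\<Sum>k\<in>F. a k *\<^sub>R \<phi> k) (\<phi> j) = (\<Sum>k\<in>F. if k = j then a k else 0)"
    unfolding inner_sum_left using assms
    by (intro sum.cong) (auto simp: orthonormal subset_iff)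
  then show ?thesis using assms by simp
qed

lemma norm_sum_basis:
  assumes "finite F" "F \<subseteq> K"
  shows "(norm (\<Sum>k\<in>F. a k *\<^sub>R \<phi> k))\<^sup>2 = (\<Sum>k\<in>F. (a k)\<^sup>2)"
proof -
  have "inner (\<Sum>k\<in>F. a k *\<^sub>R \<phi> k) (\<Sum>k\<in>F. a k *\<^sub>R \<phi> k)
      = (\<Sum>j\<in>F. a j * inner (\<Sum>k\<in>F. a k *\<^sub>R \<phi> k) (\<phi> j))"
    by (subst inner_sum_right) simp
  also have "\<dots> = (\<Sum>j\<in>F. (a j)\<^sup>2)"
    using assms by (intro sum.cong) (auto simp: inner_sum_basis power2_eq_square subset_iff)
  finally show ?thesis by (simp add: power2_norm_eq_inner)
qed

lemma Bessel_finite: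
  assumes "finite F" "F \<subseteq> K"
  shows "(\<Sum>k\<in>F. (inner u (\<phi> k))\<^sup>2) \<le> (norm u)\<^sup>2"
proof -
  define p where "p = (\<Sum>k\<in>F. inner u (\<phi> k) *\<^sub>R \<phi> k)"
  have "inner u p = (\<Sum>k\<in>F. (inner u (\<phi> k))\<^sup>2)"
    by (simp add: p_def inner_sum_right power2_eq_square)
  moreover have "inner p p = (\<Sum>k\<in>F. (inner u (\<phi> k))\<^sup>2)"
    using norm_sum_basis[OF assms, of "\<lambda>k. inner u (\<phi> k)"] by (simp add: p_def power2_norm_eq_inner)
  moreover have "0 \<le> inner (u - p) (u - p)" by simp
  ultimately show ?thesis
    by (simp add: inner_diff_left inner_diff_right inner_commute power2_norm_eq_inner)
qed

lemma coeff_summable: "(\<lambda>k. (inner u (\<phi> k))\<^sup>2) summable_on K"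
  by (rule nonneg_bdd_above_summable_on)
     (auto intro!: bdd_aboveI2[where M = "(norm u)\<^sup>2"] Bessel_finite)

lemma coeff_scaled_summable:
  assumes "\<And>k. k \<in> K \<Longrightarrow> \<bar>g k\<bar> \<le> B"
  shows "(\<lambda>k. (g k * inner u (\<phi> k))\<^sup>2) summable_on K"
proof (rule summable_on_comparison_test)
  show "(\<lambda>k. B\<^sup>2 * (inner u (\<phi> k))\<^sup>2) summable_on K"
    by (intro summable_on_cmult_right coeff_summable)
  show "(g k * inner u (\<phi> k))\<^sup>2 \<le> B\<^sup>2 * (inner u (\<phi> k))\<^sup>2" if "k \<in> K" for k
    using assms[OF that] unfolding power_mult_distrib
    by (intro mult_right_mono) (auto simp: abs_le_square_iff[symmetric])
qed simp

section \<open>Convergence of expansions in an orthonormal system\<close>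

text \<open>Riesz-Fischer for unordered sums: Pythagoras turns the Cauchy condition for the squares
  into that for the vectors, and the space is complete. Without it \<open>infsum\<close> in
  \<open>spectral_op\<close> could be the default 0.\<close>

lemma basis_series_summable:
  assumes "(\<lambda>k. (a k)\<^sup>2) summable_on K"
  shows "(\<lambda>k. a k *\<^sub>R \<phi> k) summable_on K"
proof -
  obtain l where l: "((\<lambda>k. (a k)\<^sup>2) has_sum l) K" using assms by (auto simp: summable_on_def)
  have "\<exists>P. eventually P (finite_subsets_at_top K) \<and>
      (\<forall>F F'. P F \<and> P F' \<longrightarrow> dist (\<Sum>k\<in>F. a k *\<^sub>R \<phi> k) (\<Sum>k\<in>F'. a k *\<^sub>R \<phi> k) < e)" if "e > 0" for e
  proof -
    \<comment> \<open>Two partial sums of squares within \<open>e\<^sup>2 / 8\<close> of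
      \<open>l\<close> differ by less than \<open>(e / 2)\<^sup>2\<close>. Pythagoras then gives
      distance below \<open>e / 2\<close> from the sum over \<open>X\<close>, and comparing through
      \<open>X\<close> gives \<open>e\<close>.\<close>
    have "\<forall>\<^sub>F F in finite_subsets_at_top K. dist (\<Sum>k\<in>F. (a k)\<^sup>2) l < e\<^sup>2 / 8"
      using that by (intro tendstoD[OF l[unfolded has_sum_def]]) simp
    then obtain X where X: "finite X" "X \<subseteq> K"
      and lt: "\<forall>Y. finite Y \<and> X \<subseteq> Y \<and> Y \<subseteq> K \<longrightarrow> dist (\<Sum>k\<in>Y. (a k)\<^sup>2) l < e\<^sup>2 / 8"
      unfolding eventually_finite_subsets_at_top by (elim exE conjE) 
    have near: "dist (\<Sum>k\<in>Y. a k *\<^sub>R \<phi> k) (\<Sum>k\<in>X. a k *\<^sub>R \<phi> k) < e / 2"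
      if Y: "finite Y" "X \<subseteq> Y" "Y \<subseteq> K" for Y
    proof -
      have "(\<Sum>k\<in>Y. a k *\<^sub>R \<phi> k) - (\<Sum>k\<in>X. a k *\<^sub>R \<phi> k) = (\<Sum>k\<in>Y-X. a k *\<^sub>R \<phi> k)"
        using Y by (simp add: sum_diff)
      moreover have "(norm (\<Sum>k\<in>Y-X. a k *\<^sub>R \<phi> k))\<^sup>2 = (\<Sum>k\<in>Y-X. (a k)\<^sup>2)"
        using Y by (intro norm_sum_basis) auto
      moreover have "\<dots> = (\<Sum>k\<in>Y. (a k)\<^sup>2) - (\<Sum>k\<in>X. (a k)\<^sup>2)"
        using Y by (simp add: sum_diff)
      moreover have "\<dots> < (e / 2)\<^sup>2"
      proof -
        have "e\<^sup>2 / 8 + e\<^sup>2 / 8 = (e / 2)\<^sup>2" by (simp add: power_divide)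
        moreover have "dist (\<Sum>k\<in>Y. (a k)\<^sup>2) l < e\<^sup>2 / 8" "dist (\<Sum>k\<in>X. (a k)\<^sup>2) l < e\<^sup>2 / 8"
          using lt X Y by blast+
        ultimately show ?thesis unfolding dist_real_def by linarith
      qed
      ultimately have "(dist (\<Sum>k\<in>Y. a k *\<^sub>R \<phi> k) (\<Sum>k\<in>X. a k *\<^sub>R \<phi> k))\<^sup>2 < (e / 2)\<^sup>2"
        by (simp add: dist_norm)
      then show ?thesis by (rule power_less_imp_less_base) (use \<open>e > 0\<close> in simp)
    qed
    show ?thesis
    proof (intro exI[of _ "\<lambda>Y. finite Y \<and> X \<subseteq> Y \<and> Y \<subseteq> K"] conjI allI impI)
      show "\<forall>\<^sub>F Y in finite_subsets_at_top K. finite Y \<and> X \<subseteq> Y \<and> Y \<subseteq> K"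
        unfolding eventually_finite_subsets_at_top by (rule exI[of _ X]) (use X in simp)
    next
      fix F F' assume "(finite F \<and> X \<subseteq> F \<and> F \<subseteq> K) \<and> finite F' \<and> X \<subseteq> F' \<and> F' \<subseteq> K"
      then show "dist (\<Sum>k\<in>F. a k *\<^sub>R \<phi> k) (\<Sum>k\<in>F'. a k *\<^sub>R \<phi> k) < e"
        using dist_triangle_half_l[OF near[of F] near[of F']] by blast
    qed
  qed
  then have "cauchy_filter (filtermap (sum (\<lambda>k. a k *\<^sub>R \<phi> k)) (finite_subsets_at_top K))"
    by (simp add: cauchy_filter_metric_filtermap)
  moreover have "uniform_space_class.complete (UNIV :: 'h set)"
    by (rule complete_UNIV)
  ultimately obtain L where "(sum (\<lambda>k. a k *\<^sub>R \<phi> k) \<longlongrightarrow> L) (finite_subsets_at_top K)"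
    using complete_uniform[where S = UNIV] by (force simp add: filterlim_def)
  then show ?thesis using summable_on_def has_sum_def by blast
qed

lemma has_sum_inner_basis_series:
  assumes "(\<lambda>k. (a k)\<^sup>2) summable_on K"
  shows "((\<lambda>k. a k * inner (\<phi> k) v) has_sum inner (\<Sum>\<^sub>\<infinity>k\<in>K. a k *\<^sub>R \<phi> k) v) K"
  using has_sum_bounded_linear[OF bounded_linear_inner_left
      has_sum_infsum[OF basis_series_summable[OF assms]], of v]
  by simp

lemma inner_basis_series_basis:
  assumes "(\<lambda>k. (a k)\<^sup>2) summable_on K" "j \<in> K"
  shows "inner (\<Sum>\<^sub>\<infinity>k\<in>K. a k *\<^sub>R \<phi> k) (\<phi> j) = a j"
proof -
  have "((\<lambda>k. a k * inner (\<phi> k) (\<phi> j)) has_sum a j) K"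
    using assms(2) by (intro has_sum_finite_neutralI[of "{j}"]) (auto simp: orthonormal)
  then show ?thesis
    using has_sum_inner_basis_series[OF assms(1), of "\<phi> j"] has_sum_unique by blast
qed

lemma has_sum_inner_spectral_op:
  assumes "\<And>k. k \<in> K \<Longrightarrow> \<bar>g k\<bar> \<le> B"
  shows "((\<lambda>k. g k * inner u (\<phi> k) * inner v (\<phi> k)) has_sum inner (spectral_op K \<phi> g u) v) K"
  using has_sum_inner_basis_series[OF coeff_scaled_summable[OF assms], where v = v]
  by (simp add: spectral_op_def inner_commute)

lemma inner_spectral_op_basis:
  assumes "\<And>k. k \<in> K \<Longrightarrow> \<bar>g k\<bar> \<le> B" "j \<in> K"
  shows "inner (spectral_op K \<phi> g u) (\<phi> j) = g j * inner u (\<phi> j)"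
  unfolding spectral_op_def
  by (rule inner_basis_series_basis[OF coeff_scaled_summable[OF assms(1)] assms(2)])

text \<open>Only the inner multiplier is bounded: the two series agree term by term, whether or not
  the outer one converges. This admits the square root of the inverse noise covariance as outer
  factor, whose multiplier is a positive power of the eigenvalues.\<close>

lemma spectral_op_compose:
  assumes "\<And>k. k \<in> K \<Longrightarrow> \<bar>g k\<bar> \<le> B"
  shows "spectral_op K \<phi> f (spectral_op K \<phi> g u) = spectral_op K \<phi> (\<lambda>k. f k * g k) u"
  unfolding spectral_op_def[of K \<phi> f] spectral_op_def[of K \<phi> "\<lambda>k. f k * g k"]
  by (intro infsum_cong) (simp add: inner_spectral_op_basis[OF assms])

lemma has_sum_inner_spectral_op2:
  assumes f: "\<And>k. k \<in> K \<Longrightarrow> \<bar>f k\<bar> \<le> B" and g: "\<And>k. k \<in> K \<Longrightarrow> \<bar>g k\<bar> \<le> C"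
  shows "((\<lambda>k. f k * g k * inner u (\<phi> k) * inner v (\<phi> k))
    has_sum inner (spectral_op K \<phi> f u) (spectral_op K \<phi> g v)) K"
proof -
  have "((\<lambda>k. f k * inner u (\<phi> k) * inner (spectral_op K \<phi> g v) (\<phi> k))
      has_sum inner (spectral_op K \<phi> f u) (spectral_op K \<phi> g v)) K"
    by (rule has_sum_inner_spectral_op[OF f])
  moreover have "f k * inner u (\<phi> k) * inner (spectral_op K \<phi> g v) (\<phi> k)
      = f k * g k * inner u (\<phi> k) * inner v (\<phi> k)" if "k \<in> K" for k
    using inner_spectral_op_basis[where g = g and B = C and j = k and u = v] g that by simp
  ultimately show ?thesis by (simp cong: has_sum_cong)
qed

text \<open>The expansion \<open>p\<close> of \<open>u\<close> has the same coefficients as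
  \<open>u\<close>. So \<open>u - p\<close> is orthogonal to all basis vectors, by continuity to
  their closed span and thus to \<open>u\<close>, and by expanding \<open>p\<close> also to
  \<open>p\<close>. Hence \<open>u = p\<close>, and \<open>inner u u\<close> can be
  expanded.\<close>

lemma Parseval:
  assumes "u \<in> closure (span (\<phi> ` K))"
  shows "((\<lambda>k. (inner u (\<phi> k))\<^sup>2) has_sum (norm u)\<^sup>2) K"
proof -
  define p where "p = spectral_op K \<phi> (\<lambda>_. 1) u"
  have p: "inner p (\<phi> k) = inner u (\<phi> k)" if "k \<in> K" for k
    using that unfolding p_def by (subst inner_spectral_op_basis[where B = 1]) auto
  have "span (\<phi> ` K) \<subseteq> {x. inner (u - p) x = 0}"
    by (rule span_minimal)
       (auto simp: inner_diff_left p subspace_def inner_add_right)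
  moreover have "closed {x. inner (u - p) x = 0}"
    by (intro closed_Collect_eq continuous_intros)
  ultimately have "inner (u - p) u = 0"
    using assms closure_minimal by blast
  moreover have "inner p (u - p) = 0"
  proof -
    have "((\<lambda>k. 1 * inner u (\<phi> k) * inner (u - p) (\<phi> k)) has_sum inner p (u - p)) K"
      using has_sum_inner_spectral_op[where g = "\<lambda>_. 1" and B = 1 and u = u and v = "u - p"]
      unfolding p_def[symmetric] by auto
    moreover have "((\<lambda>k. 1 * inner u (\<phi> k) * inner (u - p) (\<phi> k)) has_sum 0) K"
      by (rule has_sum_0) (simp add: inner_diff_left p)
    ultimately show ?thesis using has_sum_unique by blast
  qed
  ultimately have "inner (u - p) (u - p) = 0"
    by (simp only: inner_diff_left inner_diff_right inner_commute)
  then have "spectral_op K \<phi> (\<lambda>_. 1) u = u" by (simp add: p_def)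
  then show ?thesis
    using has_sum_inner_spectral_op[where g = "\<lambda>_. 1" and B = 1 and u = u and v = u]
    by (simp add: dot_square_norm power2_eq_square)
qed

text \<open>\<open>orth_proj\<close> is a definite description, so uniqueness is part of the proof:
  the difference of two candidates lies in the span and is orthogonal to itself.\<close>

lemma orth_proj_span:
  assumes "finite F" "F \<subseteq> K"
  shows "orth_proj (span (\<phi> ` F)) u = (\<Sum>k\<in>F. inner u (\<phi> k) *\<^sub>R \<phi> k)"
proof -
  define q where "q = (\<Sum>k\<in>F. inner u (\<phi> k) *\<^sub>R \<phi> k)"
  have orth: "inner (u - q) (\<phi> k) = 0" if "k \<in> F" for k
    using inner_sum_basis[of F k "\<lambda>k. inner u (\<phi> k)"] assms that
    by (auto simp: inner_diff_left q_def)
  have "span (\<phi> ` F) \<subseteq> {x. inner (u - q) x = 0}"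
    by (intro span_minimal subspaceI)
       (auto simp only: orth image_subset_iff mem_Collect_eq inner_add_right inner_scaleR_right inner_zero_right)
  then have q: "inner (u - q) v = 0" if "v \<in> span (\<phi> ` F)" for v
    using that by blast
  have in_span: "q \<in> span (\<phi> ` F)"
    unfolding q_def by (intro span_sum span_scale span_base imageI)
  have "p = q" if p: "p \<in> span (\<phi> ` F)" "\<forall>v\<in>span (\<phi> ` F). inner (u - p) v = 0" for p
  proof -
    have d: "q - p \<in> span (\<phi> ` F)" by (intro span_diff in_span p)
    have "inner (q - p) (q - p) = inner (u - p) (q - p) - inner (u - q) (q - p)"
      by (simp only: inner_diff_left)
    also have "\<dots> = 0" using q[OF d] p(2) d by auto
    finally show "p = q" by simp
  qed
  then show ?thesis
    unfolding orth_proj_def q_def[symmetric] using q in_span by (intro the_equality) blast+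
qed

end

section \<open>Stability of posterior measures\<close>

text \<open>A mean value estimate with the sum of the exponentials in place of their maximum, so
  that integrals split into one per potential.\<close>

lemma exp_diff_le: "\<bar>exp a - exp b\<bar> \<le> \<bar>a - b\<bar> * (exp a + exp b)" for a b :: real
proof -
  have *: "\<bar>exp a - exp b\<bar> \<le> \<bar>a - b\<bar> * (exp a + exp b)" if "a \<le> b" for a b :: real
  proof -
    have "1 - exp (a - b) \<le> b - a" using exp_ge_add_one_self[of "a - b"] by linarith
    then have "exp b * (1 - exp (a - b)) \<le> exp b * (b - a)" by (intro mult_left_mono) auto
    also have "exp b * (1 - exp (a - b)) = exp b - exp a"
      by (simp add: algebra_simps flip: exp_add)
    finally have "exp b - exp a \<le> (b - a) * exp b" by (simp add: mult.commute)
    also have "\<dots> \<le> (b - a) * (exp a + exp b)" using that by (intro mult_left_mono) auto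
    finally show ?thesis using that by simp
  qed
  show ?thesis
    using *[of a b] *[of b a] by (cases "a \<le> b") (auto simp: abs_minus_commute add.commute)
qed

lemma norm_le_one_plus_sq: "norm u \<le> 1 + (norm u)\<^sup>2" for u :: "'a::real_normed_vector"
  using sum_power2_ge_zero[of "norm u - 1" "norm u"] by (simp add: power2_diff)

text \<open>The Landau estimate needs the absolute value. \<open>onorm\<close> is a supremum of
  reals, so its sign is known only once the quotients are bounded above; the quotient at 0, which is
  0 because division by zero yields 0, then gives nonnegativity.\<close>

lemma abs_onorm_le:
  fixes F :: "'a::real_normed_vector \<Rightarrow> 'b::real_normed_vector"
  assumes "0 \<le> b" "\<And>x. norm (F x) \<le> b * norm x"
  shows "\<bar>onorm F\<bar> \<le> b"
proof -
  have "bdd_above (range (\<lambda>x. norm (F x) / norm x))"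
  proof (rule bdd_aboveI2)
    show "norm (F x) / norm x \<le> b" for x
      using assms by (cases "x = 0") (simp_all add: pos_divide_le_eq)
  qed
  then have "norm (F 0) / norm (0 :: 'a) \<le> onorm F" unfolding onorm_def by (rule cSUP_upper[rotated]) simp
  then show ?thesis using onorm_bound[OF assms] by simp
qed

lemma integral_le_of_nn_integral_le:
  fixes f :: "'a \<Rightarrow> real"
  assumes [measurable]: "f \<in> borel_measurable M" and "\<And>u. 0 \<le> f u" "0 \<le> b"
    and le: "(\<integral>\<^sup>+u. ennreal (f u) \<partial>M) \<le> ennreal b"
  shows "integrable M f" "(\<integral>u. f u \<partial>M) \<le> b"
proof -
  show int: "integrable M f"
    using le assms by (intro integrableI_nonneg) (auto intro: order_le_less_trans)
  have "ennreal (\<integral>u. f u \<partial>M) = (\<integral>\<^sup>+u. ennreal (f u) \<partial>M)"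
    using assms int by (intro nn_integral_eq_integral[symmetric]) auto
  with le have "ennreal (\<integral>u. f u \<partial>M) \<le> ennreal b" by (simp only:)
  then show "(\<integral>u. f u \<partial>M) \<le> b" by (simp only: ennreal_le_iff[OF \<open>0 \<le> b\<close>])
qed

text \<open>Separates the second moment from the rank-one part given by the mean, so that both can
  be compared between two posteriors independently.\<close>

lemma covariance_op_eq:
  fixes \<mu> :: "'h::{real_inner, banach, second_countable_topology} measure"
  assumes "prob_space \<mu>" and id: "(\<lambda>u. u) \<in> borel_measurable \<mu>"
    and sq: "integrable \<mu> (\<lambda>u. (norm u)\<^sup>2)"
  shows "covariance_op \<mu> h = (\<integral>u. inner u h *\<^sub>R u \<partial>\<mu>) - inner (mean_of \<mu>) h *\<^sub>R mean_of \<mu>"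
proof -
  interpret prob_space \<mu> by fact
  note [measurable] = id
  define m where "m = mean_of \<mu>"
  have 1: "integrable \<mu> (\<lambda>u. u)"
  proof (rule Bochner_Integration.integrable_bound)
    show "integrable \<mu> (\<lambda>u. 1 + (norm u)\<^sup>2)" using sq by simp
    show "AE u in \<mu>. norm u \<le> norm (1 + (norm u)\<^sup>2)" by (simp add: norm_le_one_plus_sq)
  qed simp
  have 2: "integrable \<mu> (\<lambda>u. inner u h *\<^sub>R u)"
  proof (rule Bochner_Integration.integrable_bound)
    show "integrable \<mu> (\<lambda>u. norm h * (norm u)\<^sup>2)" using sq by simp
    have "\<bar>inner u h\<bar> * norm u \<le> norm u * norm h * norm u" for u
      by (intro mult_right_mono Cauchy_Schwarz_ineq2) auto
    then show "AE u in \<mu>. norm (inner u h *\<^sub>R u) \<le> norm (norm h * (norm u)\<^sup>2)"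
      by (simp add: power2_eq_square ac_simps)
  qed simp
  have 3: "integrable \<mu> (\<lambda>u. inner u h)" using 1 by simp
  have "covariance_op \<mu> h
      = (\<integral>u. (inner u h *\<^sub>R u - inner u h *\<^sub>R m) - (inner m h *\<^sub>R u - inner m h *\<^sub>R m) \<partial>\<mu>)"
    unfolding covariance_op_def m_def[symmetric]
    by (intro Bochner_Integration.integral_cong) (auto simp: inner_diff_left algebra_simps)
  also have "\<dots> = (\<integral>u. inner u h *\<^sub>R u \<partial>\<mu>) - inner (\<integral>u. u \<partial>\<mu>) h *\<^sub>R m
      - (inner m h *\<^sub>R (\<integral>u. u \<partial>\<mu>) - inner m h *\<^sub>R m)"
    using 1 2 3 by (simp add: prob_space)
  finally show ?thesis by (simp add: mean_of_def m_def)
qed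

section \<open>Integrability and normalisation of posterior densities\<close>

locale fourth_moment_space = prob_space M
  for M :: "'h::{real_inner, banach, second_countable_topology} measure" +
  assumes ident_measurable [measurable]: "(\<lambda>u. u) \<in> borel_measurable M"
    and moment: "integrable M (\<lambda>u. (1 + (norm u)\<^sup>2) ^ 4)"
begin

text \<open>The constants are parameters so that one pair can serve a potential and all its
  truncations: \<open>L\<close> bounds normalisers from below, \<open>B\<close> enters the upper
  bounds of weighted integrals.\<close>

definition admissible :: "real \<Rightarrow> real \<Rightarrow> ('h \<Rightarrow> real) \<Rightarrow> bool" where
  "admissible L B g \<longleftrightarrow> g \<in> borel_measurable M \<and>
     (\<forall>u\<in>space M. \<bar>g u\<bar> \<le> L * (1 + (norm u)\<^sup>2)) \<and>
     integrable M (\<lambda>u. exp (- 2 * g u)) \<and> (\<integral>u. exp (- 2 * g u) \<partial>M) \<le> B"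

definition moment_bound :: "real \<Rightarrow> real" where
  "moment_bound B = (\<integral>u. (1 + (norm u)\<^sup>2) ^ 4 \<partial>M) + B"

definition normalizer_bound :: "real \<Rightarrow> real" where
  "normalizer_bound L = (\<integral>u. exp (- (L * (1 + (norm u)\<^sup>2))) \<partial>M)"

lemma admissible_measurable: "admissible L B g \<Longrightarrow> g \<in> borel_measurable M"
  by (simp add: admissible_def)

text \<open>The range of \<open>i\<close> is what the comparison consumes: 0 for normalisers, 1 for
  a single weight, 2 where the weight of the perturbation meets that of the integrand. The weight
  and the exponential are decoupled by \<open>a * b \<le> a\<^sup>2 + b\<^sup>2\<close>.\<close>

lemma weighted_integrable:
  assumes g: "admissible L B g" and "i \<le> 2"
  shows "integrable M (\<lambda>u. (1 + (norm u)\<^sup>2) ^ i * exp (- g u))"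
    and "(\<integral>u. (1 + (norm u)\<^sup>2) ^ i * exp (- g u) \<partial>M) \<le> moment_bound B"
proof -
  note [measurable] = admissible_measurable[OF g]
  have dom: "integrable M (\<lambda>u. (1 + (norm u)\<^sup>2) ^ 4 + exp (- 2 * g u))"
    using moment g by (auto simp: admissible_def)
  have le: "(1 + (norm u)\<^sup>2) ^ i * exp (- g u) \<le> (1 + (norm u)\<^sup>2) ^ 4 + exp (- 2 * g u)" for u
  proof -
    define v where "v = (1 + (norm u)\<^sup>2)\<^sup>2"
    have "(1 + (norm u)\<^sup>2) ^ i \<le> v" unfolding v_def using assms(2) by (intro power_increasing) auto
    then have "(1 + (norm u)\<^sup>2) ^ i * exp (- g u) \<le> v * exp (- g u)" by (intro mult_right_mono) auto
    also have "\<dots> \<le> v\<^sup>2 + (exp (- g u))\<^sup>2"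
    proof -
      have "0 \<le> v * exp (- g u)" by (simp add: v_def)
      then show ?thesis using sum_squares_bound[of v "exp (- g u)"] by linarith
    qed
    also have "\<dots> = (1 + (norm u)\<^sup>2) ^ 4 + exp (- 2 * g u)"
      by (simp add: v_def flip: exp_double)
    finally show ?thesis .
  qed
  show int: "integrable M (\<lambda>u. (1 + (norm u)\<^sup>2) ^ i * exp (- g u))"
    by (rule Bochner_Integration.integrable_bound[OF dom]) (auto intro!: AE_I2 order_trans[OF le])
  have "(\<integral>u. (1 + (norm u)\<^sup>2) ^ i * exp (- g u) \<partial>M)
      \<le> (\<integral>u. (1 + (norm u)\<^sup>2) ^ 4 + exp (- 2 * g u) \<partial>M)"
    by (intro integral_mono int dom le)
  also have "\<dots> \<le> moment_bound B"
    using moment g by (auto simp: admissible_def moment_bound_def)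
  finally show "(\<integral>u. (1 + (norm u)\<^sup>2) ^ i * exp (- g u) \<partial>M) \<le> moment_bound B" .
qed

lemmas exp_integrable = weighted_integrable(1)[where i = 0, simplified]

lemma normalizer_bound_pos:
  assumes "L \<ge> 0"
  shows "0 < normalizer_bound L"
proof -
  have int: "integrable M (\<lambda>u. exp (- (L * (1 + (norm u)\<^sup>2))))"
    by (rule integrable_const_bound[where B = 1]) (use assms in auto)
  have "normalizer_bound L \<noteq> 0"
  proof
    assume "normalizer_bound L = 0"
    then have "AE u in M. exp (- (L * (1 + (norm u)\<^sup>2))) = 0"
      unfolding normalizer_bound_def using int by (subst (asm) integral_nonneg_eq_0_iff_AE) auto
    then have "AE u in M. False" by simp
    then show False using prob_space by (simp add: AE_False)
  qed
  moreover have "0 \<le> normalizer_bound L" unfolding normalizer_bound_def by simp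
  ultimately show ?thesis by linarith
qed

lemma normalizer_lower:
  assumes g: "admissible L B g" and "L \<ge> 0"
  shows "normalizer_bound L \<le> (\<integral>u. exp (- g u) \<partial>M)"
  unfolding normalizer_bound_def
proof (rule integral_mono)
  show "integrable M (\<lambda>u. exp (- (L * (1 + (norm u)\<^sup>2))))"
    by (rule integrable_const_bound[where B = 1]) (use assms in auto)
  show "exp (- (L * (1 + (norm u)\<^sup>2))) \<le> exp (- g u)" if "u \<in> space M" for u
    using g that by (force simp: admissible_def)
qed (rule exp_integrable[OF g])

lemma normalizer_pos:
  assumes g: "admissible L B g" and "L \<ge> 0"
  shows "0 < (\<integral>u. exp (- g u) \<partial>M)"
  using normalizer_lower[OF assms] normalizer_bound_pos[OF assms(2)] by linarith

lemma integral_posterior: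
  fixes F :: "'h \<Rightarrow> 'b::{banach, second_countable_topology}"
  assumes g: "admissible L B g" and "L \<ge> 0" and [measurable]: "F \<in> borel_measurable M"
  shows "integrable (posterior M g) F
      \<longleftrightarrow> integrable M (\<lambda>u. (exp (- g u) / (\<integral>v. exp (- g v) \<partial>M)) *\<^sub>R F u)"
    and "(\<integral>u. F u \<partial>posterior M g)
      = (\<integral>u. (exp (- g u) / (\<integral>v. exp (- g v) \<partial>M)) *\<^sub>R F u \<partial>M)"
proof -
  note [measurable] = admissible_measurable[OF g]
  have "AE u in M. 0 \<le> exp (- g u) / (\<integral>v. exp (- g v) \<partial>M)" by simp
  then show "integrable (posterior M g) F
      \<longleftrightarrow> integrable M (\<lambda>u. (exp (- g u) / (\<integral>v. exp (- g v) \<partial>M)) *\<^sub>R F u)"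
    and "(\<integral>u. F u \<partial>posterior M g)
      = (\<integral>u. (exp (- g u) / (\<integral>v. exp (- g v) \<partial>M)) *\<^sub>R F u \<partial>M)"
    unfolding posterior_def by (simp_all add: integrable_density integral_density)
qed

lemma prob_space_posterior:
  assumes g: "admissible L B g" and "L \<ge> 0"
  shows "prob_space (posterior M g)"
proof
  note [measurable] = admissible_measurable[OF g]
  let ?Z = "\<integral>v. exp (- g v) \<partial>M"
  have "emeasure (posterior M g) (space (posterior M g)) = (\<integral>\<^sup>+u. ennreal (exp (- g u) / ?Z) \<partial>M)"
    unfolding posterior_def by (subst emeasure_density) (auto intro!: nn_integral_cong)
  also have "\<dots> = ennreal (\<integral>u. exp (- g u) / ?Z \<partial>M)"
    using exp_integrable[OF g] normalizer_pos[OF assms] by (intro nn_integral_eq_integral) auto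
  also have "\<dots> = 1" using normalizer_pos[OF assms] by simp
  finally show "emeasure (posterior M g) (space (posterior M g)) = 1" .
qed

lemma integrable_posterior_sq:
  assumes g: "admissible L B g" and "L \<ge> 0"
  shows "integrable (posterior M g) (\<lambda>u. (norm u)\<^sup>2)"
proof -
  note [measurable] = admissible_measurable[OF g]
  have "integrable M (\<lambda>u. (norm u)\<^sup>2 * exp (- g u))"
    by (rule Bochner_Integration.integrable_bound[OF weighted_integrable(1)[OF g, of 1]])
       (auto intro!: AE_I2 mult_right_mono)
  then have "integrable M (\<lambda>u. (1 / (\<integral>v. exp (- g v) \<partial>M)) * ((norm u)\<^sup>2 * exp (- g u)))" by simp
  then show ?thesis
    by (subst integral_posterior(1)[OF assms]) (auto simp: ac_simps)
qed

section \<open>Lipschitz dependence of posteriors on the potential\<close>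

lemma hellinger_posterior_le:
  assumes f: "admissible L B f" and g: "admissible L B g" and "L \<ge> 0" "\<epsilon> \<ge> 0"
    and diff: "\<And>u. u \<in> space M \<Longrightarrow> \<bar>f u - g u\<bar> \<le> \<epsilon> * (1 + (norm u)\<^sup>2)"
  shows "hellinger_dist M (posterior M f) (posterior M g)
    \<le> sqrt (moment_bound B / (2 * normalizer_bound L)) * \<epsilon>"
proof -
  note [measurable] = admissible_measurable[OF f] admissible_measurable[OF g]
  define Zf Zg where "Zf = (\<integral>v. exp (- f v) \<partial>M)" and "Zg = (\<integral>v. exp (- g v) \<partial>M)"
  define z where "z = normalizer_bound L"
  have z: "0 < z" "z \<le> Zf" "z \<le> Zg"
    using normalizer_bound_pos normalizer_lower f g \<open>L \<ge> 0\<close> by (auto simp: z_def Zf_def Zg_def)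
  define s t where "s u = exp (- f u / 2)" and "t u = exp (- g u / 2)" for u
  have [measurable]: "s \<in> borel_measurable M" "t \<in> borel_measurable M"
    unfolding s_def t_def by measurable
  have s2: "(s u)\<^sup>2 = exp (- f u)" and t2: "(t u)\<^sup>2 = exp (- g u)" for u
    by (auto simp: s_def t_def simp flip: exp_double)
  have st_pos: "0 < s u" "0 < t u" for u by (auto simp: s_def t_def)
  have int_s: "integrable M (\<lambda>u. (s u)\<^sup>2)" and int_t: "integrable M (\<lambda>u. (t u)\<^sup>2)"
    using exp_integrable[OF f] exp_integrable[OF g] by (simp_all add: s2 t2)
  have int_st: "integrable M (\<lambda>u. s u * t u)"
  proof (rule Bochner_Integration.integrable_bound)
    show "integrable M (\<lambda>u. (s u)\<^sup>2 + (t u)\<^sup>2)" using int_s int_t by simp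
    show "AE u in M. norm (s u * t u) \<le> norm ((s u)\<^sup>2 + (t u)\<^sup>2)"
    proof (rule AE_I2)
      fix u
      show "norm (s u * t u) \<le> norm ((s u)\<^sup>2 + (t u)\<^sup>2)"
        using sum_squares_bound[of "s u" "t u"] mult_pos_pos[OF st_pos[of u]] by simp
    qed
  qed simp
  define E where "E = (\<integral>u. s u * t u \<partial>M)"
  define D where "D = (\<integral>u. (s u - t u)\<^sup>2 \<partial>M)"
  have D_eq: "D = Zf + Zg - 2 * E"
    using int_s int_t int_st
    by (simp add: D_def E_def power2_diff Zf_def Zg_def s2[symmetric] t2[symmetric] mult.assoc)
  have D_le: "D \<le> \<epsilon>\<^sup>2 * moment_bound B"
  proof -
    \<comment> \<open>The halved exponents contribute \<open>\<epsilon> / 2\<close>, squared to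
      \<open>\<epsilon>\<^sup>2 / 4\<close>; the inequality
      \<open>(s + t)\<^sup>2 \<le> 2 * (s\<^sup>2 + t\<^sup>2)\<close> doubles this.\<close>
    have "D \<le> (\<integral>u. (\<epsilon>\<^sup>2 / 2) * ((1 + (norm u)\<^sup>2)\<^sup>2 * exp (- f u) + (1 + (norm u)\<^sup>2)\<^sup>2 * exp (- g u)) \<partial>M)"
      unfolding D_def
    proof (rule integral_mono)
      show "integrable M (\<lambda>u. (s u - t u)\<^sup>2)"
        using int_s int_t int_st by (simp add: power2_diff mult.assoc)
      show "integrable M (\<lambda>u. (\<epsilon>\<^sup>2 / 2) * ((1 + (norm u)\<^sup>2)\<^sup>2 * exp (- f u) + (1 + (norm u)\<^sup>2)\<^sup>2 * exp (- g u)))"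
        using weighted_integrable(1)[OF f, of 2] weighted_integrable(1)[OF g, of 2] by simp
      fix u assume u: "u \<in> space M"
      have "\<bar>s u - t u\<bar> \<le> \<bar>- f u / 2 - - g u / 2\<bar> * (s u + t u)"
        unfolding s_def t_def by (rule exp_diff_le)
      also have "\<bar>- f u / 2 - - g u / 2\<bar> \<le> \<epsilon> * (1 + (norm u)\<^sup>2) / 2"
        using diff[OF u] by (simp add: abs_if split: if_splits)
      finally have "\<bar>s u - t u\<bar> \<le> \<epsilon> * (1 + (norm u)\<^sup>2) / 2 * (s u + t u)"
        using st_pos[of u] by (simp add: mult_right_mono)
      then have "(s u - t u)\<^sup>2 \<le> (\<epsilon> * (1 + (norm u)\<^sup>2) / 2 * (s u + t u))\<^sup>2"
        using power_mono[of "\<bar>s u - t u\<bar>" _ 2] by simp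
      also have "\<dots> = (\<epsilon> * (1 + (norm u)\<^sup>2))\<^sup>2 / 4 * (s u + t u)\<^sup>2"
        by (simp add: power_mult_distrib power_divide)
      also have "\<dots> \<le> (\<epsilon> * (1 + (norm u)\<^sup>2))\<^sup>2 / 4 * (2 * ((s u)\<^sup>2 + (t u)\<^sup>2))"
        using sum_squares_bound[of "s u" "t u"] by (intro mult_left_mono) (auto simp: power2_sum)
      finally show "(s u - t u)\<^sup>2
          \<le> (\<epsilon>\<^sup>2 / 2) * ((1 + (norm u)\<^sup>2)\<^sup>2 * exp (- f u) + (1 + (norm u)\<^sup>2)\<^sup>2 * exp (- g u))"
        unfolding s2 t2 power_mult_distrib by (simp only: distrib_left mult.assoc) (simp add: ac_simps)
    qed
    also have "\<dots> = (\<epsilon>\<^sup>2 / 2) * ((\<integral>u. (1 + (norm u)\<^sup>2)\<^sup>2 * exp (- f u) \<partial>M)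
        + (\<integral>u. (1 + (norm u)\<^sup>2)\<^sup>2 * exp (- g u) \<partial>M))"
      using weighted_integrable(1)[OF f, of 2] weighted_integrable(1)[OF g, of 2] by simp
    also have "\<dots> \<le> (\<epsilon>\<^sup>2 / 2) * (moment_bound B + moment_bound B)"
      using weighted_integrable(2)[OF f, of 2] weighted_integrable(2)[OF g, of 2]
      by (intro mult_left_mono add_mono) auto
    finally show ?thesis by simp
  qed
  \<comment> \<open>\<open>RN_deriv\<close> is an unspecified version of the density; almost
    everywhere it may be replaced by the explicit quotient.\<close>
  have RN: "AE u in M. ennreal (exp (- f u) / Zf) = RN_deriv M (posterior M f) u"
    "AE u in M. ennreal (exp (- g u) / Zg) = RN_deriv M (posterior M g) u"
    unfolding posterior_def Zf_def Zg_def by (auto intro!: RN_deriv_unique)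
  have "(\<integral>u. (sqrt (enn2real (RN_deriv M (posterior M f) u))
        - sqrt (enn2real (RN_deriv M (posterior M g) u)))\<^sup>2 \<partial>M)
      = (\<integral>u. (s u / sqrt Zf - t u / sqrt Zg)\<^sup>2 \<partial>M)"
  proof (rule integral_cong_AE)
    show "AE u in M. (sqrt (enn2real (RN_deriv M (posterior M f) u))
        - sqrt (enn2real (RN_deriv M (posterior M g) u)))\<^sup>2 = (s u / sqrt Zf - t u / sqrt Zg)\<^sup>2"
      using RN
    proof eventually_elim
      case (elim u)
      have "sqrt (exp (- f u)) = s u" "sqrt (exp (- g u)) = t u"
        using st_pos[of u] by (simp_all flip: s2 t2)
      then show ?case using z by (simp flip: elim add: real_sqrt_divide)
    qed
  qed measurable
  also have "\<dots> = (\<integral>u. (s u)\<^sup>2 / Zf + (t u)\<^sup>2 / Zg - (2 / sqrt (Zf * Zg)) * (s u * t u) \<partial>M)"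
    using z by (intro Bochner_Integration.integral_cong)
      (auto simp: power2_diff power_divide real_sqrt_mult)
  also have "\<dots> = 2 - (2 / sqrt (Zf * Zg)) * E"
    using int_s int_t int_st z unfolding E_def
    by (simp add: Zf_def[symmetric] Zg_def[symmetric] s2 t2)
  finally have hell: "hellinger_dist M (posterior M f) (posterior M g) = sqrt (1 - E / sqrt (Zf * Zg))"
    by (simp add: hellinger_dist_def)
  have zz: "z \<le> sqrt (Zf * Zg)"
    using z by (intro real_le_rsqrt) (auto simp: power2_eq_square intro!: mult_mono)
  have "2 * sqrt (Zf * Zg) \<le> Zf + Zg"
    using arith_geo_mean_sqrt[of Zf Zg] z by simp
  then have "sqrt (Zf * Zg) - E \<le> D / 2" using D_eq by simp
  then have "(sqrt (Zf * Zg) - E) / sqrt (Zf * Zg) \<le> D / 2 / sqrt (Zf * Zg)"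
    by (rule divide_right_mono) (use zz z(1) in linarith)
  moreover have "(sqrt (Zf * Zg) - E) / sqrt (Zf * Zg) = 1 - E / sqrt (Zf * Zg)"
    using z by (simp add: diff_divide_distrib)
  ultimately have "1 - E / sqrt (Zf * Zg) \<le> D / 2 / sqrt (Zf * Zg)" by simp
  also have "\<dots> \<le> D / 2 / z"
  proof (rule divide_left_mono[OF zz])
    show "0 \<le> D / 2" by (simp add: D_def)
    show "0 < sqrt (Zf * Zg) * z" by (rule mult_pos_pos) (use zz z(1) in linarith)+
  qed
  also have "\<dots> \<le> \<epsilon>\<^sup>2 * moment_bound B / 2 / z"
    using D_le z(1) by (intro divide_right_mono) auto
  finally have "sqrt (1 - E / sqrt (Zf * Zg)) \<le> sqrt (moment_bound B / (2 * z) * \<epsilon>\<^sup>2)"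
    by (intro real_sqrt_le_mono) (simp add: ac_simps)
  then show ?thesis using \<open>\<epsilon> \<ge> 0\<close> unfolding hell z_def[symmetric] real_sqrt_mult by simp
qed

text \<open>A total variation estimate weighted by
  \<open>1 + \<parallel>u\<parallel>\<^sup>2\<close>, which controls every observable of quadratic
  growth at once. The term \<open>2 * W / z\<close> comes from the change of the exponential,
  \<open>2 * W\<^sup>2 / z\<^sup>2\<close> from the change of the normaliser.\<close>

lemma posterior_density_diff_le:
  assumes f: "admissible L B f" and g: "admissible L B g" and "L \<ge> 0" "\<epsilon> \<ge> 0"
    and diff: "\<And>u. u \<in> space M \<Longrightarrow> \<bar>f u - g u\<bar> \<le> \<epsilon> * (1 + (norm u)\<^sup>2)"
  defines "W \<equiv> moment_bound B" and "z \<equiv> normalizer_bound L"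
  defines "\<rho> \<equiv> \<lambda>f u. exp (- f u) / (\<integral>v. exp (- f v) \<partial>M)"
  shows "(\<integral>u. \<bar>\<rho> f u - \<rho> g u\<bar> * (1 + (norm u)\<^sup>2) \<partial>M) \<le> (2 * W / z + 2 * W\<^sup>2 / z\<^sup>2) * \<epsilon>"
proof -
  note [measurable] = admissible_measurable[OF f] admissible_measurable[OF g]
  define Zf Zg where "Zf = (\<integral>v. exp (- f v) \<partial>M)" and "Zg = (\<integral>v. exp (- g v) \<partial>M)"
  have z: "0 < z" "z \<le> Zf" "z \<le> Zg"
    using normalizer_bound_pos normalizer_lower f g \<open>L \<ge> 0\<close> by (auto simp: z_def Zf_def Zg_def)
  let ?V = "\<lambda>u :: 'h. 1 + (norm u)\<^sup>2"
  note If = weighted_integrable[OF f, folded W_def] and Ig = weighted_integrable[OF g, folded W_def]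
  have exp_diff: "\<bar>exp (- f u) - exp (- g u)\<bar> \<le> \<epsilon> * (?V u * exp (- f u) + ?V u * exp (- g u))"
    if "u \<in> space M" for u
  proof -
    have "\<bar>exp (- f u) - exp (- g u)\<bar> \<le> \<bar>- f u - - g u\<bar> * (exp (- f u) + exp (- g u))"
      by (rule exp_diff_le)
    also have "\<dots> \<le> (\<epsilon> * ?V u) * (exp (- f u) + exp (- g u))"
      using diff[OF that] by (intro mult_right_mono) (auto simp: abs_minus_commute)
    finally show ?thesis by (simp add: algebra_simps)
  qed
  have Wnn: "0 \<le> W"
    using If(2)[of 0] z Zf_def by simp
  have Z_diff: "\<bar>Zf - Zg\<bar> \<le> \<epsilon> * (2 * W)"
  proof -
    have "\<bar>Zf - Zg\<bar> = \<bar>\<integral>u. exp (- f u) - exp (- g u) \<partial>M\<bar>"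
      using exp_integrable[OF f] exp_integrable[OF g] by (simp add: Zf_def Zg_def)
    also have "\<dots> \<le> (\<integral>u. \<bar>exp (- f u) - exp (- g u)\<bar> \<partial>M)" by (rule integral_abs_bound)
    also have "\<dots> \<le> (\<integral>u. \<epsilon> * (?V u * exp (- f u) + ?V u * exp (- g u)) \<partial>M)"
      using exp_integrable[OF f] exp_integrable[OF g] If(1)[of 1] Ig(1)[of 1]
      by (intro integral_mono exp_diff) auto
    also have "\<dots> \<le> \<epsilon> * (W + W)"
      using If[of 1] Ig[of 1] \<open>\<epsilon> \<ge> 0\<close> by (simp add: mult_left_mono add_mono)
    finally show ?thesis by simp
  qed
  have pt: "\<bar>\<rho> f u - \<rho> g u\<bar> * ?V u \<le> \<epsilon> / z * ((?V u)\<^sup>2 * exp (- f u) + (?V u)\<^sup>2 * exp (- g u))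
      + \<epsilon> * (2 * W) / z\<^sup>2 * (?V u * exp (- g u))" if u: "u \<in> space M" for u
  proof -
    \<comment> \<open>Inserting \<open>exp (- g u) / Zf\<close> separates the change of numerator
      from the change of normaliser.\<close>
    have "\<rho> f u - \<rho> g u = (exp (- f u) - exp (- g u)) / Zf + exp (- g u) * (Zg - Zf) / (Zf * Zg)"
      using z unfolding \<rho>_def Zf_def[symmetric] Zg_def[symmetric] by (simp add: field_simps)
    then have "\<bar>\<rho> f u - \<rho> g u\<bar>
        \<le> \<bar>exp (- f u) - exp (- g u)\<bar> / Zf + exp (- g u) * \<bar>Zf - Zg\<bar> / (Zf * Zg)"
      using z abs_triangle_ineq[of "(exp (- f u) - exp (- g u)) / Zf" "exp (- g u) * (Zg - Zf) / (Zf * Zg)"]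
      by (simp add: abs_mult abs_divide abs_minus_commute)
    also have "\<dots> \<le> \<epsilon> * (?V u * exp (- f u) + ?V u * exp (- g u)) / z
        + exp (- g u) * (\<epsilon> * (2 * W)) / z\<^sup>2"
      unfolding power2_eq_square[of z]
      using z exp_diff[OF u] Z_diff \<open>\<epsilon> \<ge> 0\<close> Wnn
      by (intro add_mono frac_le mult_mono mult_left_mono) auto
    finally have "\<bar>\<rho> f u - \<rho> g u\<bar> * ?V u \<le> (\<epsilon> * (?V u * exp (- f u) + ?V u * exp (- g u)) / z
        + exp (- g u) * (\<epsilon> * (2 * W)) / z\<^sup>2) * ?V u"
      by (intro mult_right_mono) auto
    also have "\<dots> = \<epsilon> / z * ((?V u)\<^sup>2 * exp (- f u) + (?V u)\<^sup>2 * exp (- g u))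
      + \<epsilon> * (2 * W) / z\<^sup>2 * (?V u * exp (- g u))"
      unfolding power2_eq_square[of "?V u"] by (simp add: algebra_simps add_divide_distrib)
    finally show ?thesis .
  qed
  have "(\<integral>u. \<bar>\<rho> f u - \<rho> g u\<bar> * ?V u \<partial>M)
      \<le> (\<integral>u. \<epsilon> / z * ((?V u)\<^sup>2 * exp (- f u) + (?V u)\<^sup>2 * exp (- g u))
      + \<epsilon> * (2 * W) / z\<^sup>2 * (?V u * exp (- g u)) \<partial>M)"
    by (rule integral_mono')
       (use If(1)[of 2] Ig(1)[of 2] Ig(1)[of 1] pt \<open>\<epsilon> \<ge> 0\<close> z Wnn in
         \<open>auto intro!: add_nonneg_nonneg mult_nonneg_nonneg divide_nonneg_nonneg\<close>)
  also have "\<dots> = \<epsilon> / z * ((\<integral>u. (?V u)\<^sup>2 * exp (- f u) \<partial>M) + (\<integral>u. (?V u)\<^sup>2 * exp (- g u) \<partial>M))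
      + \<epsilon> * (2 * W) / z\<^sup>2 * (\<integral>u. ?V u * exp (- g u) \<partial>M)"
    using If(1)[of 2] Ig(1)[of 2] Ig(1)[of 1] by simp
  also have "\<dots> \<le> \<epsilon> / z * (W + W) + \<epsilon> * (2 * W) / z\<^sup>2 * W"
    using If(2)[of 2] Ig(2)[of 2] Ig(2)[of 1] \<open>\<epsilon> \<ge> 0\<close> z Wnn
    by (intro add_mono mult_left_mono) auto
  also have "\<dots> = (2 * W / z + 2 * W\<^sup>2 / z\<^sup>2) * \<epsilon>"
    by (simp add: power2_eq_square algebra_simps)
  finally show ?thesis .
qed

text \<open>Used with \<open>F u = u\<close> for the mean and with
  \<open>F u = inner u h *\<^sub>R u\<close> for the second moment.\<close>

lemma posterior_expectation_diff_le:
  fixes F :: "'h \<Rightarrow> 'h"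
  assumes f: "admissible L B f" and g: "admissible L B g" and "L \<ge> 0" "\<epsilon> \<ge> 0"
    and diff: "\<And>u. u \<in> space M \<Longrightarrow> \<bar>f u - g u\<bar> \<le> \<epsilon> * (1 + (norm u)\<^sup>2)"
    and [measurable]: "F \<in> borel_measurable M"
    and F: "\<And>u. norm (F u) \<le> c * (1 + (norm u)\<^sup>2)" and "c \<ge> 0"
  defines "W \<equiv> moment_bound B" and "z \<equiv> normalizer_bound L"
  shows "norm ((\<integral>u. F u \<partial>posterior M f) - (\<integral>u. F u \<partial>posterior M g))
      \<le> c * (2 * W / z + 2 * W\<^sup>2 / z\<^sup>2) * \<epsilon>"
proof -
  note [measurable] = admissible_measurable[OF f] admissible_measurable[OF g]
  define \<rho> :: "('h \<Rightarrow> real) \<Rightarrow> 'h \<Rightarrow> real"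
    where "\<rho> f u = exp (- f u) / (\<integral>v. exp (- f v) \<partial>M)" for f u
  have [measurable]: "\<rho> f \<in> borel_measurable M" "\<rho> g \<in> borel_measurable M"
    unfolding \<rho>_def by measurable
  have V: "integrable M (\<lambda>u. \<rho> h u * (1 + (norm u)\<^sup>2))" if h: "admissible L B h" for h
    using weighted_integrable(1)[OF h, of 1]
      integrable_mult_right[of "1 / (\<integral>v. exp (- h v) \<partial>M)" M "\<lambda>u. (1 + (norm u)\<^sup>2) * exp (- h u)"]
    by (simp add: \<rho>_def mult.commute)
  have \<rho>0: "0 \<le> \<rho> h u" for h u by (simp add: \<rho>_def)
  have int: "integrable M (\<lambda>u. \<rho> h u *\<^sub>R F u)" if h: "admissible L B h" for h
  proof (rule Bochner_Integration.integrable_bound)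
    note [measurable] = admissible_measurable[OF h]
    show "integrable M (\<lambda>u. c * (\<rho> h u * (1 + (norm u)\<^sup>2)))" using V[OF h] by simp
    show "(\<lambda>u. \<rho> h u *\<^sub>R F u) \<in> borel_measurable M" by (simp add: \<rho>_def)
    show "AE u in M. norm (\<rho> h u *\<^sub>R F u) \<le> norm (c * (\<rho> h u * (1 + (norm u)\<^sup>2)))"
    proof (rule AE_I2)
      fix u
      have "\<rho> h u * norm (F u) \<le> \<rho> h u * (c * (1 + (norm u)\<^sup>2))"
        by (intro mult_left_mono F \<rho>0)
      then show "norm (\<rho> h u *\<^sub>R F u) \<le> norm (c * (\<rho> h u * (1 + (norm u)\<^sup>2)))"
        using \<rho>0[of h u] \<open>c \<ge> 0\<close> by (simp add: abs_mult ac_simps)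
    qed
  qed
  have "(\<integral>u. F u \<partial>posterior M f) - (\<integral>u. F u \<partial>posterior M g)
      = (\<integral>u. (\<rho> f u - \<rho> g u) *\<^sub>R F u \<partial>M)"
    using int[OF f] int[OF g] integral_posterior(2)[OF f, of F] integral_posterior(2)[OF g, of F] \<open>L \<ge> 0\<close>
    by (simp add: \<rho>_def scaleR_diff_left)
  also have "norm \<dots> \<le> (\<integral>u. c * (\<bar>\<rho> f u - \<rho> g u\<bar> * (1 + (norm u)\<^sup>2)) \<partial>M)"
  proof (rule order_trans[OF integral_norm_bound integral_mono'])
    show "integrable M (\<lambda>u. c * (\<bar>\<rho> f u - \<rho> g u\<bar> * (1 + (norm u)\<^sup>2)))"
      using integrable_abs[OF Bochner_Integration.integrable_diff[OF V[OF f] V[OF g]]]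
      by (simp add: abs_mult flip: left_diff_distrib)
    show "norm ((\<rho> f u - \<rho> g u) *\<^sub>R F u) \<le> c * (\<bar>\<rho> f u - \<rho> g u\<bar> * (1 + (norm u)\<^sup>2))" for u
      using mult_left_mono[OF F[of u], of "\<bar>\<rho> f u - \<rho> g u\<bar>"] by (simp add: ac_simps)
    show "0 \<le> c * (\<bar>\<rho> f u - \<rho> g u\<bar> * (1 + (norm u)\<^sup>2))" for u using \<open>c \<ge> 0\<close> by simp
  qed
  also have "\<dots> \<le> c * ((2 * W / z + 2 * W\<^sup>2 / z\<^sup>2) * \<epsilon>)"
    unfolding Bochner_Integration.integral_mult_right_zero
    using posterior_density_diff_le[OF f g \<open>L \<ge> 0\<close> \<open>\<epsilon> \<ge> 0\<close> diff] \<open>c \<ge> 0\<close>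
    unfolding \<rho>_def W_def z_def by (intro mult_left_mono) auto
  finally show ?thesis by (simp add: mult.assoc)
qed

text \<open>The covariance depends quadratically on the mean, so the Lipschitz estimate for it also
  needs an a priori bound on the mean.\<close>

lemma norm_mean_posterior_le:
  assumes g: "admissible L B g" and "L \<ge> 0"
  shows "norm (mean_of (posterior M g)) \<le> moment_bound B / normalizer_bound L"
proof -
  note [measurable] = admissible_measurable[OF g]
  define Z where "Z = (\<integral>v. exp (- g v) \<partial>M)"
  have z: "0 < normalizer_bound L" "normalizer_bound L \<le> Z"
    using normalizer_bound_pos normalizer_lower g \<open>L \<ge> 0\<close> by (auto simp: Z_def)
  have "norm (mean_of (posterior M g)) \<le> (\<integral>u. norm ((exp (- g u) / Z) *\<^sub>R u) \<partial>M)"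
    unfolding mean_of_def integral_posterior(2)[OF assms ident_measurable] Z_def
    by (rule integral_norm_bound)
  also have "\<dots> \<le> (\<integral>u. (1 + (norm u)\<^sup>2) * exp (- g u) / Z \<partial>M)"
    using weighted_integrable(1)[OF g, of 1] z
    by (intro integral_mono')
       (auto intro!: divide_right_mono mult_right_mono norm_le_one_plus_sq simp: mult.commute[of "exp _"])
  also have "\<dots> \<le> moment_bound B / Z"
    using weighted_integrable(2)[OF g, of 1] z by (simp add: divide_right_mono)
  also have "\<dots> \<le> moment_bound B / normalizer_bound L"
  proof (intro divide_left_mono z)
    have "0 \<le> (\<integral>u. (1 + (norm u)\<^sup>2) ^ 0 * exp (- g u) \<partial>M)" by simp
    then show "0 \<le> moment_bound B" using weighted_integrable(2)[OF g, of 0] by linarith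
    show "0 < Z * normalizer_bound L" using z by simp
  qed
  finally show ?thesis .
qed

text \<open>In the factor \<open>1 + 2 * (W / z)\<close> the 1 stands for the second moments; the
  rest comes from telescoping the product \<open>inner m h *\<^sub>R m\<close>, where one factor
  changes and the other is at most \<open>W / z\<close>. The linear dependence on
  \<open>norm h\<close> makes this an operator norm estimate.\<close>

lemma covariance_posterior_diff_le:
  assumes f: "admissible L B f" and g: "admissible L B g" and "L \<ge> 0" "\<epsilon> \<ge> 0"
    and diff: "\<And>u. u \<in> space M \<Longrightarrow> \<bar>f u - g u\<bar> \<le> \<epsilon> * (1 + (norm u)\<^sup>2)"
  defines "W \<equiv> moment_bound B" and "z \<equiv> normalizer_bound L"
  shows "norm (covariance_op (posterior M f) h - covariance_op (posterior M g) h)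
      \<le> (1 + 2 * (W / z)) * (2 * W / z + 2 * W\<^sup>2 / z\<^sup>2) * \<epsilon> * norm h"
proof -
  define C where "C = 2 * W / z + 2 * W\<^sup>2 / z\<^sup>2"
  define m n where "m = mean_of (posterior M f)" and "n = mean_of (posterior M g)"
  have id_post: "(\<lambda>u. u) \<in> borel_measurable (posterior M g)" for g
    unfolding posterior_def by simp
  note cov = covariance_op_eq[OF prob_space_posterior id_post integrable_posterior_sq]
  have m: "norm m \<le> W / z" "norm n \<le> W / z"
    unfolding m_def n_def W_def z_def using norm_mean_posterior_le f g \<open>L \<ge> 0\<close> by blast+
  have mn: "norm (m - n) \<le> C * \<epsilon>"
    using posterior_expectation_diff_le[OF f g \<open>L \<ge> 0\<close> \<open>\<epsilon> \<ge> 0\<close> diff, of "\<lambda>u. u" 1]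
    by (simp add: norm_le_one_plus_sq m_def n_def mean_of_def C_def W_def z_def)
  have second: "norm ((\<integral>u. inner u h *\<^sub>R u \<partial>posterior M f) - (\<integral>u. inner u h *\<^sub>R u \<partial>posterior M g))
      \<le> norm h * C * \<epsilon>"
    unfolding C_def W_def z_def
  proof (rule posterior_expectation_diff_le[OF f g \<open>L \<ge> 0\<close> \<open>\<epsilon> \<ge> 0\<close> diff])
    show "norm (inner u h *\<^sub>R u) \<le> norm h * (1 + (norm u)\<^sup>2)" for u :: 'h
    proof -
      have "\<bar>inner u h\<bar> * norm u \<le> norm u * norm h * norm u"
        by (intro mult_right_mono Cauchy_Schwarz_ineq2) auto
      also have "\<dots> = norm h * (norm u)\<^sup>2" by (simp add: power2_eq_square)
      also have "\<dots> \<le> norm h * (1 + (norm u)\<^sup>2)" by (intro mult_left_mono) auto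
      finally show ?thesis by simp
    qed
  qed simp_all
  have "inner m h *\<^sub>R m - inner n h *\<^sub>R n = inner m h *\<^sub>R (m - n) + inner (m - n) h *\<^sub>R n"
    by (simp add: inner_diff_left algebra_simps)
  also have "norm \<dots> \<le> \<bar>inner m h\<bar> * norm (m - n) + \<bar>inner (m - n) h\<bar> * norm n"
    by (rule order_trans[OF norm_triangle_ineq]) simp
  also have "\<dots> \<le> (norm m * norm h) * norm (m - n) + (norm (m - n) * norm h) * norm n"
    by (intro add_mono mult_right_mono Cauchy_Schwarz_ineq2) auto
  also have "\<dots> \<le> (W / z * norm h) * (C * \<epsilon>) + ((C * \<epsilon>) * norm h) * (W / z)"
  proof -
    have "(a * norm h) * b + (b * norm h) * a' \<le> (r * norm h) * d + (d * norm h) * r"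
      if "0 \<le> a" "0 \<le> a'" "0 \<le> b" "a \<le> r" "a' \<le> r" "b \<le> d" for a a' b r d
      using that by (intro add_mono mult_mono mult_nonneg_nonneg) auto
    from this[OF _ _ _ m mn] show ?thesis by simp
  qed
  finally have first: "norm (inner m h *\<^sub>R m - inner n h *\<^sub>R n) \<le> 2 * (W / z) * C * \<epsilon> * norm h"
    by (simp add: algebra_simps)
  have "covariance_op (posterior M f) h - covariance_op (posterior M g) h
      = ((\<integral>u. inner u h *\<^sub>R u \<partial>posterior M f) - (\<integral>u. inner u h *\<^sub>R u \<partial>posterior M g))
        - (inner m h *\<^sub>R m - inner n h *\<^sub>R n)"
    unfolding cov[OF f \<open>L \<ge> 0\<close> f \<open>L \<ge> 0\<close>] cov[OF g \<open>L \<ge> 0\<close> g \<open>L \<ge> 0\<close>] m_def n_def by simp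
  also have "norm \<dots> \<le> norm h * C * \<epsilon> + 2 * (W / z) * C * \<epsilon> * norm h"
    by (rule order_trans[OF norm_triangle_ineq4 add_mono[OF second first]])
  finally show ?thesis unfolding C_def[symmetric] by (simp add: algebra_simps)
qed

text \<open>The order of quantifiers is the point: \<open>C\<close> depends on \<open>L\<close> and
  \<open>B\<close> alone and precedes the potentials, so it is uniform over all truncations.\<close>

lemma posterior_stability:
  assumes "L \<ge> 0"
  shows "\<exists>C>0. \<forall>f g \<epsilon>. admissible L B f \<longrightarrow> admissible L B g \<longrightarrow> \<epsilon> \<ge> 0 \<longrightarrow>
      (\<forall>u\<in>space M. \<bar>f u - g u\<bar> \<le> \<epsilon> * (1 + (norm u)\<^sup>2)) \<longrightarrow>
      hellinger_dist M (posterior M f) (posterior M g) \<le> C * \<epsilon> \<and>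
      norm (mean_of (posterior M f) - mean_of (posterior M g)) \<le> C * \<epsilon> \<and>
      \<bar>onorm (\<lambda>h. covariance_op (posterior M f) h - covariance_op (posterior M g) h)\<bar> \<le> C * \<epsilon>"
proof -
  define W z where "W = moment_bound B" and "z = normalizer_bound L"
  define a b c where "a = sqrt (W / (2 * z))" and "b = 2 * W / z + 2 * W\<^sup>2 / z\<^sup>2"
    and "c = (1 + 2 * (W / z)) * b"
  show ?thesis
  proof (rule exI[of _ "1 + \<bar>a\<bar> + \<bar>b\<bar> + \<bar>c\<bar>"], rule conjI, linarith, intro allI impI)
    fix f g \<epsilon>
    assume f: "admissible L B f" and g: "admissible L B g" and \<epsilon>: "\<epsilon> \<ge> 0"
      and diff: "\<forall>u\<in>space M. \<bar>f u - g u\<bar> \<le> \<epsilon> * (1 + (norm u)\<^sup>2)"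
    note * = f g \<open>L \<ge> 0\<close> \<epsilon> bspec[OF diff]
    have "hellinger_dist M (posterior M f) (posterior M g) \<le> a * \<epsilon>"
      unfolding a_def W_def z_def by (rule hellinger_posterior_le[OF *])
    moreover have "norm (mean_of (posterior M f) - mean_of (posterior M g)) \<le> b * \<epsilon>"
      using posterior_expectation_diff_le[OF *, of "\<lambda>u. u" 1]
      by (simp add: norm_le_one_plus_sq mean_of_def b_def W_def z_def)
    moreover have "\<bar>onorm (\<lambda>h. covariance_op (posterior M f) h - covariance_op (posterior M g) h)\<bar>
        \<le> \<bar>c\<bar> * \<epsilon>"
    proof (rule abs_onorm_le)
      fix h
      have "norm (covariance_op (posterior M f) h - covariance_op (posterior M g) h) \<le> c * (\<epsilon> * norm h)"
        using covariance_posterior_diff_le[OF *, of h] by (simp add: c_def b_def W_def z_def mult.assoc)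
      also have "\<dots> \<le> \<bar>c\<bar> * (\<epsilon> * norm h)" using \<epsilon> by (intro mult_right_mono) auto
      finally show "norm (covariance_op (posterior M f) h - covariance_op (posterior M g) h)
          \<le> \<bar>c\<bar> * \<epsilon> * norm h" by (simp add: mult.assoc)
    qed (use \<epsilon> in simp)
    moreover have "x * \<epsilon> \<le> (1 + \<bar>a\<bar> + \<bar>b\<bar> + \<bar>c\<bar>) * \<epsilon>" if "x \<in> {a, b, \<bar>c\<bar>}" for x
      using that \<epsilon> by (intro mult_right_mono) auto
    ultimately show "hellinger_dist M (posterior M f) (posterior M g) \<le> (1 + \<bar>a\<bar> + \<bar>b\<bar> + \<bar>c\<bar>) * \<epsilon> \<and>
      norm (mean_of (posterior M f) - mean_of (posterior M g)) \<le> (1 + \<bar>a\<bar> + \<bar>b\<bar> + \<bar>c\<bar>) * \<epsilon> \<and>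
      \<bar>onorm (\<lambda>h. covariance_op (posterior M f) h - covariance_op (posterior M g) h)\<bar>
        \<le> (1 + \<bar>a\<bar> + \<bar>b\<bar> + \<bar>c\<bar>) * \<epsilon>"
      by (meson insertCI order_trans)
  qed
qed

end

section \<open>Gaussian measures\<close>

text \<open>Completing the square: exponential tilting moves the mean by the variance. Integrating
  the shifted density leaves the prefactor as the exponential moment.\<close>

lemma normal_density_times_exp:
  assumes "\<sigma> > 0"
  shows "normal_density m \<sigma> x * exp x = exp (m + \<sigma>\<^sup>2 / 2) * normal_density (m + \<sigma>\<^sup>2) \<sigma> x"
proof -
  have "- (x - m)\<^sup>2 / (2 * \<sigma>\<^sup>2) + x = (m + \<sigma>\<^sup>2 / 2) + - (x - (m + \<sigma>\<^sup>2))\<^sup>2 / (2 * \<sigma>\<^sup>2)"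
    using assms by (simp add: field_simps power2_eq_square)
  then have "exp (- (x - m)\<^sup>2 / (2 * \<sigma>\<^sup>2)) * exp x
      = exp (m + \<sigma>\<^sup>2 / 2) * exp (- (x - (m + \<sigma>\<^sup>2))\<^sup>2 / (2 * \<sigma>\<^sup>2))"
    by (simp only: exp_add[symmetric])
  then show ?thesis by (simp add: normal_density_def)
qed

lemma nn_integral_exp_real_gaussian:
  assumes "v \<ge> 0"
  shows "(\<integral>\<^sup>+x. ennreal (exp x) \<partial>real_gaussian m v) = ennreal (exp (m + v / 2))"
proof (cases "v = 0")
  case True
  then show ?thesis by (simp add: real_gaussian_def nn_integral_return)
next
  case False
  then have "sqrt v > 0" using assms by simp
  have "(\<integral>\<^sup>+x. ennreal (exp x) \<partial>real_gaussian m v)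
      = (\<integral>\<^sup>+x. ennreal (normal_density m (sqrt v) x) * ennreal (exp x) \<partial>lborel)"
    using False by (simp add: real_gaussian_def nn_integral_density)
  also have "\<dots> = (\<integral>\<^sup>+x. ennreal (exp (m + v / 2)) * ennreal (normal_density (m + v) (sqrt v) x) \<partial>lborel)"
    using normal_density_times_exp[OF \<open>sqrt v > 0\<close>] assms
    by (intro nn_integral_cong) (simp flip: ennreal_mult')
  also have "\<dots> = ennreal (exp (m + v / 2)) * (\<integral>\<^sup>+x. ennreal (normal_density (m + v) (sqrt v) x) \<partial>lborel)"
    by (rule nn_integral_cmult) simp
  also have "(\<integral>\<^sup>+x. ennreal (normal_density (m + v) (sqrt v) x) \<partial>lborel) = 1"
    using \<open>sqrt v > 0\<close> by (subst nn_integral_eq_integral) auto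
  finally show ?thesis by simp
qed

lemma gaussian_on_measurable:
  fixes f :: "'h::real_inner \<Rightarrow> 'b::topological_space"
  assumes "gaussian_on H M m C" "f \<in> borel_measurable borel"
  shows "f \<in> borel_measurable M"
  using assms by (auto simp: gaussian_on_def cong: measurable_cong_sets intro: measurable_restrict_space1)

lemma gaussian_on_space:
  assumes "gaussian_on H M m C"
  shows "space M = H"
  using assms sets_eq_imp_space_eq[of M "restrict_space borel H"]
  by (simp add: gaussian_on_def space_restrict_space)

lemma gaussian_on_exp_inner:
  assumes M: "gaussian_on H M m C" and h: "h \<in> H" "0 \<le> inner (C h) h"
  shows "(\<integral>\<^sup>+u. ennreal (exp (inner u h)) \<partial>M) = ennreal (exp (inner m h + inner (C h) h / 2))"
proof -
  have [measurable]: "(\<lambda>u. inner u h) \<in> borel_measurable M"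
    by (rule gaussian_on_measurable[OF M]) (intro borel_measurable_continuous_onI continuous_intros)
  have "(\<integral>\<^sup>+u. ennreal (exp (inner u h)) \<partial>M) = (\<integral>\<^sup>+x. ennreal (exp x) \<partial>distr M borel (\<lambda>u. inner u h))"
    by (subst nn_integral_distr) auto
  also have "distr M borel (\<lambda>u. inner u h) = real_gaussian (inner m h) (inner (C h) h)"
    using M h by (simp add: gaussian_on_def)
  finally show ?thesis using h(2) by (simp add: nn_integral_exp_real_gaussian)
qed

section \<open>From coordinate moments to moments of the norm\<close>

text \<open>The eighth power of \<open>t \<le> exp t\<close> at
  \<open>t = \<bar>x\<bar> / 8\<close>. The exponent is that of a coordinate in the fourth power of
  the squared norm, and the two signs of \<open>x\<close> match the exponential moments of a linear
  functional and its negative.\<close>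

lemma power8_le_exp: "x ^ 8 \<le> 8 ^ 8 * (exp x + exp (- x))" for x :: real
proof -
  have *: "y ^ 8 \<le> 8 ^ 8 * exp y" if "y \<ge> 0" for y :: real
  proof -
    have "(y / 8) ^ 8 \<le> exp (y / 8) ^ 8"
      using exp_ge_add_one_self[of "y / 8"] that by (intro power_mono) linarith+
    also have "exp (y / 8) ^ 8 = exp y" by (simp flip: exp_of_nat_mult)
    finally show ?thesis by (simp add: power_divide)
  qed
  have "8 ^ 8 * exp \<bar>x\<bar> \<le> 8 ^ 8 * (exp x + exp (- x))"
    by (intro mult_left_mono) (auto simp: abs_if)
  with *[of "\<bar>x\<bar>"] show ?thesis by (simp add: power_even_abs)
qed

lemma weighted_sum_square_le:
  fixes a x :: "'i \<Rightarrow> real"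
  assumes "\<And>i. i \<in> I \<Longrightarrow> 0 \<le> a i"
  shows "(\<Sum>i\<in>I. a i * x i)\<^sup>2 \<le> (\<Sum>i\<in>I. a i) * (\<Sum>i\<in>I. a i * (x i)\<^sup>2)"
proof -
  have "(\<Sum>i\<in>I. sqrt (a i) * (sqrt (a i) * x i))\<^sup>2
      \<le> (\<Sum>i\<in>I. (sqrt (a i))\<^sup>2) * (\<Sum>i\<in>I. (sqrt (a i) * x i)\<^sup>2)"
    by (rule Cauchy_Schwarz_ineq_sum)
  moreover have "(\<Sum>i\<in>I. sqrt (a i) * (sqrt (a i) * x i)) = (\<Sum>i\<in>I. a i * x i)"
    "(\<Sum>i\<in>I. (sqrt (a i))\<^sup>2) = (\<Sum>i\<in>I. a i)"
    "(\<Sum>i\<in>I. (sqrt (a i) * x i)\<^sup>2) = (\<Sum>i\<in>I. a i * (x i)\<^sup>2)"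
    using assms by (auto intro!: sum.cong simp: power_mult_distrib simp flip: mult.assoc)
  ultimately show ?thesis by simp
qed

text \<open>Jensen's inequality for the fourth power with unnormalised weights, obtained by applying
  the weighted Cauchy-Schwarz inequality twice.\<close>

lemma weighted_sum_power4_le:
  fixes a x :: "'i \<Rightarrow> real"
  assumes a: "\<And>i. i \<in> I \<Longrightarrow> 0 \<le> a i"
  shows "(\<Sum>i\<in>I. a i * x i) ^ 4 \<le> (\<Sum>i\<in>I. a i) ^ 3 * (\<Sum>i\<in>I. a i * (x i) ^ 4)"
proof -
  let ?S = "\<Sum>i\<in>I. a i"
  have S: "0 \<le> ?S" using a by (rule sum_nonneg)
  have "(\<Sum>i\<in>I. a i * x i) ^ 4 = ((\<Sum>i\<in>I. a i * x i)\<^sup>2)\<^sup>2" by simp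
  also have "\<dots> \<le> (?S * (\<Sum>i\<in>I. a i * (x i)\<^sup>2))\<^sup>2"
    by (intro power_mono weighted_sum_square_le a) auto
  also have "\<dots> = ?S\<^sup>2 * (\<Sum>i\<in>I. a i * (x i)\<^sup>2)\<^sup>2" by (simp add: power_mult_distrib)
  also have "\<dots> \<le> ?S\<^sup>2 * (?S * (\<Sum>i\<in>I. a i * ((x i)\<^sup>2)\<^sup>2))"
    by (intro mult_left_mono weighted_sum_square_le a) auto
  also have "\<dots> = ?S ^ 3 * (\<Sum>i\<in>I. a i * (x i) ^ 4)"
    by (simp add: power3_eq_cube power2_eq_square[of ?S])
  finally show ?thesis .
qed

locale exhausted_orthonormal_system = orthonormal_system K \<phi>
  for K :: "'k set" and \<phi> :: "'k \<Rightarrow> 'h::{real_inner, banach, second_countable_topology}" +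
  fixes F :: "nat \<Rightarrow> 'k set"
  assumes finite_F: "finite (F n)" and F_subset: "F n \<subseteq> K"
    and F_exhaust: "k \<in> K \<Longrightarrow> \<forall>\<^sub>F n in sequentially. k \<in> F n"
begin

text \<open>Each finite subset of \<open>K\<close> is eventually contained in \<open>F n\<close>, so
  \<open>F\<close> converges along the filter of finite subsets and unordered limits become
  sequential ones.\<close>

lemma has_sum_tendsto_F:
  assumes "(f has_sum S) K"
  shows "(\<lambda>n. \<Sum>k\<in>F n. f k) \<longlonglongrightarrow> S"
proof -
  have "filterlim F (finite_subsets_at_top K) sequentially"
    unfolding filterlim_finite_subsets_at_top
  proof (intro allI impI)
    fix X assume X: "finite X \<and> X \<subseteq> K"
    then have "\<forall>\<^sub>F n in sequentially. \<forall>k\<in>X. k \<in> F n"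
      by (intro eventually_ball_finite) (auto intro: F_exhaust)
    then show "\<forall>\<^sub>F n in sequentially. finite (F n) \<and> X \<subseteq> F n \<and> F n \<subseteq> K"
      using finite_F F_subset by (simp add: subset_eq)
  qed
  then show ?thesis
    using assms unfolding has_sum_def by (rule filterlim_compose[rotated])
qed

text \<open>No joint law of the coordinates enters. With summable weights \<open>a k\<close>,
  Jensen's inequality reduces the fourth power of a partial sum of \<open>u\<^sub>k\<^sup>2\<close>
  to the fourth powers of \<open>u\<^sub>k\<^sup>2 / a k\<close>, whose expectations are bounded by
  \<open>b\<close> for every \<open>k\<close>. All partial sums thus obey the bound
  \<open>S ^ 4 * b\<close>, and Fatou's lemma with Parseval's identity passes to the norm.\<close>

lemma gaussian_fourth_moment:
  assumes M: "gaussian_on (closure (span (\<phi> ` K))) M m C"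
    and C: "\<And>k c. k \<in> K \<Longrightarrow> inner (C (c *\<^sub>R \<phi> k)) (c *\<^sub>R \<phi> k) = c\<^sup>2 * v k"
    and v: "\<And>k. k \<in> K \<Longrightarrow> 0 < v k" "v summable_on K"
  shows "integrable M (\<lambda>u. (1 + (norm u)\<^sup>2) ^ 4)"
proof -
  interpret prob_space M using M by (simp add: gaussian_on_def)
  have [measurable]: "(\<lambda>u. inner u h) \<in> borel_measurable M" "(\<lambda>u. norm u) \<in> borel_measurable M" for h
    by (rule gaussian_on_measurable[OF M], intro borel_measurable_continuous_onI continuous_intros)+
  \<comment> \<open>The second moment of the coordinate: it dominates both the squared mean and the
    variance, is positive, and is summable by Bessel's inequality and the summability of
    \<open>v\<close>.\<close>
  define a where "a k = (inner m (\<phi> k))\<^sup>2 + v k" for k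
  have a_pos: "0 < a k" if "k \<in> K" for k
    using v(1)[OF that] by (simp add: a_def add_nonneg_pos)
  have a_sum: "a summable_on K"
    unfolding a_def by (intro summable_on_add coeff_summable v)
  define S where "S = infsum a K"
  define b where "b = 8 ^ 8 * (exp (3 / 2) + exp (3 / 2) :: real)"
  have in_closure: "c *\<^sub>R \<phi> k \<in> closure (span (\<phi> ` K))" if "k \<in> K" for c k
    using that by (intro subsetD[OF closure_subset] span_scale span_base) auto
  \<comment> \<open>Scaled by \<open>1 / sqrt (a k)\<close>, the coordinate has mean and variance at
    most 1, whence the exponent \<open>1 + 1 / 2\<close>. Fixing only \<open>\<bar>c\<bar>\<close>
    covers both signs.\<close>
  have exp_le: "(\<integral>\<^sup>+u. ennreal (exp (inner u (c *\<^sub>R \<phi> k))) \<partial>M) \<le> ennreal (exp (3 / 2))"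
    if k: "k \<in> K" and c: "\<bar>c\<bar> = 1 / sqrt (a k)" for c k
  proof -
    have c2: "c\<^sup>2 = 1 / a k"
      using c a_pos[OF k] by (metis less_imp_le power2_abs power_divide power_one real_sqrt_pow2)
    have "c * inner m (\<phi> k) \<le> \<bar>c\<bar> * \<bar>inner m (\<phi> k)\<bar>" by (simp flip: abs_mult)
    also have "\<dots> \<le> \<bar>c\<bar> * sqrt (a k)"
      using v(1)[OF k] by (intro mult_left_mono real_le_rsqrt) (auto simp: a_def)
    also have "\<dots> = 1" using c a_pos[OF k] by simp
    finally have 1: "inner m (c *\<^sub>R \<phi> k) \<le> 1" by simp
    have "v k \<le> a k" by (simp add: a_def)
    then have "c\<^sup>2 * v k \<le> 1" using a_pos[OF k] by (simp add: c2 divide_le_eq)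
    with 1 have "exp (inner m (c *\<^sub>R \<phi> k) + inner (C (c *\<^sub>R \<phi> k)) (c *\<^sub>R \<phi> k) / 2) \<le> exp (3 / 2)"
      unfolding C[OF k] by simp
    moreover have "0 \<le> inner (C (c *\<^sub>R \<phi> k)) (c *\<^sub>R \<phi> k)"
      using v(1)[OF k] unfolding C[OF k] by (intro mult_nonneg_nonneg) auto
    ultimately show ?thesis
      using gaussian_on_exp_inner[OF M in_closure[OF k]] by (simp add: ennreal_leI)
  qed
  have coord: "(\<integral>\<^sup>+u. ennreal (((inner u (\<phi> k))\<^sup>2 / a k) ^ 4) \<partial>M) \<le> ennreal b" if k: "k \<in> K" for k
  proof -
    define c where "c = 1 / sqrt (a k)"
    have c2: "c\<^sup>2 = 1 / a k" using a_pos[OF k] by (simp add: c_def power_divide)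
    have eq: "((inner u (\<phi> k))\<^sup>2 / a k) ^ 4 = (inner u (c *\<^sub>R \<phi> k)) ^ 8" for u
    proof -
      have "(inner u (c *\<^sub>R \<phi> k)) ^ 8 = (c\<^sup>2 * (inner u (\<phi> k))\<^sup>2) ^ 4"
        by (simp add: power_mult_distrib)
      then show ?thesis by (simp add: c2)
    qed
    have "(\<integral>\<^sup>+u. ennreal (((inner u (\<phi> k))\<^sup>2 / a k) ^ 4) \<partial>M)
        \<le> (\<integral>\<^sup>+u. ennreal (8 ^ 8) * (ennreal (exp (inner u (c *\<^sub>R \<phi> k)))
            + ennreal (exp (inner u ((- c) *\<^sub>R \<phi> k)))) \<partial>M)"
      unfolding eq
      using power8_le_exp
      by (intro nn_integral_mono) (simp flip: ennreal_plus ennreal_mult' del: ennreal_numeral ennreal_power)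
    also have "\<dots> = ennreal (8 ^ 8) * ((\<integral>\<^sup>+u. ennreal (exp (inner u (c *\<^sub>R \<phi> k))) \<partial>M)
        + (\<integral>\<^sup>+u. ennreal (exp (inner u ((- c) *\<^sub>R \<phi> k))) \<partial>M))"
      by (subst nn_integral_cmult, measurable) (subst nn_integral_add, auto)
    also have "\<dots> \<le> ennreal (8 ^ 8) * (ennreal (exp (3 / 2)) + ennreal (exp (3 / 2)))"
      using a_pos[OF k] by (intro mult_left_mono add_mono exp_le k) (auto simp: c_def)
    also have "\<dots> = ennreal b"
      unfolding b_def by (simp flip: ennreal_plus ennreal_mult' del: ennreal_numeral ennreal_power)
    finally show ?thesis .
  qed
  have partial: "(\<integral>\<^sup>+u. ennreal ((\<Sum>k\<in>X. (inner u (\<phi> k))\<^sup>2) ^ 4) \<partial>M) \<le> ennreal (S ^ 4 * b)"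
    if X: "finite X" "X \<subseteq> K" for X
  proof -
    have SX: "0 \<le> (\<Sum>k\<in>X. a k)" "(\<Sum>k\<in>X. a k) \<le> S"
      unfolding S_def using X a_sum a_pos
      by (auto intro!: sum_nonneg finite_sum_le_infsum intro: less_imp_le)
    have b: "0 \<le> b" by (simp add: b_def)
    have "(\<Sum>k\<in>X. (inner u (\<phi> k))\<^sup>2) ^ 4 \<le> S ^ 3 * (\<Sum>k\<in>X. a k * ((inner u (\<phi> k))\<^sup>2 / a k) ^ 4)" for u
    proof -
      have "(\<Sum>k\<in>X. (inner u (\<phi> k))\<^sup>2) = (\<Sum>k\<in>X. a k * ((inner u (\<phi> k))\<^sup>2 / a k))"
        using X a_pos by (intro sum.cong) (force simp: subset_iff)+
      also have "\<dots> ^ 4 \<le> (\<Sum>k\<in>X. a k) ^ 3 * (\<Sum>k\<in>X. a k * ((inner u (\<phi> k))\<^sup>2 / a k) ^ 4)"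
        using X a_pos by (intro weighted_sum_power4_le) (auto intro: less_imp_le)
      also have "\<dots> \<le> S ^ 3 * (\<Sum>k\<in>X. a k * ((inner u (\<phi> k))\<^sup>2 / a k) ^ 4)"
        using X a_pos SX by (intro mult_right_mono power_mono sum_nonneg mult_nonneg_nonneg) (auto intro: less_imp_le)
      finally show ?thesis .
    qed
    then have "(\<integral>\<^sup>+u. ennreal ((\<Sum>k\<in>X. (inner u (\<phi> k))\<^sup>2) ^ 4) \<partial>M)
        \<le> (\<integral>\<^sup>+u. ennreal (S ^ 3 * (\<Sum>k\<in>X. a k * ((inner u (\<phi> k))\<^sup>2 / a k) ^ 4)) \<partial>M)"
      by (intro nn_integral_mono ennreal_leI)
    also have "\<dots> = (\<integral>\<^sup>+u. ennreal (S ^ 3) * (\<Sum>k\<in>X. ennreal (a k) * ennreal (((inner u (\<phi> k))\<^sup>2 / a k) ^ 4)) \<partial>M)"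
    proof (intro nn_integral_cong)
      fix u
      have nn: "0 \<le> a k * ((inner u (\<phi> k))\<^sup>2 / a k) ^ 4" if "k \<in> X" for k
        using that X a_pos by (intro mult_nonneg_nonneg) (auto intro: less_imp_le)
      have "(\<Sum>k\<in>X. ennreal (a k) * ennreal (((inner u (\<phi> k))\<^sup>2 / a k) ^ 4))
          = (\<Sum>k\<in>X. ennreal (a k * ((inner u (\<phi> k))\<^sup>2 / a k) ^ 4))"
        using X a_pos by (intro sum.cong ennreal_mult[symmetric]) (auto intro: less_imp_le)
      also have "\<dots> = ennreal (\<Sum>k\<in>X. a k * ((inner u (\<phi> k))\<^sup>2 / a k) ^ 4)"
        by (rule sum_ennreal[OF nn])
      finally show "ennreal (S ^ 3 * (\<Sum>k\<in>X. a k * ((inner u (\<phi> k))\<^sup>2 / a k) ^ 4))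
          = ennreal (S ^ 3) * (\<Sum>k\<in>X. ennreal (a k) * ennreal (((inner u (\<phi> k))\<^sup>2 / a k) ^ 4))"
        using SX sum_nonneg[OF nn] by (subst ennreal_mult) auto
    qed
    also have "\<dots> = ennreal (S ^ 3) * (\<Sum>k\<in>X. ennreal (a k) * (\<integral>\<^sup>+u. ennreal (((inner u (\<phi> k))\<^sup>2 / a k) ^ 4) \<partial>M))"
      by (subst nn_integral_cmult, measurable) (simp add: nn_integral_sum nn_integral_cmult)
    also have "\<dots> \<le> ennreal (S ^ 3) * (\<Sum>k\<in>X. ennreal (a k) * ennreal b)"
      using X by (intro mult_left_mono sum_mono coord) auto
    also have "(\<Sum>k\<in>X. ennreal (a k) * ennreal b) = ennreal ((\<Sum>k\<in>X. a k) * b)"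
      using X a_pos b by (subst sum_distrib_right[symmetric], subst sum_ennreal)
        (auto simp: ennreal_mult SX intro: less_imp_le)
    also have "ennreal (S ^ 3) * \<dots> \<le> ennreal (S ^ 3) * ennreal (S * b)"
      using SX b by (intro mult_left_mono ennreal_leI mult_right_mono) auto
    also have "\<dots> = ennreal (S ^ 4 * b)"
      using SX b by (simp add: power4_eq_xxxx power3_eq_cube flip: ennreal_mult' del: ennreal_power)
    finally show ?thesis .
  qed
  have "(\<integral>\<^sup>+u. ennreal (((norm u)\<^sup>2) ^ 4) \<partial>M)
      = (\<integral>\<^sup>+u. liminf (\<lambda>n. ennreal ((\<Sum>k\<in>F n. (inner u (\<phi> k))\<^sup>2) ^ 4)) \<partial>M)"
  proof (intro nn_integral_cong lim_imp_Liminf[symmetric] tendsto_ennrealI)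
    fix u assume "u \<in> space M"
    then show "(\<lambda>n. (\<Sum>k\<in>F n. (inner u (\<phi> k))\<^sup>2) ^ 4) \<longlonglongrightarrow> ((norm u)\<^sup>2) ^ 4"
      using gaussian_on_space[OF M] by (intro tendsto_power has_sum_tendsto_F Parseval) simp
  qed simp
  also have "\<dots> \<le> liminf (\<lambda>n. \<integral>\<^sup>+u. ennreal ((\<Sum>k\<in>F n. (inner u (\<phi> k))\<^sup>2) ^ 4) \<partial>M)"
    by (rule nn_integral_liminf) simp
  also have "\<dots> \<le> liminf (\<lambda>n. ennreal (S ^ 4 * b))"
    by (intro Liminf_mono always_eventually allI partial finite_F F_subset)
  also have "\<dots> < \<infinity>" by (simp add: Liminf_const)
  finally have int8: "integrable M (\<lambda>u. ((norm u)\<^sup>2) ^ 4)"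
    by (intro integrableI_nonneg) auto
  show ?thesis
  proof (rule Bochner_Integration.integrable_bound)
    show "integrable M (\<lambda>u. 8 * (1 + ((norm u)\<^sup>2) ^ 4))" using int8 by simp
    \<comment> \<open>Applied twice, this produces the constant
      \<open>2\<^sup>2 * 2 = 8\<close>.\<close>
    have sq: "(1 + t)\<^sup>2 \<le> 2 * (1 + t\<^sup>2)" for t :: real
      using sum_squares_bound[of 1 t] by (simp add: power2_sum)
    have "(1 + t) ^ 4 \<le> 8 * (1 + t ^ 4)" if "t \<ge> 0" for t :: real
    proof -
      have "(1 + t) ^ 4 = ((1 + t)\<^sup>2)\<^sup>2" by simp
      also have "\<dots> \<le> (2 * (1 + t\<^sup>2))\<^sup>2" by (intro power_mono sq) auto
      also have "\<dots> = 4 * (1 + t\<^sup>2)\<^sup>2" unfolding power_mult_distrib by simp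
      also have "\<dots> \<le> 4 * (2 * (1 + (t\<^sup>2)\<^sup>2))" by (intro mult_left_mono sq) auto
      finally show ?thesis by simp
    qed
    from this[of "(norm u)\<^sup>2" for u :: 'h]
    show "AE u in M. norm ((1 + (norm u)\<^sup>2) ^ 4) \<le> norm (8 * (1 + ((norm u)\<^sup>2) ^ 4))"
      by simp
  qed simp
qed

end

section \<open>The potential of the backward heat equation\<close>

text \<open>The inequality \<open>s \<le> exp s\<close> at \<open>s = \<epsilon> * x / p\<close>,
  raised to the power \<open>p\<close>: an arbitrarily small exponential rate absorbs any
  power.\<close>

lemma powr_le_exp:
  fixes x p \<epsilon> :: real
  assumes "x > 0" "p > 0" "\<epsilon> > 0"
  shows "x powr p \<le> (p / \<epsilon>) powr p * exp (\<epsilon> * x)"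
proof -
  have "\<epsilon> * x / p \<le> exp (\<epsilon> * x / p)" using exp_ge_add_one_self[of "\<epsilon> * x / p"] by linarith
  then have "(\<epsilon> * x / p) powr p \<le> exp (\<epsilon> * x / p) powr p"
    using assms by (intro powr_mono2) auto
  also have "\<dots> = exp (\<epsilon> * x)" using assms by (simp add: powr_def)
  finally have "(p / \<epsilon>) powr p * (\<epsilon> * x / p) powr p \<le> (p / \<epsilon>) powr p * exp (\<epsilon> * x)"
    by (intro mult_left_mono) auto
  moreover have "(p / \<epsilon>) powr p * (\<epsilon> * x / p) powr p = x powr p"
    using assms by (subst powr_mult[symmetric]) auto
  ultimately show ?thesis by simp
qed

section \<open>Diagonal form of the potential\<close>

locale backward_heat = exhausted_orthonormal_system K \<phi> F
  for K :: "'k set" and \<phi> :: "'k \<Rightarrow> 'h::{real_inner, banach, second_countable_topology}"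
    and F :: "nat \<Rightarrow> 'k set" +
  fixes lam :: "'k \<Rightarrow> real" and T \<delta> \<gamma> :: real and y :: 'h
  assumes lam_pos: "k \<in> K \<Longrightarrow> 0 < lam k"
    and T_pos: "T > 0" and \<delta>_pos: "\<delta> > 0" and \<gamma>_pos: "\<gamma> > 0"
begin

text \<open>The eigenvalue of the inverse noise covariance sandwiched between two copies of the
  semigroup at time \<open>T / 2\<close>, the operator of the data term. The quadratic term carries
  a further factor \<open>exp (- lam k * T)\<close>.\<close>

definition q :: "'k \<Rightarrow> real" where
  "q k = lam k powr \<gamma> / \<delta> * exp (- lam k * T)"

definition Q :: real where
  "Q = (\<gamma> / (T / 2)) powr \<gamma> / \<delta>"

definition summand :: "'h \<Rightarrow> 'k \<Rightarrow> real" where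
  "summand u k = q k * (1/2 * (exp (- lam k * T) * (inner u (\<phi> k))\<^sup>2) - inner u (\<phi> k) * inner y (\<phi> k))"

abbreviation \<Phi> :: "'h \<Rightarrow> real" where
  "\<Phi> \<equiv> potential K \<phi> lam T \<delta> \<gamma> y"

lemma q_nonneg: "0 \<le> q k"
  using \<delta>_pos by (simp add: q_def)

lemma Q_pos: "0 < Q"
  using \<delta>_pos \<gamma>_pos T_pos by (simp add: Q_def)

text \<open>Half of the decay \<open>exp (- lam k * T)\<close> pays for
  \<open>lam k powr \<gamma>\<close>, which produces the constant \<open>Q\<close>; the other half
  is kept and becomes the convergence rate.\<close>

lemma q_le:
  assumes "k \<in> K"
  shows "q k \<le> Q * exp (- (T / 2) * lam k)"
proof -
  have "lam k powr \<gamma> / \<delta> * exp (- lam k * T)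
      \<le> (\<gamma> / (T / 2)) powr \<gamma> * exp (T / 2 * lam k) / \<delta> * exp (- lam k * T)"
    using powr_le_exp[OF lam_pos[OF assms] \<gamma>_pos, of "T / 2"] T_pos \<delta>_pos
    by (intro mult_right_mono divide_right_mono) auto
  also have "\<dots> = Q * (exp (T / 2 * lam k) * exp (- lam k * T))" by (simp add: Q_def)
  also have "exp (T / 2 * lam k) * exp (- lam k * T) = exp (- (T / 2) * lam k)"
    by (simp add: field_simps flip: exp_add)
  finally show ?thesis by (simp add: q_def)
qed

lemma q_le_Q:
  assumes "k \<in> K"
  shows "q k \<le> Q"
proof -
  have "Q * exp (- (T / 2) * lam k) \<le> Q * 1"
    using Q_pos T_pos lam_pos[OF assms] by (intro mult_left_mono) auto
  then show ?thesis using q_le[OF assms] by linarith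
qed

text \<open>From time \<open>T / 2\<close> on, the smoothing of the semigroup compensates the
  inverse square root of the noise covariance. The squared multiplier is \<open>q k\<close> at
  \<open>t = T / 2\<close> and \<open>q k * exp (- lam k * T)\<close> at \<open>t = T\<close>, the
  two times occurring in the potential.\<close>

lemma noise_semigroup_bound:
  assumes k: "k \<in> K" and t: "t \<ge> T / 2"
  shows "\<bar>(\<delta> * lam k powr (- \<gamma>)) powr (- 1 / 2) * exp (- lam k * t)\<bar> \<le> sqrt Q"
    and "((\<delta> * lam k powr (- \<gamma>)) powr (- 1 / 2) * exp (- lam k * t))\<^sup>2 = q k * exp (- lam k * (2 * t - T))"
proof -
  define r where "r = (\<delta> * lam k powr (- \<gamma>)) powr (- 1 / 2)"
  have "r\<^sup>2 = (\<delta> * lam k powr (- \<gamma>)) powr (- 1)"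
    by (simp add: r_def power2_eq_square flip: powr_add)
  also have "\<dots> = lam k powr \<gamma> / \<delta>"
    using \<delta>_pos lam_pos[OF k] by (simp add: powr_minus field_simps)
  finally have "(r * exp (- lam k * t))\<^sup>2 = lam k powr \<gamma> / \<delta> * (exp (- lam k * t))\<^sup>2"
    by (simp add: power_mult_distrib)
  also have "(exp (- lam k * t))\<^sup>2 = exp (- lam k * T) * exp (- lam k * (2 * t - T))"
    by (simp add: power2_eq_square algebra_simps flip: exp_add)
  finally have eq: "(r * exp (- lam k * t))\<^sup>2 = q k * exp (- lam k * (2 * t - T))"
    by (simp add: q_def)
  then show "((\<delta> * lam k powr (- \<gamma>)) powr (- 1 / 2) * exp (- lam k * t))\<^sup>2 = q k * exp (- lam k * (2 * t - T))"
    by (simp add: r_def)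
  have "q k * exp (- lam k * (2 * t - T)) \<le> Q * 1"
    using q_le_Q[OF k] q_nonneg t lam_pos[OF k] Q_pos by (intro mult_mono) auto
  with eq have "\<bar>r * exp (- lam k * t)\<bar>\<^sup>2 \<le> Q" by simp
  then show "\<bar>(\<delta> * lam k powr (- \<gamma>)) powr (- 1 / 2) * exp (- lam k * t)\<bar> \<le> sqrt Q"
    unfolding r_def by (rule real_le_rsqrt)
qed

lemma noise_semigroup_eq:
  assumes "t \<ge> 0"
  shows "noise_cov_inv_sqrt K \<phi> lam \<delta> \<gamma> (semigroup_op K \<phi> lam t u)
    = spectral_op K \<phi> (\<lambda>k. (\<delta> * lam k powr (- \<gamma>)) powr (- 1 / 2) * exp (- lam k * t)) u"
  unfolding noise_cov_inv_sqrt_def op_power_def semigroup_op_def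
proof (rule spectral_op_compose)
  fix k assume "k \<in> K"
  then have "0 \<le> lam k * t" using lam_pos assms by (simp add: less_imp_le)
  then show "\<bar>exp (- lam k * t)\<bar> \<le> 1" by simp
qed

lemma potential_has_sum: "(summand u has_sum \<Phi> u) K"
proof -
  define r where "r t k = (\<delta> * lam k powr (- \<gamma>)) powr (- 1 / 2) * exp (- lam k * t)" for t k
  define N where "N t = spectral_op K \<phi> (r t)" for t
  have pot: "\<Phi> u = 1/2 * inner (N T u) (N T u) - inner (N (1/2 * T) u) (N (1/2 * T) y)"
    unfolding potential_def Let_def N_def r_def using T_pos
    by (simp add: noise_semigroup_eq power2_norm_eq_inner)
  have bound: "\<bar>r t k\<bar> \<le> sqrt Q" and sq: "r t k * r t k = q k * exp (- lam k * (2 * t - T))"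
    if "k \<in> K" "t \<ge> T / 2" for k t
    using noise_semigroup_bound[OF that] by (simp_all add: r_def power2_eq_square)
  have hs: "((\<lambda>k. r t k * r t k * inner v (\<phi> k) * inner w (\<phi> k)) has_sum inner (N t v) (N t w)) K"
    if "t \<ge> T / 2" for t v w
    unfolding N_def by (rule has_sum_inner_spectral_op2) (use bound that in auto)
  have "((\<lambda>k. 1/2 * (r T k * r T k * inner u (\<phi> k) * inner u (\<phi> k))
      + (- 1) * (r (1/2 * T) k * r (1/2 * T) k * inner u (\<phi> k) * inner y (\<phi> k))) has_sum \<Phi> u) K"
    unfolding pot using has_sum_add[OF has_sum_cmult_right[OF hs[of T u u], of "1/2"]
        has_sum_cmult_right[OF hs[of "1/2 * T" u y], of "- 1"]] T_pos by simp
  moreover have "1/2 * (r T k * r T k * inner u (\<phi> k) * inner u (\<phi> k))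
      + (- 1) * (r (1/2 * T) k * r (1/2 * T) k * inner u (\<phi> k) * inner y (\<phi> k)) = summand u k" if "k \<in> K" for k
    using T_pos sq[OF that, of T] sq[OF that, of "1/2 * T"]
    by (simp add: summand_def power2_eq_square algebra_simps)
  ultimately show ?thesis by (simp cong: has_sum_cong)
qed

lemma abs_summand_le: "\<bar>summand u k\<bar> \<le> q k * ((inner u (\<phi> k))\<^sup>2 + (inner y (\<phi> k))\<^sup>2)" if "k \<in> K"
proof -
  define a b where "a = inner u (\<phi> k)" and "b = inner y (\<phi> k)"
  have "exp (- lam k * T) * a\<^sup>2 \<le> 1 * a\<^sup>2"
    using lam_pos[OF that] T_pos by (intro mult_right_mono) auto
  moreover have "0 \<le> exp (- lam k * T) * a\<^sup>2" by simp
  moreover have "2 * \<bar>a * b\<bar> \<le> a\<^sup>2 + b\<^sup>2"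
    using sum_squares_bound[of "\<bar>a\<bar>" "\<bar>b\<bar>"] by (simp add: abs_mult)
  moreover have "0 \<le> a\<^sup>2" "0 \<le> b\<^sup>2" by simp_all
  ultimately have "\<bar>1/2 * (exp (- lam k * T) * a\<^sup>2) - a * b\<bar> \<le> a\<^sup>2 + b\<^sup>2" by linarith
  then show ?thesis
    unfolding summand_def abs_mult a_def b_def using q_nonneg by (simp add: mult_left_mono)
qed

text \<open>The index set is arbitrary because three are used: \<open>K\<close> and
  \<open>F n\<close> for the growth of the full and truncated potentials, \<open>K - F n\<close> for
  the truncation error.\<close>

lemma abs_has_sum_summand_le:
  assumes s: "(summand u has_sum s) A" and A: "A \<subseteq> K"
    and q: "\<And>k. k \<in> A \<Longrightarrow> q k \<le> e" and "e \<ge> 0"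
  shows "\<bar>s\<bar> \<le> e * (1 + (norm y)\<^sup>2) * (1 + (norm u)\<^sup>2)"
proof -
  have fin: "(\<Sum>k\<in>X. \<bar>summand u k\<bar>) \<le> e * (1 + (norm y)\<^sup>2) * (1 + (norm u)\<^sup>2)"
    if X: "finite X" "X \<subseteq> A" for X
  proof -
    have "(\<Sum>k\<in>X. \<bar>summand u k\<bar>) \<le> (\<Sum>k\<in>X. e * ((inner u (\<phi> k))\<^sup>2 + (inner y (\<phi> k))\<^sup>2))"
    proof (rule sum_mono)
      fix k assume "k \<in> X"
      then have k: "k \<in> A" "k \<in> K" using X A by auto
      show "\<bar>summand u k\<bar> \<le> e * ((inner u (\<phi> k))\<^sup>2 + (inner y (\<phi> k))\<^sup>2)"
        by (rule order_trans[OF abs_summand_le[OF k(2)]]) (intro mult_right_mono q k, simp)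
    qed
    also have "\<dots> = e * ((\<Sum>k\<in>X. (inner u (\<phi> k))\<^sup>2) + (\<Sum>k\<in>X. (inner y (\<phi> k))\<^sup>2))"
      by (simp add: sum_distrib_left sum.distrib distrib_left)
    also have "\<dots> \<le> e * ((norm u)\<^sup>2 + (norm y)\<^sup>2)"
      using X A \<open>e \<ge> 0\<close> by (intro mult_left_mono add_mono Bessel_finite) auto
    also have "\<dots> \<le> e * ((1 + (norm y)\<^sup>2) * (1 + (norm u)\<^sup>2))"
      using \<open>e \<ge> 0\<close> by (intro mult_left_mono) (auto simp: algebra_simps)
    finally show ?thesis by (simp add: mult.assoc)
  qed
  have "s \<le> e * (1 + (norm y)\<^sup>2) * (1 + (norm u)\<^sup>2)"
  proof (rule has_sum_le_finite_sums[OF s])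
    fix X assume "finite X" "X \<subseteq> A"
    then show "sum (summand u) X \<le> e * (1 + (norm y)\<^sup>2) * (1 + (norm u)\<^sup>2)"
      by (intro order_trans[OF sum_mono fin]) auto
  qed
  moreover have "- s \<le> e * (1 + (norm y)\<^sup>2) * (1 + (norm u)\<^sup>2)"
  proof (rule has_sum_le_finite_sums)
    show "((\<lambda>k. - summand u k) has_sum - s) A" using s by (simp add: has_sum_uminus)
    fix X assume "finite X" "X \<subseteq> A"
    then show "(\<Sum>k\<in>X. - summand u k) \<le> e * (1 + (norm y)\<^sup>2) * (1 + (norm u)\<^sup>2)"
      by (intro order_trans[OF sum_mono fin]) auto
  qed
  ultimately show ?thesis by linarith
qed

section \<open>Truncation of the potential\<close>

lemma potential_truncated:
  "\<Phi> (\<Sum>k\<in>F n. inner u (\<phi> k) *\<^sub>R \<phi> k) = (\<Sum>k\<in>F n. summand u k)"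
proof -
  let ?p = "\<Sum>k\<in>F n. inner u (\<phi> k) *\<^sub>R \<phi> k"
  have coord: "inner ?p (\<phi> k) = (if k \<in> F n then inner u (\<phi> k) else 0)" if "k \<in> K" for k
    by (rule inner_sum_basis[OF finite_F F_subset that])
  have "(summand ?p has_sum (\<Sum>k\<in>F n. summand ?p k)) K"
    by (rule has_sum_finite_neutralI[OF finite_F F_subset[of n]]) (auto simp: coord summand_def)
  also have "(\<Sum>k\<in>F n. summand ?p k) = (\<Sum>k\<in>F n. summand u k)"
    using F_subset by (intro sum.cong) (auto simp: coord summand_def subset_iff)
  finally show ?thesis using potential_has_sum has_sum_unique by blast
qed

lemma potential_truncation_error:
  assumes "\<And>k. k \<in> K - F n \<Longrightarrow> q k \<le> e" "e \<ge> 0"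
  shows "\<bar>\<Phi> u - \<Phi> (\<Sum>k\<in>F n. inner u (\<phi> k) *\<^sub>R \<phi> k)\<bar> \<le> e * (1 + (norm y)\<^sup>2) * (1 + (norm u)\<^sup>2)"
proof (rule abs_has_sum_summand_le)
  show "(summand u has_sum (\<Phi> u - \<Phi> (\<Sum>k\<in>F n. inner u (\<phi> k) *\<^sub>R \<phi> k))) (K - F n)"
    unfolding potential_truncated
    by (intro has_sum_Diff potential_has_sum has_sum_finite finite_F F_subset)
qed (use assms in auto)

lemma truncated_potential_tendsto:
  "(\<lambda>n. \<Phi> (\<Sum>k\<in>F n. inner u (\<phi> k) *\<^sub>R \<phi> k)) \<longlonglongrightarrow> \<Phi> u"
  unfolding potential_truncated by (rule has_sum_tendsto_F[OF potential_has_sum])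

section \<open>Measurability and integrability under the Gaussian prior\<close>

context
  fixes M :: "'h measure" and m :: 'h and C :: "'h \<Rightarrow> 'h" and c :: real
  assumes M: "gaussian_on (closure (span (\<phi> ` K))) M m C"
    and C: "\<And>h. 0 \<le> inner (C h) h" "\<And>h. inner (C h) h \<le> c * (norm h)\<^sup>2"
    and "c \<ge> 0"
begin

lemma inner_measurable [measurable]: "(\<lambda>u. inner u h) \<in> borel_measurable M"
  by (rule gaussian_on_measurable[OF M]) (intro borel_measurable_continuous_onI continuous_intros)

lemma truncated_potential_measurable [measurable]:
  "(\<lambda>u. \<Phi> (\<Sum>k\<in>F n. inner u (\<phi> k) *\<^sub>R \<phi> k)) \<in> borel_measurable M"
  unfolding potential_truncated summand_def by measurable

text \<open>The potential is built from unordered infinite sums; measurability comes from the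
  sequence of truncations, each a finite expression in the coordinates.\<close>

lemma potential_measurable [measurable]: "\<Phi> \<in> borel_measurable M"
  by (rule borel_measurable_LIMSEQ_real[OF truncated_potential_tendsto]) simp

text \<open>Mean plus half the variance of a linear functional of norm at most
  \<open>2 * Q * norm y\<close>. This norm bounds, for every truncation, the linear part of -2
  \<Phi>; \<open>c\<close> bounds the quadratic form of the covariance.\<close>

definition exp_bound :: real where
  "exp_bound = exp (norm m * (2 * Q * norm y) + c * (2 * Q * norm y)\<^sup>2 / 2)"

text \<open>
  Dropping the quadratic part of the potential leaves a linear functional of \<open>u\<close>, whose exponential
  moment is explicit; this replaces Fernique's theorem.
\<close>

lemma nn_integral_exp_truncated_potential:
  "(\<integral>\<^sup>+u. ennreal (exp (- 2 * \<Phi> (\<Sum>k\<in>F n. inner u (\<phi> k) *\<^sub>R \<phi> k))) \<partial>M) \<le> ennreal exp_bound"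
proof -
  define h where "h = (\<Sum>k\<in>F n. (2 * q k * inner y (\<phi> k)) *\<^sub>R \<phi> k)"
  have "- 2 * summand u k \<le> (2 * q k * inner y (\<phi> k)) * inner u (\<phi> k)" for u k
    using q_nonneg[of k] by (simp add: summand_def right_diff_distrib)
  then have "(\<Sum>k\<in>F n. - 2 * summand u k) \<le> (\<Sum>k\<in>F n. (2 * q k * inner y (\<phi> k)) * inner u (\<phi> k))" for u
    by (intro sum_mono)
  then have "- 2 * \<Phi> (\<Sum>k\<in>F n. inner u (\<phi> k) *\<^sub>R \<phi> k) \<le> inner u h" for u
    unfolding potential_truncated h_def by (simp add: inner_sum_right sum_distrib_left sum_negf)
  then have "(\<integral>\<^sup>+u. ennreal (exp (- 2 * \<Phi> (\<Sum>k\<in>F n. inner u (\<phi> k) *\<^sub>R \<phi> k))) \<partial>M)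
      \<le> (\<integral>\<^sup>+u. ennreal (exp (inner u h)) \<partial>M)"
    by (intro nn_integral_mono ennreal_leI) simp
  also have "\<dots> = ennreal (exp (inner m h + inner (C h) h / 2))"
  proof (rule gaussian_on_exp_inner[OF M _ C(1)])
    have "h \<in> span (\<phi> ` K)"
      unfolding h_def using F_subset by (intro span_sum span_scale span_base) auto
    then show "h \<in> closure (span (\<phi> ` K))" using closure_subset by blast
  qed
  also have "\<dots> \<le> ennreal exp_bound"
  proof -
    have "(norm h)\<^sup>2 = (\<Sum>k\<in>F n. (2 * q k)\<^sup>2 * (inner y (\<phi> k))\<^sup>2)"
      unfolding h_def by (subst norm_sum_basis[OF finite_F F_subset]) (simp add: power_mult_distrib)
    also have "\<dots> \<le> (\<Sum>k\<in>F n. (2 * Q)\<^sup>2 * (inner y (\<phi> k))\<^sup>2)"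
      using F_subset q_nonneg q_le_Q by (intro sum_mono mult_right_mono power_mono) auto
    also have "\<dots> \<le> (2 * Q)\<^sup>2 * (norm y)\<^sup>2"
      unfolding sum_distrib_left[symmetric]
      by (intro mult_left_mono Bessel_finite finite_F F_subset) simp
    finally have h2: "(norm h)\<^sup>2 \<le> (2 * Q * norm y)\<^sup>2" by (simp add: power_mult_distrib)
    then have h1: "norm h \<le> 2 * Q * norm y"
      by (rule power2_le_imp_le) (use Q_pos in simp)
    have "inner m h \<le> norm m * norm h" by (rule norm_cauchy_schwarz)
    also have "\<dots> \<le> norm m * (2 * Q * norm y)" using h1 by (intro mult_left_mono) auto
    finally have "inner m h \<le> norm m * (2 * Q * norm y)" .
    moreover have "inner (C h) h \<le> c * (2 * Q * norm y)\<^sup>2"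
      by (rule order_trans[OF C(2) mult_left_mono[OF h2 \<open>c \<ge> 0\<close>]])
    ultimately show ?thesis
      unfolding exp_bound_def by (intro ennreal_leI) simp
  qed
  finally show ?thesis .
qed

text \<open>Fatou's lemma preserves the constant, so the full potential and all truncations share
  one exponential bound.\<close>

lemma nn_integral_exp_potential:
  "(\<integral>\<^sup>+u. ennreal (exp (- 2 * \<Phi> u)) \<partial>M) \<le> ennreal exp_bound"
proof -
  have "(\<integral>\<^sup>+u. ennreal (exp (- 2 * \<Phi> u)) \<partial>M)
      = (\<integral>\<^sup>+u. liminf (\<lambda>n. ennreal (exp (- 2 * \<Phi> (\<Sum>k\<in>F n. inner u (\<phi> k) *\<^sub>R \<phi> k)))) \<partial>M)"
    by (intro nn_integral_cong lim_imp_Liminf[symmetric])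
       (auto intro!: tendsto_ennrealI tendsto_exp tendsto_mult tendsto_minus truncated_potential_tendsto)
  also have "\<dots> \<le> liminf (\<lambda>n. \<integral>\<^sup>+u. ennreal (exp (- 2 * \<Phi> (\<Sum>k\<in>F n. inner u (\<phi> k) *\<^sub>R \<phi> k))) \<partial>M)"
    by (rule nn_integral_liminf) simp
  also have "\<dots> \<le> liminf (\<lambda>n. ennreal exp_bound)"
    by (intro Liminf_mono always_eventually allI nn_integral_exp_truncated_potential)
  finally show ?thesis by (simp add: Liminf_const)
qed

lemma fourth_moment_space:
  assumes "\<And>k c. k \<in> K \<Longrightarrow> inner (C (c *\<^sub>R \<phi> k)) (c *\<^sub>R \<phi> k) = c\<^sup>2 * v k"
    and "\<And>k. k \<in> K \<Longrightarrow> 0 < v k" "v summable_on K"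
  shows "fourth_moment_space M"
proof -
  interpret prob_space M using M by (simp add: gaussian_on_def)
  show ?thesis
  proof
    show "(\<lambda>u. u) \<in> borel_measurable M" by (rule gaussian_on_measurable[OF M]) simp
    show "integrable M (\<lambda>u. (1 + (norm u)\<^sup>2) ^ 4)"
      by (rule gaussian_fourth_moment[OF M assms])
  qed
qed

lemma admissible_potentials:
  assumes "fourth_moment_space M"
  shows "fourth_moment_space.admissible M (Q * (1 + (norm y)\<^sup>2)) exp_bound \<Phi>"
    and "fourth_moment_space.admissible M (Q * (1 + (norm y)\<^sup>2)) exp_bound
      (\<lambda>u. \<Phi> (\<Sum>k\<in>F n. inner u (\<phi> k) *\<^sub>R \<phi> k))"
proof -
  interpret fourth_moment_space M by fact
  have b: "0 \<le> exp_bound" by (simp add: exp_bound_def)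
  note I = integral_le_of_nn_integral_le[OF _ _ b nn_integral_exp_potential]
  note J = integral_le_of_nn_integral_le[OF _ _ b nn_integral_exp_truncated_potential[of n]]
  have "\<bar>\<Phi> u\<bar> \<le> Q * (1 + (norm y)\<^sup>2) * (1 + (norm u)\<^sup>2)" for u
    using Q_pos by (intro abs_has_sum_summand_le[OF potential_has_sum] q_le_Q) auto
  then show "admissible (Q * (1 + (norm y)\<^sup>2)) exp_bound \<Phi>"
    unfolding admissible_def using I by simp
  have "\<bar>\<Phi> (\<Sum>k\<in>F n. inner u (\<phi> k) *\<^sub>R \<phi> k)\<bar> \<le> Q * (1 + (norm y)\<^sup>2) * (1 + (norm u)\<^sup>2)" for u
    unfolding potential_truncated using Q_pos F_subset
    by (intro abs_has_sum_summand_le[OF has_sum_finite[OF finite_F]] q_le_Q) auto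
  then show "admissible (Q * (1 + (norm y)\<^sup>2)) exp_bound (\<lambda>u. \<Phi> (\<Sum>k\<in>F n. inner u (\<phi> k) *\<^sub>R \<phi> k))"
    unfolding admissible_def using J by simp
qed

end

end

section \<open>Summability over the integer lattice\<close>

text \<open>On the nonnegative and on the negative integers separately, \<open>\<bar>n\<bar>\<close>
  is injective, so each half is at most a series over the naturals, which converges because
  \<open>2 * p > 1\<close>.\<close>

lemma lattice_factor_sum_bounded:
  fixes p :: real
  assumes "p > 1/2"
  obtains B where "B \<ge> 0" "\<And>X. finite X \<Longrightarrow> (\<Sum>n\<in>X. (1 + (real_of_int n)\<^sup>2) powr (- p)) \<le> B"
proof -
  define c where "c n = (1 + (real n)\<^sup>2) powr (- p)" for n
  have c: "summable c"
  proof (rule summable_comparison_test')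
    show "summable (\<lambda>n. real n powr (- 2 * p))" using assms by (subst summable_real_powr_iff) simp
    \<comment> \<open>The comparison starts at 1: at 0 the left side is 1, while
      \<open>0 powr _\<close> is 0.\<close>
    show "norm (c n) \<le> real n powr (- 2 * p)" if "1 \<le> n" for n
    proof -
      have "c n \<le> ((real n)\<^sup>2) powr (- p)"
        unfolding c_def using assms that by (intro powr_mono2') auto
      also have "\<dots> = real n powr (- 2 * p)"
      proof -
        have "(real n)\<^sup>2 = real n powr 2" using that by simp
        then show ?thesis by (simp only: powr_powr) simp
      qed
      finally show ?thesis by (simp add: c_def)
    qed
  qed
  have le: "(\<Sum>n\<in>X. (1 + (real_of_int n)\<^sup>2) powr (- p)) \<le> suminf c"
    if "finite X" "inj_on (\<lambda>n. nat \<bar>n\<bar>) X" for X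
  proof -
    have "(\<Sum>n\<in>X. (1 + (real_of_int n)\<^sup>2) powr (- p)) = (\<Sum>n\<in>X. c (nat \<bar>n\<bar>))"
      by (simp add: c_def)
    also have "\<dots> = sum c ((\<lambda>n. nat \<bar>n\<bar>) ` X)"
      by (rule sum.reindex_cong[OF that(2), symmetric]) auto
    also have "\<dots> \<le> suminf c"
      using that by (intro sum_le_suminf c) (auto simp: c_def)
    finally show ?thesis .
  qed
  show ?thesis
  proof
    show "0 \<le> 2 * suminf c" using suminf_nonneg[OF c] by (simp add: c_def)
    fix X :: "int set" assume X: "finite X"
    have "X = (X \<inter> {0..}) \<union> (X \<inter> {..<0})" by auto
    then have "(\<Sum>n\<in>X. (1 + (real_of_int n)\<^sup>2) powr (- p))
        = (\<Sum>n\<in>X \<inter> {0..}. (1 + (real_of_int n)\<^sup>2) powr (- p)) + (\<Sum>n\<in>X \<inter> {..<0}. (1 + (real_of_int n)\<^sup>2) powr (- p))"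
      using X by (subst sum.union_disjoint[symmetric]) auto
    also have "\<dots> \<le> suminf c + suminf c"
      using X by (intro add_mono le) (auto simp: inj_on_def)
    finally show "(\<Sum>n\<in>X. (1 + (real_of_int n)\<^sup>2) powr (- p)) \<le> 2 * suminf c" by simp
  qed
qed

lemma multi_index_norm_component: "\<bar>real_of_int (k $ i)\<bar> \<le> multi_index_norm k"
  using component_le_norm_cart[of "\<chi> i. real_of_int (k $ i)" i] by (simp add: multi_index_norm_def)

lemma multi_index_norm_ge_1:
  assumes "k \<noteq> 0"
  shows "1 \<le> multi_index_norm k"
proof -
  obtain i where "k $ i \<noteq> 0" using assms by (auto simp: vec_eq_iff)
  then have "1 \<le> \<bar>real_of_int (k $ i)\<bar>" by linarith
  then show ?thesis using multi_index_norm_component[of k i] by linarith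
qed

text \<open>
  Since \<open>1 + k\<^sub>i\<^sup>2 \<le> 2 |k|\<^sup>2\<close> for every coordinate, the lattice sum is dominated by a product of
  one-dimensional sums.
\<close>

lemma lattice_sum:
  fixes \<alpha> :: real
  assumes \<alpha>: "\<alpha> > real CARD('d::finite) / 2"
  shows "(\<lambda>k :: int ^ 'd. ((multi_index_norm k)\<^sup>2) powr (- \<alpha>)) summable_on (- {0})"
proof -
  define d where "d = real CARD('d)"
  have d: "d > 0" by (simp add: d_def)
  \<comment> \<open>The exponent is shared equally among the \<open>d\<close> coordinates, so that
    \<alpha> > d / 2 becomes convergence of each one-dimensional sum.\<close>
  define p where "p = \<alpha> / d"
  have p: "p > 1/2" "p * d = \<alpha>" using \<alpha> d by (auto simp: p_def d_def[symmetric] field_simps)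
  obtain B where B: "B \<ge> 0" "\<And>X. finite X \<Longrightarrow> (\<Sum>n\<in>X. (1 + (real_of_int n)\<^sup>2) powr (- p)) \<le> B"
    using lattice_factor_sum_bounded[OF p(1)] by blast
  define g where "g n = (1 + (real_of_int n)\<^sup>2) powr (- p)" for n
  have pt: "((multi_index_norm k)\<^sup>2) powr (- \<alpha>) \<le> 2 powr \<alpha> * (\<Prod>i\<in>UNIV. g (k $ i))"
    if "k \<noteq> 0" for k :: "int ^ 'd"
  proof -
    define s where "s = (multi_index_norm k)\<^sup>2"
    have s: "1 \<le> s" using multi_index_norm_ge_1[OF that] by (simp add: s_def)
    have "(2 * s) powr (- p) \<le> g (k $ i)" for i
      unfolding g_def
    proof (rule powr_mono2')
      have "\<bar>real_of_int (k $ i)\<bar>\<^sup>2 \<le> s"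
        unfolding s_def by (intro power_mono multi_index_norm_component) simp
      then show "1 + (real_of_int (k $ i))\<^sup>2 \<le> 2 * s" using s by simp
      show "0 < 1 + (real_of_int (k $ i))\<^sup>2" by (simp add: add_pos_nonneg)
    qed (use p in simp)
    then have "(\<Prod>i\<in>(UNIV :: 'd set). (2 * s) powr (- p)) \<le> (\<Prod>i\<in>UNIV. g (k $ i))"
      by (intro prod_mono) auto
    moreover have "(\<Prod>i\<in>(UNIV :: 'd set). (2 * s) powr (- p)) = (2 * s) powr (- \<alpha>)"
      using s p(2) by (simp add: powr_power d_def mult.commute)
    moreover have "2 powr \<alpha> * (2 * s) powr (- \<alpha>) = s powr (- \<alpha>)"
      using s by (simp add: powr_mult flip: mult.assoc powr_add)
    ultimately show ?thesis
      unfolding s_def[symmetric] by (metis mult_left_mono powr_ge_zero)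
  qed
  show ?thesis
  proof (rule nonneg_bdd_above_summable_on)
    show "bdd_above (sum (\<lambda>k :: int ^ 'd. ((multi_index_norm k)\<^sup>2) powr (- \<alpha>)) ` {X. X \<subseteq> - {0} \<and> finite X})"
    proof (rule bdd_aboveI2)
      fix X :: "(int ^ 'd) set" assume "X \<in> {X. X \<subseteq> - {0} \<and> finite X}"
      then have X: "X \<subseteq> - {0}" "finite X" by auto
      have "(\<Sum>k\<in>X. ((multi_index_norm k)\<^sup>2) powr (- \<alpha>)) \<le> (\<Sum>k\<in>X. 2 powr \<alpha> * (\<Prod>i\<in>UNIV. g (k $ i)))"
        using X by (intro sum_mono pt) auto
      also have "\<dots> = 2 powr \<alpha> * (\<Sum>f\<in>vec_nth ` X. \<Prod>i\<in>UNIV. g (f i))"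
        by (subst sum.reindex) (auto simp: sum_distrib_left inj_on_def vec_eq_iff)
      \<comment> \<open>\<open>X\<close> lies in the box spanned by its coordinate projections; over
        a box the sum of products factorises.\<close>
      also have "(\<Sum>f\<in>vec_nth ` X. \<Prod>i\<in>UNIV. g (f i))
          \<le> (\<Sum>f\<in>PiE UNIV (\<lambda>i. (\<lambda>k. k $ i) ` X). \<Prod>i\<in>UNIV. g (f i))"
        using X by (intro sum_mono2 finite_PiE) (auto simp: g_def intro!: prod_nonneg)
      also have "\<dots> = (\<Prod>i\<in>UNIV. \<Sum>n\<in>(\<lambda>k. k $ i) ` X. g n)"
        using X by (intro prod_sum_PiE[symmetric]) auto
      also have "\<dots> \<le> (\<Prod>i\<in>(UNIV :: 'd set). B)"
      proof (rule prod_mono, rule conjI)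
        fix i :: 'd
        show "0 \<le> (\<Sum>n\<in>(\<lambda>k. k $ i) ` X. g n)" by (rule sum_nonneg) (simp add: g_def)
        show "(\<Sum>n\<in>(\<lambda>k. k $ i) ` X. g n) \<le> B" unfolding g_def by (rule B(2)) (use X in simp)
      qed
      finally show "(\<Sum>k\<in>X. ((multi_index_norm k)\<^sup>2) powr (- \<alpha>)) \<le> 2 powr \<alpha> * (\<Prod>i\<in>(UNIV :: 'd set). B)"
        by (simp add: mult_left_mono)
    qed
  qed simp
qed

lemma finite_multi_index_ball: "finite {k :: int ^ 'd. multi_index_norm k \<le> r}"
proof (rule finite_imageD)
  show "finite (vec_nth ` {k :: int ^ 'd. multi_index_norm k \<le> r})"
  proof (rule finite_subset)
    show "finite (PiE (UNIV :: 'd set) (\<lambda>_. {- \<lceil>r\<rceil>..\<lceil>r\<rceil>}))" by (intro finite_PiE) auto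
    show "vec_nth ` {k :: int ^ 'd. multi_index_norm k \<le> r} \<subseteq> PiE UNIV (\<lambda>_. {- \<lceil>r\<rceil>..\<lceil>r\<rceil>})"
    proof -
      have "k $ i \<in> {- \<lceil>r\<rceil>..\<lceil>r\<rceil>}" if "multi_index_norm k \<le> r" for k :: "int ^ 'd" and i
      proof -
        have "\<bar>real_of_int (k $ i)\<bar> \<le> r"
          using that multi_index_norm_component[of k i] by linarith
        then have "- \<lceil>r\<rceil> \<le> k $ i \<and> k $ i \<le> \<lceil>r\<rceil>" by linarith
        then show ?thesis by simp
      qed
      then show ?thesis by (auto simp: PiE_iff)
    qed
  qed
qed (auto simp: inj_on_def vec_eq_iff)

section \<open>Spectral approximation of the posterior\<close>

text \<open>Total mass one and square integrability accompany the estimates, so that the integrals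
  behind \<open>mean_of\<close> and \<open>covariance_op\<close> are genuine rather than the default
  0. A single \<open>c2\<close> serves all three estimates.\<close>

theorem theorem3p3:
  fixes D :: "(real ^ 'd) set"
    and K :: "(int ^ 'd) set"
    and \<phi> :: "int ^ 'd \<Rightarrow> (real ^ 'd) L2"
    and lam :: "int ^ 'd \<Rightarrow> real"
    and T \<alpha> \<beta> \<gamma> \<delta> :: real
    and m0 y :: "(real ^ 'd) L2"
    and \<Phi> :: "(real ^ 'd) L2 \<Rightarrow> real"
    and P :: "nat \<Rightarrow> (real ^ 'd) L2 \<Rightarrow> (real ^ 'd) L2"
    and \<mu>0 \<mu> :: "(real ^ 'd) L2 measure"
    and \<mu>N :: "nat \<Rightarrow> (real ^ 'd) L2 measure"
  assumes "smooth_bounded_domain D"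
    and "dirichlet_eigenbasis D K \<phi> lam"
    and "T > 0" and "\<beta> > 0" and "\<delta> > 0"
    and "\<alpha> > real CARD('d) / 2" and "\<gamma> > real CARD('d) / 2"
    and "m0 \<in> sobolev_scale (L2_on D) K \<phi> lam \<alpha>"
    and "y \<in> L2_on D"
    and "gaussian_on (L2_on D) \<mu>0 m0 (\<lambda>h. \<beta> *\<^sub>R op_power K \<phi> lam (-\<alpha>) h)"
    and "\<Phi> = potential K \<phi> lam T \<delta> \<gamma> y"
    and "\<And>N. P N = orth_proj (span (\<phi> ` {k\<in>K. multi_index_norm k \<le> real N}))"
    and "\<mu> = posterior \<mu>0 \<Phi>"
    and "\<And>N. \<mu>N N = posterior \<mu>0 (\<lambda>u. \<Phi> (P N u))"
  shows "prob_space \<mu> \<and> integrable \<mu> (\<lambda>u. (norm u)\<^sup>2) \<and>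
    (\<forall>N. prob_space (\<mu>N N) \<and> integrable (\<mu>N N) (\<lambda>u. (norm u)\<^sup>2)) \<and>
    (\<exists>c1>0. \<exists>c2>0.
      (\<forall>N. hellinger_dist \<mu>0 \<mu> (\<mu>N N) \<le> c1 * exp (- c2 * (real N)\<^sup>2)) \<and>
      (\<lambda>N. norm (mean_of \<mu> - mean_of (\<mu>N N))) \<in> O(\<lambda>N. exp (- c2 * (real N)\<^sup>2)) \<and>
      (\<lambda>N. onorm (\<lambda>h. covariance_op \<mu> h - covariance_op (\<mu>N N) h)) \<in> O(\<lambda>N. exp (- c2 * (real N)\<^sup>2)))"
proof -
  define F where "F N = {k\<in>K. multi_index_norm k \<le> real N}" for N
  have K0: "0 \<notin> K" and H: "closure (span (\<phi> ` K)) = L2_on D"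
    and orth: "\<And>j k. j \<in> K \<Longrightarrow> k \<in> K \<Longrightarrow> inner (\<phi> j) (\<phi> k) = (if j = k then 1 else 0)"
    using assms(2) by (auto simp: dirichlet_eigenbasis_def)
  obtain c where c: "c > 0" "\<And>k. k \<in> K \<Longrightarrow> c * (multi_index_norm k)\<^sup>2 \<le> lam k"
    using assms(2) unfolding dirichlet_eigenbasis_def by blast
  have norm_ge: "1 \<le> multi_index_norm k" if "k \<in> K" for k
    using that K0 by (intro multi_index_norm_ge_1) auto
  \<comment> \<open>Nonzero integer vectors have norm at least 1, so the spectrum stays away from 0
    and negative powers of the eigenvalues are bounded.\<close>
  have lam_ge: "c \<le> lam k" if "k \<in> K" for k
  proof -
    have "c * 1 \<le> c * (multi_index_norm k)\<^sup>2"
      using c norm_ge[OF that] by (intro mult_left_mono) auto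
    then show ?thesis using c(2)[OF that] by linarith
  qed
  have pos: "\<alpha> > 0" "\<gamma> > 0" using assms(6,7) by (meson divide_nonneg_nonneg le_less_trans of_nat_0_le_iff zero_le_numeral)+
  interpret backward_heat K \<phi> F lam T \<delta> \<gamma> y
  proof
    show "finite (F n)" for n
      unfolding F_def by (rule finite_subset[OF _ finite_multi_index_ball[of "real n"]]) auto
    show "\<forall>\<^sub>F n in sequentially. k \<in> F n" if "k \<in> K" for k
      using eventually_ge_at_top[of "nat \<lceil>multi_index_norm k\<rceil>"]
      by eventually_elim (use that in \<open>auto simp: F_def nat_le_iff ceiling_le_iff\<close>)
    show "0 < lam k" if "k \<in> K" for k using lam_ge[OF that] c(1) by linarith
  qed (use assms pos orth in \<open>auto simp: F_def\<close>)
  define C where "C h = \<beta> *\<^sub>R op_power K \<phi> lam (- \<alpha>) h" for h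
  have M: "gaussian_on (closure (span (\<phi> ` K))) \<mu>0 m0 C"
    using assms(10) unfolding H C_def .
  have eig: "\<bar>lam k powr (- \<alpha>)\<bar> \<le> c powr (- \<alpha>)" if "k \<in> K" for k
    using lam_ge[OF that] c(1) pos by (simp add: powr_mono2')
  have hs: "((\<lambda>k. lam k powr (- \<alpha>) * (inner h (\<phi> k))\<^sup>2) has_sum inner (op_power K \<phi> lam (- \<alpha>) h) h) K" for h
    using has_sum_inner_spectral_op[of "\<lambda>k. lam k powr (- \<alpha>)" "c powr (- \<alpha>)" h h] eig
    unfolding op_power_def by (simp add: power2_eq_square mult.assoc)
  have C_nonneg: "0 \<le> inner (C h) h" for h
    using has_sum_nonneg[OF hs[of h]] assms(4) by (simp add: C_def)
  have C_le: "inner (C h) h \<le> \<beta> * c powr (- \<alpha>) * (norm h)\<^sup>2" for h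
  proof -
    have "inner (op_power K \<phi> lam (- \<alpha>) h) h \<le> c powr (- \<alpha>) * (norm h)\<^sup>2"
    proof (rule has_sum_le_finite_sums[OF hs])
      fix X assume X: "finite X" "X \<subseteq> K"
      then have "(\<Sum>k\<in>X. lam k powr (- \<alpha>) * (inner h (\<phi> k))\<^sup>2) \<le> (\<Sum>k\<in>X. c powr (- \<alpha>) * (inner h (\<phi> k))\<^sup>2)"
        using eig by (intro sum_mono mult_right_mono) auto
      also have "\<dots> \<le> c powr (- \<alpha>) * (norm h)\<^sup>2"
        unfolding sum_distrib_left[symmetric] by (intro mult_left_mono Bessel_finite X) simp
      finally show "(\<Sum>k\<in>X. lam k powr (- \<alpha>) * (inner h (\<phi> k))\<^sup>2) \<le> c powr (- \<alpha>) * (norm h)\<^sup>2" .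
    qed
    then show ?thesis using assms(4) by (simp add: C_def mult.assoc)
  qed
  have C_basis: "inner (C (t *\<^sub>R \<phi> k)) (t *\<^sub>R \<phi> k) = t\<^sup>2 * (\<beta> * lam k powr (- \<alpha>))" if "k \<in> K" for k t
    using inner_spectral_op_basis[of "\<lambda>k. lam k powr (- \<alpha>)" "c powr (- \<alpha>)" k "t *\<^sub>R \<phi> k"] eig that orth
    by (simp add: C_def op_power_def power2_eq_square)
  \<comment> \<open>The prior covariance has finite trace; this is where \<alpha> > d / 2 enters,
    through the lattice sum.\<close>
  have cov_summable: "(\<lambda>k. \<beta> * lam k powr (- \<alpha>)) summable_on K"
  proof (rule summable_on_comparison_test)
    have "(\<lambda>k. ((multi_index_norm k)\<^sup>2) powr (- \<alpha>)) summable_on K"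
      by (rule summable_on_subset_banach[OF lattice_sum[OF assms(6)]]) (use K0 in auto)
    then show "(\<lambda>k. \<beta> * c powr (- \<alpha>) * ((multi_index_norm k)\<^sup>2) powr (- \<alpha>)) summable_on K"
      by (rule summable_on_cmult_right)
    show "\<beta> * lam k powr (- \<alpha>) \<le> \<beta> * c powr (- \<alpha>) * ((multi_index_norm k)\<^sup>2) powr (- \<alpha>)" if "k \<in> K" for k
    proof -
      have "lam k powr (- \<alpha>) \<le> (c * (multi_index_norm k)\<^sup>2) powr (- \<alpha>)"
        using c(2)[OF that] norm_ge[OF that] c(1) pos by (intro powr_mono2') auto
      also have "\<dots> = c powr (- \<alpha>) * ((multi_index_norm k)\<^sup>2) powr (- \<alpha>)"
        using c(1) by (simp add: powr_mult)
      finally show ?thesis using assms(4) by (simp add: mult.assoc)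
    qed
    show "0 \<le> \<beta> * lam k powr (- \<alpha>)" for k using assms(4) by simp
  qed
  note bounds = M C_nonneg C_le
  have cc: "0 \<le> \<beta> * c powr (- \<alpha>)" using assms(4) by simp
  have fm: "fourth_moment_space \<mu>0"
    by (rule fourth_moment_space[OF bounds cc C_basis _ cov_summable]) (use assms(4) lam_pos in force)+
  interpret fourth_moment_space \<mu>0 by fact
  \<comment> \<open>The summand 1 keeps \<open>L\<close>, and with it the final constant
    \<open>S * L\<close>, positive even for \<open>y = 0\<close>.\<close>
  define Y where "Y = 1 + (norm y)\<^sup>2"
  define B where "B = exp_bound m0 (\<beta> * c powr (- \<alpha>))"
  define L where "L = Q * Y"
  have L: "L \<ge> 0" using Q_pos by (simp add: L_def Y_def)
  have P: "P N u = (\<Sum>k\<in>F N. inner u (\<phi> k) *\<^sub>R \<phi> k)" for N u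
    unfolding assms(12) F_def[symmetric] by (rule orth_proj_span[OF finite_F F_subset])
  have adm: "admissible L B \<Phi>" "admissible L B (\<lambda>u. \<Phi> (P N u))" for N
    using admissible_potentials[OF bounds cc fm] unfolding L_def B_def Y_def P assms(11) by blast+
  \<comment> \<open>The rate \<open>T / 2\<close> left over in \<open>q_le\<close>, times the
    constant of the quadratic lower bound on the eigenvalues.\<close>
  define c2 where "c2 = c * T / 2"
  define \<epsilon> where "\<epsilon> N = L * exp (- c2 * (real N)\<^sup>2)" for N
  have diff: "\<bar>\<Phi> u - \<Phi> (P N u)\<bar> \<le> \<epsilon> N * (1 + (norm u)\<^sup>2)" for u N
  proof -
    have "q k \<le> Q * exp (- c2 * (real N)\<^sup>2)" if k: "k \<in> K - F N" for k
    proof -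
      have "c * (real N)\<^sup>2 \<le> c * (multi_index_norm k)\<^sup>2"
        using k c(1) by (intro mult_left_mono power_mono) (auto simp: F_def)
      then have "c * (real N)\<^sup>2 \<le> lam k" using c(2)[of k] k by auto
      then have "- (T / 2) * lam k \<le> - c2 * (real N)\<^sup>2"
        using mult_left_mono[of "c * (real N)\<^sup>2" "lam k" "T / 2"] assms(3) by (simp add: c2_def ac_simps)
      then have "Q * exp (- (T / 2) * lam k) \<le> Q * exp (- c2 * (real N)\<^sup>2)"
        using Q_pos by (intro mult_left_mono) auto
      then show ?thesis using q_le[of k] k by auto
    qed
    then have "\<bar>\<Phi> u - \<Phi> (P N u)\<bar> \<le> Q * exp (- c2 * (real N)\<^sup>2) * (1 + (norm y)\<^sup>2) * (1 + (norm u)\<^sup>2)"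
      unfolding P assms(11) using Q_pos by (intro potential_truncation_error) auto
    then show ?thesis by (simp add: \<epsilon>_def L_def Y_def ac_simps)
  qed
  obtain S where S: "S > 0" and stab: "\<forall>f g \<epsilon>. admissible L B f \<longrightarrow> admissible L B g \<longrightarrow> \<epsilon> \<ge> 0 \<longrightarrow>
      (\<forall>u\<in>space \<mu>0. \<bar>f u - g u\<bar> \<le> \<epsilon> * (1 + (norm u)\<^sup>2)) \<longrightarrow>
      hellinger_dist \<mu>0 (posterior \<mu>0 f) (posterior \<mu>0 g) \<le> S * \<epsilon> \<and>
      norm (mean_of (posterior \<mu>0 f) - mean_of (posterior \<mu>0 g)) \<le> S * \<epsilon> \<and>
      \<bar>onorm (\<lambda>h. covariance_op (posterior \<mu>0 f) h - covariance_op (posterior \<mu>0 g) h)\<bar> \<le> S * \<epsilon>"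
    using posterior_stability[OF L, of B] by blast
  have est: "hellinger_dist \<mu>0 \<mu> (\<mu>N N) \<le> S * L * exp (- c2 * (real N)\<^sup>2) \<and>
      norm (mean_of \<mu> - mean_of (\<mu>N N)) \<le> S * L * exp (- c2 * (real N)\<^sup>2) \<and>
      \<bar>onorm (\<lambda>h. covariance_op \<mu> h - covariance_op (\<mu>N N) h)\<bar> \<le> S * L * exp (- c2 * (real N)\<^sup>2)" for N
    using stab[rule_format, OF adm(1) adm(2)[of N] _ diff] L
    unfolding assms(13) assms(14)[of N] by (simp add: \<epsilon>_def mult.assoc)
  have "S * L > 0" "c2 > 0"
    using S Q_pos c(1) assms(3) by (simp_all add: L_def Y_def c2_def add_pos_nonneg)
  moreover have "(\<lambda>N. norm (mean_of \<mu> - mean_of (\<mu>N N))) \<in> O(\<lambda>N. exp (- c2 * (real N)\<^sup>2))"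
    by (rule bigoI[of _ "S * L"]) (use est in simp)
  moreover have "(\<lambda>N. onorm (\<lambda>h. covariance_op \<mu> h - covariance_op (\<mu>N N) h)) \<in> O(\<lambda>N. exp (- c2 * (real N)\<^sup>2))"
    by (rule bigoI[of _ "S * L"]) (use est in simp)
  moreover have "prob_space \<mu>" "integrable \<mu> (\<lambda>u. (norm u)\<^sup>2)"
    and "\<And>N. prob_space (\<mu>N N) \<and> integrable (\<mu>N N) (\<lambda>u. (norm u)\<^sup>2)"
    using prob_space_posterior integrable_posterior_sq adm L unfolding assms(13,14) by blast+
  ultimately show ?thesis using est by blast
qed

end
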